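(* Let $\tau_0\in\{0,1\}$ and let $\widehat U$ be the solution of the Fourier-side system of the context with initial datum $\widehat U_0$ ($\tau_0=0$: frictional damping; $\tau_0=1$: infinite memory). 1. If $\frac{k_1}{\rho_1}=\frac{k_2}{\rho_2}$, then for every $\xi\in\mathbb{R}$, $|\widehat U(\xi,t)|$ does not converge to zero as $t$ goes to infinity. 2. If $\frac{k_1}{\rho_1}\neq\frac{k_2}{\rho_2}$, then there exist $c,\widetilde c>0$, independent of $\xi$ and $t$, such that $$|\widehat U(\xi,t)|\le \widetilde c\,e^{-c\,f(\xi)\,t}\,|\widehat U_0(\xi)|,\qquad \forall(\xi,t)\in\mathbb{R}\times\mathbb{R}_+,$$ where $$f(\xi)=\frac{\xi^{4+2\tau_0}}{\xi^{10}+1}.$$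
   Context: $\mathbb{R}_+=[0,+\infty)$. The numbers $\rho_1,\rho_2,\rho_3,k_0,k_1,k_2,k_3,\gamma,l$ are positive real constants, and $g:\mathbb{R}_+\to\mathbb{R}_+$ is of class $C^1$ with $0<g_0:=\int_0^{+\infty}g(s)\,ds<k_3$ and $-\beta_2 g\le g'\le-\beta_1 g$ for some constants $\beta_1,\beta_2>0$. Physical systems (Rao-Nakra sandwich beam on $\mathbb{R}$), with unknown $(\varphi,\psi,w)(x,t)$: $$\rho_1\varphi_{tt}-k_1\varphi_{xx}+k_0(\varphi+\psi+lw_x)=0,\quad \rho_2\psi_{tt}-k_2\psi_{xx}+k_0(\varphi+\psi+lw_x)=0,$$ $$\rho_3w_{tt}+k_3w_{xxxx}-lk_0(\varphi+\psi+lw_x)_x+D=0,$$ where $D=\gamma w_t$ if $\tau_0=0$ and $D=-\int_0^{+\infty}g(s)w_{xxxx}(x,t-s)\,ds$ if $\tau_0=1$ (in the latter case the history $w(x,-t)$, $t\ge 0$, is prescribed). Set $$u=\varphi_t,\quad y=\psi_t,\quad \theta=w_t,\quad v=\varphi_x,\quad z=\psi_x,\quad \phi=w_{xx},\quad p=\varphi+\psi+lw_x,$$ and, if $\tau_0=1$, $\eta(x,t,s)=w(x,t)-w(x,t-s)$, $s\geq 0$. Let $U=(v,u,z,y,\phi,\theta,p)^T$ if $\tau_0=0$, $U=(v,u,z,y,\phi,\theta,p,\eta)^T$ if $\tau_0=1$, and $U_0=U|_{t=0}$. Fourier-side system: with $\widehat h(\xi)=\int_{\mathbb{R}}e^{-i\xi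 x}h(x)\,dx$ (transform in $x$), $\widehat U(\xi,t)$ solves, for each $\xi\in\mathbb{R}$, with initial datum $\widehat U(\xi,0)=\widehat U_0(\xi)$, $$\widehat v_t-i\xi\widehat u=0,\quad \rho_1\widehat u_t-ik_1\xi\widehat v+k_0\widehat p=0,\quad \widehat z_t-i\xi\widehat y=0,\quad \rho_2\widehat y_t-ik_2\xi\widehat z+k_0\widehat p=0,\quad \widehat\phi_t+\xi^2\widehat\theta=0,$$ $$\rho_3\widehat\theta_t-(k_3-\tau_0g_0)\xi^2\widehat\phi-ilk_0\xi\widehat p+G=0,\quad \widehat p_t-\widehat u-\widehat y-il\xi\widehat\theta=0,$$ with $G=\gamma\widehat\theta$ if $\tau_0=0$ and $G=\xi^4\int_0^{+\infty}g(s)\widehat\eta\,ds$ if $\tau_0=1$; in addition, if $\tau_0=1$, $\widehat\eta_t+\widehat\eta_s-\widehat\theta=0$ with $\widehat\eta(\xi,t,0)=0$. As a consequence of the definitions of the variables, (initial data and) solutions satisfy the compatibility relation $i\xi\widehat p=\widehat v+\widehat z+l\widehat\phi$. Norm: $$|\widehat U(\xi,t)|^2=|\widehat v|^2+|\widehat u|^2+|\widehat z|^2+|\widehat y|^2+|\widehat\phi|^2+|\widehat\theta|^2+|\widehat p|^2+\tau_0\,\xi^4\int_0^{+\infty}g(s)|\widehat\eta(\xi,t,s)|^2\,ds,$$ and similarly for $\widehat U_0$.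
   Formalization: Part 1 is false for every initial datum (zero data give the zero solution), so it is stated as: there exist compatible initial data, chosen for every ξ, whose solution satisfies that |Û(ξ,t)| does not converge to zero as t goes to infinity. *)

theory Defs
  imports "HOL-Analysis.Analysis"
begin

text \<open>
  State of the Fourier-side Rao--Nakra system at one frequency \<open>\<xi>\<close> and one time:
  \<open>hat_v\<close>, ..., \<open>hat_p\<close> are the transforms of
  \<open>\<phi>\<^sub>x, \<phi>\<^sub>t, \<psi>\<^sub>x, \<psi>\<^sub>t, w\<^sub>x\<^sub>x, w\<^sub>t, \<phi> + \<psi> + l w\<^sub>x\<close>, and \<open>hat_eta\<close> is the transform of the relative
  history \<open>s \<mapsto> w(t) - w(t - s)\<close>. The parameter \<open>\<tau>0\<close> is 0 (frictional damping) or 1 (infinite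
  memory); for \<open>\<tau>0 = 0\<close> the field \<open>hat_eta\<close> is not part of the state, and neither the equations
  nor the norm below refer to it.
\<close>

record rn_state =
  hat_v :: complex
  hat_u :: complex
  hat_z :: complex
  hat_y :: complex
  hat_phi :: complex
  hat_theta :: complex
  hat_p :: complex
  hat_eta :: "real \<Rightarrow> complex"

definition kernel_mass :: "(real \<Rightarrow> real) \<Rightarrow> real" where
  "kernel_mass g = (LINT s:{0..}|lborel. g s)"

definition rn_norm :: "nat \<Rightarrow> (real \<Rightarrow> real) \<Rightarrow> real \<Rightarrow> rn_state \<Rightarrow> real" where
  "rn_norm \<tau>0 g \<xi> X = sqrt (
     (cmod (hat_v X))\<^sup>2 + (cmod (hat_u X))\<^sup>2 + (cmod (hat_z X))\<^sup>2 + (cmod (hat_y X))\<^sup>2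
     + (cmod (hat_phi X))\<^sup>2 + (cmod (hat_theta X))\<^sup>2 + (cmod (hat_p X))\<^sup>2
     + real \<tau>0 * \<xi>^4 * (LINT s:{0..}|lborel. g s * (cmod (hat_eta X s))\<^sup>2))"

definition rn_compatible :: "real \<Rightarrow> real \<Rightarrow> rn_state \<Rightarrow> bool" where
  "rn_compatible l \<xi> X \<longleftrightarrow>
     \<i> * of_real \<xi> * hat_p X = hat_v X + hat_z X + of_real l * hat_phi X"

text \<open>The set of admissible histories: the weighted space \<open>L\<^sup>2\<close> with density \<open>g\<close> on \<open>[0, \<infinity>)\<close>.\<close>

definition rn_history :: "(real \<Rightarrow> real) \<Rightarrow> (real \<Rightarrow> complex) \<Rightarrow> bool" where
  "rn_history g h \<longleftrightarrow>
     set_borel_measurable lborel {0..} h \<and>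
     set_integrable lborel {0..} (\<lambda>s. g s * (cmod (h s))\<^sup>2)"

definition rn_damping ::
  "nat \<Rightarrow> real \<Rightarrow> (real \<Rightarrow> real) \<Rightarrow> real \<Rightarrow> rn_state \<Rightarrow> complex" where
  "rn_damping \<tau>0 \<gamma> g \<xi> X =
     (if \<tau>0 = 0 then of_real \<gamma> * hat_theta X
      else of_real (\<xi>^4) * (LINT s:{0..}|lborel. of_real (g s) * hat_eta X s))"

text \<open>
  The transport operator \<open>\<partial>\<^sub>t + \<partial>\<^sub>s\<close> at \<open>(t, s)\<close>, as the derivative in the direction \<open>(1, 1)\<close>
  within the closed quadrant \<open>t, s \<ge> 0\<close> (so one-sided on its boundary). Where \<open>\<eta>\<close> is
  differentiable this is the sum of the two partial derivatives (next lemma). The separate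
  partial derivatives do not exist for all data: an initial history that is merely in the weighted
  \<open>L\<^sup>2\<close> space is transported unchanged along the lines \<open>s - t\<close> = const, and even for a smooth one
  the solution may have a kink or a jump across \<open>s = t\<close>.
\<close>

definition has_transport_derivative ::
  "(real \<Rightarrow> real \<Rightarrow> complex) \<Rightarrow> complex \<Rightarrow> real \<Rightarrow> real \<Rightarrow> bool" where
  "has_transport_derivative \<eta> d t s \<longleftrightarrow>
     ((\<lambda>r. \<eta> (t + r) (s + r)) has_vector_derivative d) (at 0 within {r. 0 \<le> t + r \<and> 0 \<le> s + r})"

lemma has_transport_derivative_partials:
  fixes \<eta> :: "real \<Rightarrow> real \<Rightarrow> complex"
  assumes "((\<lambda>(t, s). \<eta> t s) has_derivative D) (at (t, s) within {0..} \<times> {0..})"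
  shows "has_transport_derivative \<eta> (D (1, 0) + D (0, 1)) t s"
proof -
  let ?R = "{r. 0 \<le> t + r \<and> 0 \<le> s + r}"
  let ?q = "\<lambda>r. (t + r, s + r)"
  have q: "(?q has_derivative (\<lambda>r. (r, r))) (at 0 within ?R)"
    by (auto intro!: derivative_eq_intros)
  have sub: "?q ` ?R \<subseteq> {0..} \<times> {0..}"
    by auto
  have "((\<lambda>(t, s). \<eta> t s) has_derivative D) (at (?q 0) within ?q ` ?R)"
    using has_derivative_subset[OF assms sub] by simp
  from has_derivative_in_compose[OF q this]
  have "((\<lambda>r. \<eta> (t + r) (s + r)) has_derivative (\<lambda>r. D (r, r))) (at 0 within ?R)"
    by simp
  moreover have "D (r, r) = r *\<^sub>R (D (1, 0) + D (0, 1))" for r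
  proof -
    interpret D: bounded_linear D
      using assms by (rule has_derivative_bounded_linear)
    have "D (r, r) = D (r *\<^sub>R ((1, 0) + (0, 1)))"
      by simp
    then show ?thesis
      by (simp only: D.scaleR D.add)
  qed
  ultimately show ?thesis
    by (simp add: has_transport_derivative_def has_vector_derivative_def)
qed

text \<open>
  \<open>U\<close> solves the system at frequency \<open>\<xi>\<close> for \<open>t \<ge> 0\<close>; time derivatives are one-sided at \<open>t = 0\<close>.
  Compatibility is not part of this predicate: it is imposed on the initial datum, and the
  equations preserve it.
\<close>

definition rn_solution ::
  "nat \<Rightarrow> real \<Rightarrow> real \<Rightarrow> real \<Rightarrow> real \<Rightarrow> real \<Rightarrow> real \<Rightarrow> real \<Rightarrow> real \<Rightarrow> real
   \<Rightarrow> (real \<Rightarrow> real) \<Rightarrow> real \<Rightarrow> (real \<Rightarrow> rn_state) \<Rightarrow> bool" where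
  "rn_solution \<tau>0 \<rho>1 \<rho>2 \<rho>3 k0 k1 k2 k3 \<gamma> l g \<xi> U \<longleftrightarrow>
     (\<forall>t\<ge>0.
        ((\<lambda>t. hat_v (U t)) has_vector_derivative
            \<i> * of_real \<xi> * hat_u (U t)) (at t within {0..}) \<and>
        ((\<lambda>t. of_real \<rho>1 * hat_u (U t)) has_vector_derivative
            \<i> * of_real (k1 * \<xi>) * hat_v (U t) - of_real k0 * hat_p (U t)) (at t within {0..}) \<and>
        ((\<lambda>t. hat_z (U t)) has_vector_derivative
            \<i> * of_real \<xi> * hat_y (U t)) (at t within {0..}) \<and>
        ((\<lambda>t. of_real \<rho>2 * hat_y (U t)) has_vector_derivative
            \<i> * of_real (k2 * \<xi>) * hat_z (U t) - of_real k0 * hat_p (U t)) (at t within {0..}) \<and>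
        ((\<lambda>t. hat_phi (U t)) has_vector_derivative
            - of_real (\<xi>\<^sup>2) * hat_theta (U t)) (at t within {0..}) \<and>
        ((\<lambda>t. of_real \<rho>3 * hat_theta (U t)) has_vector_derivative
            of_real ((k3 - real \<tau>0 * kernel_mass g) * \<xi>\<^sup>2) * hat_phi (U t)
            + \<i> * of_real (l * k0 * \<xi>) * hat_p (U t)
            - rn_damping \<tau>0 \<gamma> g \<xi> (U t)) (at t within {0..}) \<and>
        ((\<lambda>t. hat_p (U t)) has_vector_derivative
            hat_u (U t) + hat_y (U t) + \<i> * of_real (l * \<xi>) * hat_theta (U t))
          (at t within {0..})) \<and>
     (\<tau>0 = 1 \<longrightarrow>
        (\<forall>t\<ge>0. rn_history g (hat_eta (U t)) \<and> hat_eta (U t) 0 = 0 \<and>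
           (\<forall>s\<ge>0. has_transport_derivative (\<lambda>t. hat_eta (U t)) (hat_theta (U t)) t s)))"

end

theory Submission
  imports Defs
begin

text \<open>
  For equal wave speeds the antisymmetric motion \<open>\<psi> = - \<phi>\<close>, \<open>w = 0\<close> is an undamped wave.

  For different wave speeds, the energy of a solution decreases at a rate \<open>D\<close> that only sees \<open>\<theta>\<close> (or the
  history \<open>\<eta>\<close>). A multiplier \<open>F\<close> with \<open>F' \<le> - X + \<epsilon> T + C K D\<close> and \<open>|F| \<le> C K |U|\<^sup>2\<close>, where \<open>1 / K\<close> is
  comparable to \<open>f(\<xi>)\<close> and \<open>T \<ge> |U|\<^sup>2\<close> is a weighted square norm, transfers the dissipation to the
  quantity \<open>X\<close>. Such multipliers are found successively for
  \<open>\<theta>\<close>, the moment \<open>q = \<kappa> \<xi> \<phi> + i l k0 p\<close> that drives \<open>\<theta>\<close>, \<open>\<phi>\<close>, \<open>p\<close>, \<open>v + z\<close> (by compatibility), \<open>u + y\<close>,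
  \<open>(k1/\<rho>1) v + (k2/\<rho>2) z\<close>, and then, the two speeds being different, \<open>v\<close>, \<open>z\<close>, \<open>u\<close>, \<open>y\<close>. Every component
  of \<open>T\<close> is reached, so \<open>\<epsilon> T\<close> is absorbed and a large multiple of \<open>K\<close> times the energy, plus the sum
  of the \<open>F\<close>, decays like \<open>exp (- c t / K)\<close>.
\<close>

text \<open>The exponents in \<open>cost\<close> are set by the worst products of a dissipated
  quantity with one merely bounded by T. With friction they contain \<xi>^-2 times the damping for
  small \<xi> and |\<xi>|^3 \<theta> for large \<xi>, with squares of order \<xi>^-4 and \<xi>^6.
  With memory the mean of the history occurs with orders \<xi>^-1 and \<xi>^4; as the dissipation
  carries \<xi>^4, the squares cost \<xi>^-6 and \<xi>^4. The obstacle at low frequency is p, whose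
  terms come with 1/\<xi>. They are cancelled, not estimated: for the waves by adding \<theta> to
  the velocities, for \<phi> by a weighted sum of u and y whose derivative contains only p and
  \<phi>. This second cancellation leaves a product of that sum with \<theta>,
  \<open>coupling\<close>, which each type of damping treats in its own way. T carries extra powers
  of frequency on \<phi>, p and \<theta>, so that mixed terms can be measured against it before
  their factors are reached. The multipliers divide by \<xi>; at \<xi> = 0, f vanishes and a bounded
  energy is enough.\<close>

lemma has_vector_derivative_iff_quotient:
  fixes f :: "real \<Rightarrow> 'a::real_normed_vector"
  shows "(f has_vector_derivative D) (at x within S) \<longleftrightarrow>
    ((\<lambda>y. (f y - f x) /\<^sub>R (y - x)) \<longlongrightarrow> D) (at x within S)"
proof -
  have "norm ((f y - f x) - (y - x) *\<^sub>R D) / norm (y - x) = norm ((f y - f x) /\<^sub>R (y - x) - D)"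
    if "y \<noteq> x" for y
  proof -
    have "(f y - f x) /\<^sub>R (y - x) - D = ((f y - f x) - (y - x) *\<^sub>R D) /\<^sub>R (y - x)"
      using that by (simp add: scaleR_diff_right)
    then show ?thesis
      by (simp add: divide_inverse_commute)
  qed
  then have "((\<lambda>y. norm ((f y - f x) - (y - x) *\<^sub>R D) / norm (y - x)) \<longlongrightarrow> 0) (at x within S) \<longleftrightarrow>
      ((\<lambda>y. norm ((f y - f x) /\<^sub>R (y - x) - D)) \<longlongrightarrow> 0) (at x within S)"
    by (intro filterlim_cong refl) (auto simp: eventually_at_filter)
  then show ?thesis
    by (simp add: has_vector_derivative_def has_derivative_iff_norm bounded_linear_scaleR_left
        tendsto_norm_zero_iff LIM_zero_iff)
qed

section \<open>One-sided calculus on the half-line and differentiation of memory integrals\<close>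

lemma vector_differentiable_bound:
  fixes f :: "real \<Rightarrow> 'a::real_normed_vector"
  assumes "convex S" "\<And>x. x \<in> S \<Longrightarrow> (f has_vector_derivative f' x) (at x within S)"
    and "\<And>x. x \<in> S \<Longrightarrow> norm (f' x) \<le> B" "x \<in> S" "y \<in> S"
  shows "norm (f x - f y) \<le> B * \<bar>x - y\<bar>"
proof -
  have "onorm (\<lambda>h. h *\<^sub>R v) = norm v" for v :: 'a
    using onorm_scaleR_left[OF bounded_linear_ident, of v] by (simp add: onorm_id)
  then show ?thesis
    using differentiable_bound[OF assms(1), of f "\<lambda>x h. h *\<^sub>R f' x" B x y] assms
    by (simp add: has_vector_derivative_def)
qed

lemma nonincreasing_if_derivative_nonpos:
  fixes f :: "real \<Rightarrow> real"
  assumes "\<And>t. 0 \<le> t \<Longrightarrow> \<exists>d. (f has_real_derivative d) (at t within {0..}) \<and> d \<le> 0"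
    and "0 \<le> s" "s \<le> t"
  shows "f t \<le> f s"
proof (rule DERIV_nonpos_imp_decreasing_open[OF \<open>s \<le> t\<close>])
  fix x assume "s < x"
  then have "x \<in> interior {0..}"
    using \<open>0 \<le> s\<close> by (simp add: interior_Ici[of "-1"])
  then show "\<exists>y. (f has_real_derivative y) (at x) \<and> y \<le> 0"
    using assms(1)[of x] \<open>s < x\<close> \<open>0 \<le> s\<close> at_within_interior[of x "{0..}"] by force
next
  have "continuous_on {0..} f"
    using assms(1) DERIV_continuous by (fastforce simp: continuous_on_eq_continuous_within)
  then show "continuous_on {s..t} f"
    by (rule continuous_on_subset) (use \<open>0 \<le> s\<close> in auto)
qed

text \<open>Integrating factor \<open>exp (c * t)\<close>. The sign of \<open>c\<close> is free:
  besides the final decay, negative \<open>c\<close> yields growth bounds for the kernel.\<close>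

lemma exp_decay_if_derivative_le:
  fixes f :: "real \<Rightarrow> real"
  assumes "\<And>t. 0 \<le> t \<Longrightarrow> \<exists>d. (f has_real_derivative d) (at t within {0..}) \<and> d \<le> - c * f t"
    and "0 \<le> s" "s \<le> t"
  shows "f t \<le> exp (- c * (t - s)) * f s"
proof -
  have "exp (c * t) * f t \<le> exp (c * s) * f s"
  proof (rule nonincreasing_if_derivative_nonpos[OF _ assms(2,3)])
    fix r :: real assume "0 \<le> r"
    then obtain d where d: "(f has_real_derivative d) (at r within {0..})" "d \<le> - c * f r"
      using assms(1) by blast
    have "((\<lambda>r. exp (c * r) * f r) has_real_derivative exp (c * r) * (c * f r + d)) (at r within {0..})"
      by (auto intro!: derivative_eq_intros d(1) simp: algebra_simps)
    then show "\<exists>d. ((\<lambda>r. exp (c * r) * f r) has_real_derivative d) (at r within {0..}) \<and> d \<le> 0"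
      using d(2) by (intro exI conjI) (auto simp: mult_le_0_iff)
  qed
  then show ?thesis
    by (simp add: field_simps exp_minus exp_diff left_diff_distrib right_diff_distrib)
qed

text \<open>
  The integrand is compared along the characteristics \<open>r \<mapsto> (t + r, s + r)\<close>: after extending it by
  zero to \<open>s < 0\<close>, translation invariance turns the increment of the integral into the integral of the
  increments along the characteristics.
\<close>

lemma has_vector_derivative_memory_integral:
  fixes H :: "real \<Rightarrow> real \<Rightarrow> 'b::{banach,second_countable_topology}"
  assumes g': "\<And>s. 0 \<le> s \<Longrightarrow> (g has_real_derivative g' s) (at s within {0..})"
    and g: "\<And>s. 0 \<le> s \<Longrightarrow> 0 \<le> g s" "\<And>s. 0 \<le> s \<Longrightarrow> \<bar>g' s\<bar> \<le> \<beta> * g s"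
    and "0 \<le> \<beta>" "0 \<le> t"
    and int: "\<And>t. 0 \<le> t \<Longrightarrow> set_integrable lborel {0..} (\<lambda>s. g s *\<^sub>R H t s)"
    and d: "\<And>s. 0 < s \<Longrightarrow> ((\<lambda>r. H (t + r) (s + r)) has_vector_derivative d s)
               (at 0 within {r. 0 \<le> t + r \<and> 0 \<le> s + r})"
    and meas: "set_borel_measurable lborel {0..} (\<lambda>s. g' s *\<^sub>R H t s + g s *\<^sub>R d s)"
    and lip: "\<And>r s. \<bar>r\<bar> \<le> 1 \<Longrightarrow> 0 \<le> t + r \<Longrightarrow> 0 \<le> s \<Longrightarrow> 0 \<le> s + r \<Longrightarrow>
               norm (H (t + r) (s + r) - H t s) \<le> \<bar>r\<bar> * k s"
    and k: "set_integrable lborel {0..} (\<lambda>s. g s * k s)"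
    and small: "\<And>t' s. 0 \<le> s \<Longrightarrow> s \<le> 1 \<Longrightarrow> s \<le> t' \<Longrightarrow> t' \<le> t + 1 \<Longrightarrow> norm (H t' s) \<le> c * s"
  shows "((\<lambda>t. LINT s:{0..}|lborel. g s *\<^sub>R H t s) has_vector_derivative
            (LINT s:{0..}|lborel. g' s *\<^sub>R H t s + g s *\<^sub>R d s)) (at t within {0..})"
proof -
  define \<Phi> where "\<Phi> r s = indicat_real {0..} (s + r) *\<^sub>R g (s + r) *\<^sub>R H (t + r) (s + r)" for r s
  \<comment> \<open>The logarithmic derivative of \<open>g\<close> is at most \<beta> in absolute
    value, so kernel values at distance at most 1 are comparable. This lets \<open>g s\<close>
    dominate the shifted kernel \<open>g (s + r)\<close>.\<close>
  have gexp: "g s' \<le> exp (\<beta> * \<bar>s' - s\<bar>) * g s" if "0 \<le> s" "0 \<le> s'" for s s'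
  proof (cases "s \<le> s'")
    case True
    have "g s' \<le> exp (- (- \<beta>) * (s' - s)) * g s"
    proof (rule exp_decay_if_derivative_le[OF _ \<open>0 \<le> s\<close> True])
      fix t :: real assume "0 \<le> t"
      then show "\<exists>d. (g has_real_derivative d) (at t within {0..}) \<and> d \<le> - (- \<beta>) * g t"
        using g' g(2)[of t] by (intro exI[of _ "g' t"]) auto
    qed
    then show ?thesis using True by simp
  next
    case False
    have "- g s \<le> exp (- \<beta> * (s - s')) * - g s'"
    proof (rule exp_decay_if_derivative_le[OF _ \<open>0 \<le> s'\<close>])
      fix t :: real assume "0 \<le> t"
      then show "\<exists>d. ((\<lambda>x. - g x) has_real_derivative d) (at t within {0..}) \<and> d \<le> - \<beta> * - g t"
        using g'[of t] g(2)[of t] by (intro exI[of _ "- g' t"]) (auto intro: derivative_intros)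
    qed (use False in simp)
    then show ?thesis using False by (simp add: exp_diff right_diff_distrib field_simps)
  qed
  have glip: "\<bar>g (s + r) - g s\<bar> \<le> \<beta> * exp \<beta> * g s * \<bar>r\<bar>" if "0 \<le> s" "0 \<le> s + r" "\<bar>r\<bar> \<le> 1" for s r
  proof -
    let ?S = "closed_segment s (s + r)"
    have sub: "0 \<le> x \<and> \<bar>x - s\<bar> \<le> 1" if "x \<in> ?S" for x
      using that \<open>0 \<le> s\<close> \<open>0 \<le> s + r\<close> \<open>\<bar>r\<bar> \<le> 1\<close>
      by (auto simp: closed_segment_eq_real_ivl split: if_splits)
    have "norm (g (s + r) - g s) \<le> (\<beta> * exp \<beta> * g s) * norm (s + r - s)"
    proof (rule field_differentiable_bound[of ?S g g'])
      fix x assume x: "x \<in> ?S"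
      then show "(g has_real_derivative g' x) (at x within ?S)"
        using sub by (intro DERIV_subset[OF g']) auto
      have "g x \<le> exp (\<beta> * \<bar>x - s\<bar>) * g s"
        using sub[OF x] \<open>0 \<le> s\<close> by (intro gexp) auto
      also have "\<dots> \<le> exp \<beta> * g s"
        using sub[OF x] \<open>0 \<le> s\<close> g(1)[of s] \<open>0 \<le> \<beta>\<close>
        by (intro mult_right_mono) (auto simp: mult_left_le)
      finally have "\<beta> * g x \<le> \<beta> * (exp \<beta> * g s)"
        using \<open>0 \<le> \<beta>\<close> by (rule mult_left_mono)
      then show "norm (g' x) \<le> \<beta> * exp \<beta> * g s"
        using g(2)[of x] sub[OF x] by simp
    qed auto
    then show ?thesis by simp
  qed
  \<comment> \<open>Integrable majorant of the difference quotients. The first part serves the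
    points where \<open>s\<close> and \<open>s + r\<close> are both nonnegative. The second serves
    the strip of width |r| at 0 where only one of them is: there the surviving value of
    \<open>H\<close> is of order |r|, so the quotient stays bounded.\<close>
  define w where "w s = indicator {0..} s * (exp \<beta> * (g s * k s) + \<beta> * exp \<beta> * norm (g s *\<^sub>R H t s))
                        + indicator {-1..1} s * (exp \<beta> * g 0 * c)" for s :: real
  have c0: "0 \<le> c"
  proof -
    have "0 \<le> norm (H 1 1)" by simp
    also have "\<dots> \<le> c * 1" using small[of 1 1] \<open>0 \<le> t\<close> by simp
    finally show ?thesis by simp
  qed
  have k0: "0 \<le> g s * k s" if "0 \<le> s" for s
    using lip[of 1 s] order_trans[OF norm_ge_zero lip[of 1 s]] that \<open>0 \<le> t\<close> g(1)[of s] by simp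
  have w: "integrable lborel w"
  proof -
    have 1: "integrable lborel (\<lambda>s. exp \<beta> * (indicator {0..} s * (g s * k s)))"
      using k by (simp add: set_integrable_def)
    have 2: "integrable lborel (\<lambda>s. \<beta> * exp \<beta> * norm (indicator {0..} s *\<^sub>R g s *\<^sub>R H t s))"
      using integrable_norm[OF int[OF \<open>0 \<le> t\<close>, unfolded set_integrable_def]] by simp
    have 3: "integrable lborel (\<lambda>s. indicator {-1..1::real} s * (exp \<beta> * g 0 * c))"
      by (rule integrable_mult_left) simp
    show ?thesis
      unfolding w_def
      by (rule Bochner_Integration.integrable_cong[THEN iffD1, OF refl _
            Bochner_Integration.integrable_add[OF Bochner_Integration.integrable_add[OF 1 2] 3]])
         (auto simp: indicator_def)
  qed
  have \<Phi>_int: "integrable lborel (\<Phi> r)" "(\<integral>s. \<Phi> r s \<partial>lborel) = (LINT s:{0..}|lborel. g s *\<^sub>R H (t + r) s)"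
    if "0 \<le> t + r" for r
    using lborel_integrable_real_affine[OF int[OF that, unfolded set_integrable_def], of 1 r]
      lborel_integral_real_affine[of 1 "\<lambda>s. indicator {0..} s *\<^sub>R g s *\<^sub>R H (t + r) s" r]
    by (simp_all add: \<Phi>_def[abs_def] set_lebesgue_integral_def add.commute)
  have bound: "norm ((\<Phi> r s - \<Phi> 0 s) /\<^sub>R r) \<le> w s" if r: "r \<noteq> 0" "\<bar>r\<bar> \<le> 1" "0 \<le> t + r" for r s
  proof -
    have g0c: "g s \<le> exp \<beta> * g 0" if "0 \<le> s" "s \<le> 1" for s
    proof -
      have "exp (\<beta> * \<bar>s - 0\<bar>) * g 0 \<le> exp \<beta> * g 0"
        using that g(1)[of 0] \<open>0 \<le> \<beta>\<close> by (intro mult_right_mono) (auto simp: mult_left_le)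
      then show ?thesis using gexp[of 0 s] that by simp
    qed
    have "norm (\<Phi> r s - \<Phi> 0 s) \<le> \<bar>r\<bar> * w s"
    proof (cases "0 \<le> s"; cases "0 \<le> s + r")
      assume s: "0 \<le> s" "0 \<le> s + r"
      have "\<Phi> r s - \<Phi> 0 s = g (s + r) *\<^sub>R (H (t + r) (s + r) - H t s) + (g (s + r) - g s) *\<^sub>R H t s"
        using s by (simp add: \<Phi>_def algebra_simps)
      also have "norm \<dots> \<le> g (s + r) * norm (H (t + r) (s + r) - H t s) + \<bar>g (s + r) - g s\<bar> * norm (H t s)"
        using g(1)[of "s + r"] s by (intro order_trans[OF norm_triangle_ineq]) simp
      also have "\<dots> \<le> (exp \<beta> * g s) * (\<bar>r\<bar> * k s) + (\<beta> * exp \<beta> * g s * \<bar>r\<bar>) * norm (H t s)"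
      proof (intro add_mono mult_mono)
        have "exp (\<beta> * \<bar>r\<bar>) * g s \<le> exp \<beta> * g s"
          using r g(1)[of s] s \<open>0 \<le> \<beta>\<close> by (intro mult_right_mono) (auto simp: mult_left_le)
        then show "g (s + r) \<le> exp \<beta> * g s"
          using gexp[of s "s + r"] s by simp
      qed (use s r lip[of r s] glip[of s r] g \<open>0 \<le> \<beta>\<close> in auto)
      also have "\<dots> \<le> \<bar>r\<bar> * w s"
        using s g(1) c0 g(1)[of 0] by (auto simp: w_def algebra_simps indicator_def)
      finally show ?thesis .
    next
      assume s: "0 \<le> s" "\<not> 0 \<le> s + r"
      have "norm (\<Phi> r s - \<Phi> 0 s) = g s * norm (H t s)"
        using s g(1)[of s] by (simp add: \<Phi>_def)
      \<comment> \<open>From \<open>s + r < 0 \<le> t + r\<close> follow \<open>s \<le> t\<close>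
        and \<open>s \<le> \<bar>r\<bar>\<close>, which puts the point in the range of the
        hypothesis \<open>small\<close>.\<close>
      also have "\<dots> \<le> (exp \<beta> * g 0) * (c * \<bar>r\<bar>)"
      proof (intro mult_mono)
        have "c * s \<le> c * \<bar>r\<bar>" using s c0 by (intro mult_left_mono) auto
        then show "norm (H t s) \<le> c * \<bar>r\<bar>"
          using small[of s t] s r by simp
      qed (use s r g0c[of s] g(1) in auto)
      also have "\<dots> = \<bar>r\<bar> * (exp \<beta> * g 0 * c)"
        by simp
      also have "\<dots> \<le> \<bar>r\<bar> * w s"
        using s r g(1)[of s] k0[of s] \<open>0 \<le> \<beta>\<close> by (intro mult_left_mono) (auto simp: w_def)
      finally show ?thesis .
    next
      assume s: "\<not> 0 \<le> s" "0 \<le> s + r"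
      have "norm (\<Phi> r s - \<Phi> 0 s) = g (s + r) * norm (H (t + r) (s + r))"
        using s g(1)[of "s + r"] by (simp add: \<Phi>_def)
      also have "\<dots> \<le> (exp \<beta> * g 0) * (c * \<bar>r\<bar>)"
      proof (intro mult_mono)
        have "c * (s + r) \<le> c * \<bar>r\<bar>" using s c0 by (intro mult_left_mono) auto
        then show "norm (H (t + r) (s + r)) \<le> c * \<bar>r\<bar>"
          using small[of "s + r" "t + r"] s r \<open>0 \<le> t\<close> by simp
      qed (use s r g0c[of "s + r"] g(1) in auto)
      also have "\<dots> \<le> \<bar>r\<bar> * w s"
        using s r by (auto simp: w_def indicator_def algebra_simps)
      finally show ?thesis .
    next
      assume s: "\<not> 0 \<le> s" "\<not> 0 \<le> s + r"
      then show ?thesis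
        using c0 g(1)[of 0] by (auto simp: \<Phi>_def w_def)
    qed
    then show ?thesis
      using r by (simp only: norm_scaleR abs_inverse) (simp add: inverse_eq_divide pos_divide_le_eq mult.commute)
  qed
  \<comment> \<open>The null set \<open>s = 0\<close> is left out, as \<open>d\<close> describes the
    derivative only for \<open>0 < s\<close>.\<close>
  have lim: "((\<lambda>r. (\<Phi> r s - \<Phi> 0 s) /\<^sub>R r) \<longlongrightarrow> indicator {0..} s *\<^sub>R (g' s *\<^sub>R H t s + g s *\<^sub>R d s))
               (at 0 within {r. 0 \<le> t + r})" if "s \<noteq> 0" for s
  proof (cases "0 < s")
    case True
    let ?R = "{r. 0 \<le> t + r \<and> 0 \<le> s + r}"
    have "((\<lambda>r. s + r) has_real_derivative 1) (at 0 within ?R)"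
      by (auto intro!: derivative_eq_intros)
    moreover have "(g has_real_derivative g' s) (at (s + 0) within (\<lambda>r. s + r) ` ?R)"
      using True by (auto intro!: DERIV_subset[OF g'])
    ultimately have "((\<lambda>r. g (s + r)) has_real_derivative g' s * 1) (at 0 within ?R)"
      using DERIV_image_chain[of g "g' s" "\<lambda>r. s + r" 0 ?R 1] by (simp add: o_def)
    then have g1: "((\<lambda>r. g (s + r)) has_real_derivative g' s) (at 0 within ?R)"
      by simp
    have "((\<lambda>r. g (s + r) *\<^sub>R H (t + r) (s + r)) has_vector_derivative
        g (s + 0) *\<^sub>R d s + g' s *\<^sub>R H (t + 0) (s + 0)) (at 0 within ?R)"
      by (rule has_vector_derivative_scaleR[OF g1 d[OF True]])
    then have "((\<lambda>r. (g (s + r) *\<^sub>R H (t + r) (s + r) - g s *\<^sub>R H t s) /\<^sub>R r) \<longlongrightarrow>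
        g' s *\<^sub>R H t s + g s *\<^sub>R d s) (at 0 within ?R)"
      by (simp add: has_vector_derivative_iff_quotient add.commute)
    moreover have ev: "\<forall>\<^sub>F r in at 0 within {r. 0 \<le> t + r}. 0 \<le> s + r"
      unfolding eventually_at using True by (intro exI[of _ s]) (auto simp: dist_real_def)
    moreover have "at 0 within ?R = at 0 within {r. 0 \<le> t + r}"
      by (rule at_within_nhd[of _ "{-s<..<s}"]) (use True in auto)
    ultimately have L: "((\<lambda>r. (g (s + r) *\<^sub>R H (t + r) (s + r) - g s *\<^sub>R H t s) /\<^sub>R r) \<longlongrightarrow>
        g' s *\<^sub>R H t s + g s *\<^sub>R d s) (at 0 within {r. 0 \<le> t + r})"
      by simp
    show ?thesis
      by (rule tendsto_eq_rhs[OF Lim_transform_eventually[OF L]])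
         (use ev True in \<open>auto simp: \<Phi>_def elim: eventually_mono\<close>)
  next
    case False
    with that have "s < 0" by simp
    have "\<forall>\<^sub>F r in at 0 within {r. 0 \<le> t + r}. 0 = (\<Phi> r s - \<Phi> 0 s) /\<^sub>R r"
      unfolding eventually_at using \<open>s < 0\<close> by (intro exI[of _ "-s"]) (auto simp: dist_real_def \<Phi>_def)
    then show ?thesis
      using \<open>s < 0\<close> by (auto intro: Lim_transform_eventually[OF tendsto_const])
  qed
  show ?thesis
    unfolding has_vector_derivative_iff_quotient tendsto_at_iff_sequentially
  proof (intro allI impI)
    fix X :: "nat \<Rightarrow> real"
    assume X: "\<forall>i. X i \<in> {0..} - {t}" "X \<longlonglongrightarrow> t"
    obtain n0 where n0: "\<And>n. n \<ge> n0 \<Longrightarrow> \<bar>X n - t\<bar> \<le> 1"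
      using LIMSEQ_D[OF X(2), of 1] by (force intro: less_imp_le)
    \<comment> \<open>Discarding the first \<open>n0\<close> terms brings the increments into |r|
      \<le> 1, where the majorant is valid.\<close>
    define Y where "Y n = X (n + n0) - t" for n
    have Y: "Y n \<noteq> 0" "\<bar>Y n\<bar> \<le> 1" "0 \<le> t + Y n" for n
      using X(1) n0[of "n + n0"] by (auto simp: Y_def)
    have "(\<lambda>n. X (n + n0)) \<longlonglongrightarrow> t" using X(2) by (rule LIMSEQ_ignore_initial_segment)
    then have Y0: "Y \<longlonglongrightarrow> 0" unfolding Y_def by (simp add: LIM_zero)
    have "(\<lambda>n. \<integral>s. (\<Phi> (Y n) s - \<Phi> 0 s) /\<^sub>R Y n \<partial>lborel) \<longlonglongrightarrow>
        (\<integral>s. indicator {0..} s *\<^sub>R (g' s *\<^sub>R H t s + g s *\<^sub>R d s) \<partial>lborel)"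
    proof (rule integral_dominated_convergence[of _ _ _ w])
      show "AE s in lborel. (\<lambda>n. (\<Phi> (Y n) s - \<Phi> 0 s) /\<^sub>R Y n) \<longlonglongrightarrow>
          indicator {0..} s *\<^sub>R (g' s *\<^sub>R H t s + g s *\<^sub>R d s)"
        using AE_lborel_singleton[of 0]
      proof eventually_elim
        case (elim s)
        show ?case
          using lim[OF elim, unfolded tendsto_at_iff_sequentially, rule_format, of Y] Y Y0
          by (simp add: o_def)
      qed
      show "(\<lambda>s. (\<Phi> (Y n) s - \<Phi> 0 s) /\<^sub>R Y n) \<in> borel_measurable lborel" for n
        using \<Phi>_int(1)[OF Y(3), of n] \<Phi>_int(1)[of 0] \<open>0 \<le> t\<close> by (intro borel_measurable_integrable) auto
    qed (use meas w bound Y in \<open>auto simp: set_borel_measurable_def\<close>)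
    moreover have "(\<integral>s. (\<Phi> (Y n) s - \<Phi> 0 s) /\<^sub>R Y n \<partial>lborel) =
        ((LINT s:{0..}|lborel. g s *\<^sub>R H (X (n + n0)) s) - (LINT s:{0..}|lborel. g s *\<^sub>R H t s)) /\<^sub>R (X (n + n0) - t)" for n
      using \<Phi>_int[OF Y(3), of n] \<Phi>_int[of 0] \<open>0 \<le> t\<close> by (simp add: Y_def)
    ultimately have "(\<lambda>n. ((LINT s:{0..}|lborel. g s *\<^sub>R H (X (n + n0)) s) - (LINT s:{0..}|lborel. g s *\<^sub>R H t s)) /\<^sub>R (X (n + n0) - t))
        \<longlonglongrightarrow> (LINT s:{0..}|lborel. g' s *\<^sub>R H t s + g s *\<^sub>R d s)"
      by (simp add: set_lebesgue_integral_def)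
    then show "((\<lambda>y. ((LINT s:{0..}|lborel. g s *\<^sub>R H y s) - (LINT s:{0..}|lborel. g s *\<^sub>R H t s)) /\<^sub>R (y - t)) \<circ> X)
        \<longlonglongrightarrow> (LINT s:{0..}|lborel. g' s *\<^sub>R H t s + g s *\<^sub>R d s)"
      unfolding o_def by (rule LIMSEQ_offset)
  qed
qed

section \<open>Inner products, measurability and the multiplier identity for waves\<close>

lemma has_real_derivative_inner:
  assumes "(f has_vector_derivative f') (at t within S)" "(g has_vector_derivative g') (at t within S)"
  shows "((\<lambda>t. f t \<bullet> g t) has_real_derivative f t \<bullet> g' + f' \<bullet> g t) (at t within S)"
  using bounded_bilinear.has_vector_derivative[OF bounded_bilinear_inner assms]
  by (simp add: has_real_derivative_iff_has_vector_derivative)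

lemma has_vector_derivative_shift_at_0:
  assumes "((\<lambda>r. f (x + r)) has_vector_derivative f') (at 0 within {r. x + r \<in> S})"
  shows "(f has_vector_derivative f') (at x within S)"
proof -
  have "((\<lambda>y. y - x) has_vector_derivative 1) (at x within S)"
    by (auto intro!: derivative_eq_intros)
  moreover have "((\<lambda>r. f (x + r)) has_vector_derivative f') (at (x - x) within (\<lambda>y. y - x) ` S)"
    by (rule has_vector_derivative_within_subset[of _ _ _ "{r. x + r \<in> S}"]) (use assms in auto)
  ultimately have "(((\<lambda>r. f (x + r)) \<circ> (\<lambda>y. y - x)) has_vector_derivative 1 *\<^sub>R f') (at x within S)"
    by (rule vector_diff_chain_within)
  then show ?thesis by (simp add: o_def)
qed

lemma set_borel_measurable_times:
  fixes f h :: "real \<Rightarrow> 'a::{real_normed_algebra, second_countable_topology}"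
  assumes "set_borel_measurable lborel A f" "set_borel_measurable lborel A h"
  shows "set_borel_measurable lborel A (\<lambda>s. f s * h s)"
proof -
  have "(\<lambda>s. (indicat_real A s *\<^sub>R f s) * (indicat_real A s *\<^sub>R h s)) \<in> borel_measurable lborel"
    using assms unfolding set_borel_measurable_def by (rule borel_measurable_times)
  moreover have "(\<lambda>s. (indicat_real A s *\<^sub>R f s) * (indicat_real A s *\<^sub>R h s)) = (\<lambda>s. indicat_real A s *\<^sub>R (f s * h s))"
    by (auto simp: indicator_def)
  ultimately show ?thesis by (simp add: set_borel_measurable_def)
qed

lemma set_borel_measurable_of_real:
  assumes "set_borel_measurable lborel A f"
  shows "set_borel_measurable lborel A (\<lambda>s. complex_of_real (f s))"
proof -
  have "(\<lambda>s. complex_of_real (indicat_real A s *\<^sub>R f s)) \<in> borel_measurable lborel"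
    using assms unfolding set_borel_measurable_def by measurable
  then show ?thesis by (simp add: set_borel_measurable_def scaleR_conv_of_real)
qed

lemma set_borel_measurable_cmod:
  assumes "set_borel_measurable lborel A f"
  shows "set_borel_measurable lborel A (\<lambda>s. cmod (f s))"
proof -
  have "(\<lambda>s. cmod (indicat_real A s *\<^sub>R f s)) \<in> borel_measurable lborel"
    using assms unfolding set_borel_measurable_def by measurable
  then show ?thesis by (simp add: set_borel_measurable_def)
qed

lemma scaled_inner_le:
  fixes x y :: "'a::real_inner"
  assumes "\<bar>c\<bar> \<le> k * (\<alpha> * \<beta>)" "\<alpha> * norm x \<le> A" "\<beta> * norm y \<le> B" "0 \<le> \<alpha>" "0 \<le> \<beta>" "0 \<le> k"
  shows "\<bar>c * (x \<bullet> y)\<bar> \<le> k * (A * B)"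
proof -
  have "0 \<le> \<alpha> * norm x" "0 \<le> \<beta> * norm y"
    using assms by simp_all
  have "\<bar>c * (x \<bullet> y)\<bar> \<le> \<bar>c\<bar> * (norm x * norm y)"
    unfolding abs_mult by (intro mult_left_mono Cauchy_Schwarz_ineq2) simp
  also have "\<dots> \<le> (k * (\<alpha> * \<beta>)) * (norm x * norm y)"
    using assms by (intro mult_right_mono) auto
  also have "\<dots> = k * ((\<alpha> * norm x) * (\<beta> * norm y))"
    by simp
  also have "\<dots> \<le> k * (A * B)"
    using assms(2,3,6) \<open>0 \<le> \<alpha> * norm x\<close> \<open>0 \<le> \<beta> * norm y\<close>
    by (intro mult_left_mono mult_mono) linarith+
  finally show ?thesis .
qed

lemma inner_i_i: "(\<i> * x) \<bullet> (\<i> * y) = x \<bullet> y"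
  by (simp add: inner_complex_def)

lemma inner_i_left: "(\<i> * x) \<bullet> y = - (x \<bullet> (\<i> * y))"
  by (simp add: inner_complex_def)

lemma inner_i_swap: "x \<bullet> (\<i> * y) = - (y \<bullet> (\<i> * x))"
  by (simp add: inner_complex_def)

lemma i_scaleR_i: "\<i> * (c *\<^sub>R (\<i> * x)) = - (c *\<^sub>R x)"
  by (simp add: complex_eq_iff)

text \<open>Equipartition of a wave: for e' = i \<xi> w and c' = i \<xi> E this is the derivative of
  the multiplier - (1/\<xi>) e \<bullet> (i c). If \<open>c\<close> is close to a multiple of
  \<open>w\<close>, then \<open>- w \<bullet> c\<close> is the square that is gained, while
  \<open>e \<bullet> E\<close> contains the factor \<open>e\<close> that is already small.\<close>

lemma multiplier_identity:
  fixes e E w c :: complex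
  assumes "\<xi> \<noteq> 0"
  shows "- (1 / \<xi>) * (e \<bullet> (- (\<xi> *\<^sub>R E)) + (\<xi> *\<^sub>R (\<i> * w)) \<bullet> (\<i> * c)) = e \<bullet> E - w \<bullet> c"
  using assms by (simp add: inner_i_i field_simps)

subsection \<open>The Fourier-side system and its history term\<close>

locale rao_nakra =
  fixes \<rho>1 \<rho>2 \<rho>3 k0 k1 k2 k3 \<gamma> l \<beta>1 \<beta>2 :: real
    and g g' :: "real \<Rightarrow> real"
    and \<tau>0 :: nat
  assumes pos: "0 < \<rho>1" "0 < \<rho>2" "0 < \<rho>3" "0 < k0" "0 < k1" "0 < k2" "0 < k3" "0 < \<gamma>" "0 < l"
    and g_nonneg: "\<And>s. 0 \<le> s \<Longrightarrow> 0 \<le> g s"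
    and g_deriv: "\<And>s. 0 \<le> s \<Longrightarrow> (g has_real_derivative g' s) (at s within {0..})"
    and g'_cont: "continuous_on {0..} g'"
    and mass: "0 < kernel_mass g" "kernel_mass g < k3"
    and \<beta>_pos: "0 < \<beta>1" "0 < \<beta>2"
    and g'_bounds: "\<And>s. 0 \<le> s \<Longrightarrow> - \<beta>2 * g s \<le> g' s \<and> g' s \<le> - \<beta>1 * g s"
    and \<tau>0: "\<tau>0 \<in> {0, 1}"
begin

definition \<kappa> where "\<kappa> = k3 - real \<tau>0 * kernel_mass g"

definition memory_energy :: "rn_state \<Rightarrow> real" where
  "memory_energy S = (LINT s:{0..}|lborel. g s * (cmod (hat_eta S s))\<^sup>2)"

definition memory_mean :: "rn_state \<Rightarrow> complex" where
  "memory_mean S = (LINT s:{0..}|lborel. of_real (g s) * hat_eta S s)"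

definition memory_mean' :: "rn_state \<Rightarrow> complex" where
  "memory_mean' S = (LINT s:{0..}|lborel. of_real (g' s) * hat_eta S s)"

definition memory_energy' :: "rn_state \<Rightarrow> real" where
  "memory_energy' S = (LINT s:{0..}|lborel. g' s * (cmod (hat_eta S s))\<^sup>2)"

abbreviation damping :: "real \<Rightarrow> rn_state \<Rightarrow> complex" where
  "damping \<equiv> rn_damping \<tau>0 \<gamma> g"

definition solution :: "real \<Rightarrow> (real \<Rightarrow> rn_state) \<Rightarrow> bool" where
  "solution \<xi> U \<longleftrightarrow> rn_compatible l \<xi> (U 0) \<and> rn_solution \<tau>0 \<rho>1 \<rho>2 \<rho>3 k0 k1 k2 k3 \<gamma> l g \<xi> U"

lemma \<kappa>_pos: "0 < \<kappa>"
  using \<tau>0 mass pos by (auto simp: \<kappa>_def)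

lemma abs_g'_le: "\<bar>g' s\<bar> \<le> \<beta>2 * g s" if "0 \<le> s"
proof -
  have "0 \<le> \<beta>1 * g s" using g_nonneg[OF that] \<beta>_pos by simp
  then show ?thesis using g'_bounds[OF that] by linarith
qed

lemma solution_derivs:
  assumes "solution \<xi> U" "0 \<le> t"
  shows "((\<lambda>t. hat_v (U t)) has_vector_derivative \<i> * of_real \<xi> * hat_u (U t)) (at t within {0..})"
    and "((\<lambda>t. hat_u (U t)) has_vector_derivative
          (\<i> * of_real (k1 * \<xi>) * hat_v (U t) - of_real k0 * hat_p (U t)) / of_real \<rho>1) (at t within {0..})"
    and "((\<lambda>t. hat_z (U t)) has_vector_derivative \<i> * of_real \<xi> * hat_y (U t)) (at t within {0..})"
    and "((\<lambda>t. hat_y (U t)) has_vector_derivative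
          (\<i> * of_real (k2 * \<xi>) * hat_z (U t) - of_real k0 * hat_p (U t)) / of_real \<rho>2) (at t within {0..})"
    and "((\<lambda>t. hat_phi (U t)) has_vector_derivative - of_real (\<xi>\<^sup>2) * hat_theta (U t)) (at t within {0..})"
    and "((\<lambda>t. hat_theta (U t)) has_vector_derivative
          (of_real (\<kappa> * \<xi>\<^sup>2) * hat_phi (U t) + \<i> * of_real (l * k0 * \<xi>) * hat_p (U t)
            - damping \<xi> (U t)) / of_real \<rho>3) (at t within {0..})"
    and "((\<lambda>t. hat_p (U t)) has_vector_derivative
          hat_u (U t) + hat_y (U t) + \<i> * of_real (l * \<xi>) * hat_theta (U t)) (at t within {0..})"
proof -
  have div: "(f has_vector_derivative d / of_real \<rho>) F"
    if "((\<lambda>t. of_real \<rho> * f t) has_vector_derivative d) F" "\<rho> > 0" for f :: "real \<Rightarrow> complex" and \<rho> d F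
    using has_vector_derivative_mult_right[OF that(1), of "1 / of_real \<rho>"] that(2) by simp
  note sol = assms(1)[unfolded solution_def rn_solution_def, THEN conjunct2, THEN conjunct1, rule_format, OF assms(2)]
  show "((\<lambda>t. hat_v (U t)) has_vector_derivative \<i> * of_real \<xi> * hat_u (U t)) (at t within {0..})"
    "((\<lambda>t. hat_z (U t)) has_vector_derivative \<i> * of_real \<xi> * hat_y (U t)) (at t within {0..})"
    "((\<lambda>t. hat_phi (U t)) has_vector_derivative - of_real (\<xi>\<^sup>2) * hat_theta (U t)) (at t within {0..})"
    "((\<lambda>t. hat_p (U t)) has_vector_derivative
          hat_u (U t) + hat_y (U t) + \<i> * of_real (l * \<xi>) * hat_theta (U t)) (at t within {0..})"
    using sol by blast+
  show "((\<lambda>t. hat_u (U t)) has_vector_derivative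
          (\<i> * of_real (k1 * \<xi>) * hat_v (U t) - of_real k0 * hat_p (U t)) / of_real \<rho>1) (at t within {0..})"
    by (rule div) (use sol pos in blast)+
  show "((\<lambda>t. hat_y (U t)) has_vector_derivative
          (\<i> * of_real (k2 * \<xi>) * hat_z (U t) - of_real k0 * hat_p (U t)) / of_real \<rho>2) (at t within {0..})"
    by (rule div) (use sol pos in blast)+
  show "((\<lambda>t. hat_theta (U t)) has_vector_derivative
          (of_real (\<kappa> * \<xi>\<^sup>2) * hat_phi (U t) + \<i> * of_real (l * k0 * \<xi>) * hat_p (U t)
            - damping \<xi> (U t)) / of_real \<rho>3) (at t within {0..})"
    unfolding \<kappa>_def by (rule div) (use sol pos in blast)+
qed

text \<open>The defect of the relation has derivative 0: the velocities cancel against v' and z',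
  and the \<theta> terms of p' and \<phi>' against each other.\<close>

lemma solution_compatible:
  assumes "solution \<xi> U" "0 \<le> t"
  shows "rn_compatible l \<xi> (U t)"
proof -
  define c where "c t = \<i> * of_real \<xi> * hat_p (U t) - hat_v (U t) - hat_z (U t) - of_real l * hat_phi (U t)" for t
  have "(c has_vector_derivative 0) (at s within {0..})" if "0 \<le> s" for s
    unfolding c_def
    by (rule has_vector_derivative_eq_rhs)
      ((rule has_vector_derivative_diff has_vector_derivative_mult_right solution_derivs[OF assms(1) that])+,
       simp add: algebra_simps power2_eq_square)
  then have "\<And>s. s \<in> {0..} \<Longrightarrow> (c has_vector_derivative 0) (at s within {0..})"
    by simp
  then have "c t = c 0"
    using has_vector_derivative_zero_constant[of "{0..}" c] assms(2) by (metis atLeast_iff convex_real_interval(1) order_refl)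
  then show ?thesis
    using assms(1) by (simp add: c_def solution_def rn_compatible_def algebra_simps)
qed

lemma solution_history:
  assumes "solution \<xi> U" "\<tau>0 = 1" "0 \<le> t"
  shows "rn_history g (hat_eta (U t))" "hat_eta (U t) 0 = 0"
    and "0 \<le> s \<Longrightarrow> has_transport_derivative (\<lambda>t. hat_eta (U t)) (hat_theta (U t)) t s"
  using assms unfolding solution_def rn_solution_def by blast+

text \<open>A function that is not integrable has Bochner integral 0 by convention, so positive mass
  already forces integrability.\<close>

lemma g_integrable: "set_integrable lborel {0..} g"
  using mass(1) not_integrable_integral_eq[of lborel "\<lambda>s. indicat_real {0..} s *\<^sub>R g s"]
  by (fastforce simp: kernel_mass_def set_lebesgue_integral_def set_integrable_def)

lemma g_measurable: "set_borel_measurable lborel {0..} g" "set_borel_measurable lborel {0..} g'"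
proof -
  have "continuous_on {0..} g"
    using g_deriv DERIV_continuous by (fastforce simp: continuous_on_eq_continuous_within)
  then show "set_borel_measurable lborel {0..} g" "set_borel_measurable lborel {0..} g'"
    using g'_cont borel_measurable_continuous_on_indicator[of "{0..}" g] borel_measurable_continuous_on_indicator[of "{0..}" g']
    by (simp_all add: set_borel_measurable_def)
qed

text \<open>Everything is dominated by g and g |h|^2: first powers by |h| \<le> 1 + |h|^2, and terms
  with g' by |g'| \<le> \<beta>2 g.\<close>

lemma history_integrable:
  assumes "rn_history g h"
  shows "set_integrable lborel {0..} (\<lambda>s. g s * (cmod (h s))\<^sup>2)"
    and "set_integrable lborel {0..} (\<lambda>s. g s * cmod (h s))"
    and "set_integrable lborel {0..} (\<lambda>s. of_real (g s) * h s)"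
    and "set_integrable lborel {0..} (\<lambda>s. of_real (g' s) * h s)"
    and "set_integrable lborel {0..} (\<lambda>s. g' s * (cmod (h s))\<^sup>2)"
proof -
  note meas = assms[unfolded rn_history_def, THEN conjunct1] g_measurable
  show int2: "set_integrable lborel {0..} (\<lambda>s. g s * (cmod (h s))\<^sup>2)"
    using assms by (simp add: rn_history_def)
  have int01: "set_integrable lborel {0..} (\<lambda>s. g s + g s * (cmod (h s))\<^sup>2)"
    by (rule set_integral_add[OF g_integrable int2])
  show int1: "set_integrable lborel {0..} (\<lambda>s. g s * cmod (h s))"
  proof (rule set_integrable_bound[OF int01])
    show "AE s in lborel. s \<in> {0..} \<longrightarrow> norm (g s * cmod (h s)) \<le> norm (g s + g s * (cmod (h s))\<^sup>2)"
    proof (intro AE_I2 impI)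
      fix s :: real assume "s \<in> {0..}"
      then have g: "0 \<le> g s" by (simp add: g_nonneg)
      have "0 \<le> (cmod (h s) - 1)\<^sup>2 + (cmod (h s))\<^sup>2 + 1" by simp
      then have "cmod (h s) \<le> 1 + (cmod (h s))\<^sup>2" by (simp add: power2_eq_square algebra_simps)
      then have "g s * cmod (h s) \<le> g s * (1 + (cmod (h s))\<^sup>2)" using g by (rule mult_left_mono)
      then show "norm (g s * cmod (h s)) \<le> norm (g s + g s * (cmod (h s))\<^sup>2)"
        using g by (simp add: algebra_simps)
    qed
  qed (intro set_borel_measurable_times set_borel_measurable_cmod meas)
  show "set_integrable lborel {0..} (\<lambda>s. of_real (g s) * h s)"
    by (rule set_integrable_bound[OF int1])
      (auto simp: norm_mult intro!: set_borel_measurable_times set_borel_measurable_of_real meas)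
  have int1': "set_integrable lborel {0..} (\<lambda>s. \<beta>2 * (g s * cmod (h s)))"
    by (rule set_integrable_mult_right) (rule int1)
  show "set_integrable lborel {0..} (\<lambda>s. of_real (g' s) * h s)"
  proof (rule set_integrable_bound[OF int1'])
    show "AE s in lborel. s \<in> {0..} \<longrightarrow> norm (complex_of_real (g' s) * h s) \<le> norm (\<beta>2 * (g s * cmod (h s)))"
    proof (intro AE_I2 impI)
      fix s :: real assume "s \<in> {0..}"
      then have "\<bar>g' s\<bar> * cmod (h s) \<le> (\<beta>2 * g s) * cmod (h s)" "0 \<le> g s"
        using mult_right_mono[OF abs_g'_le] g_nonneg \<beta>_pos by simp_all
      then show "norm (complex_of_real (g' s) * h s) \<le> norm (\<beta>2 * (g s * cmod (h s)))"
        unfolding norm_mult norm_of_real real_norm_def abs_mult abs_norm_cancel using \<beta>_pos by simp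
    qed
  qed (intro set_borel_measurable_times set_borel_measurable_of_real meas)
  have int2': "set_integrable lborel {0..} (\<lambda>s. \<beta>2 * (g s * (cmod (h s))\<^sup>2))"
    by (rule set_integrable_mult_right) (rule int2)
  show "set_integrable lborel {0..} (\<lambda>s. g' s * (cmod (h s))\<^sup>2)"
  proof (rule set_integrable_bound[OF int2'])
    show "AE s in lborel. s \<in> {0..} \<longrightarrow> norm (g' s * (cmod (h s))\<^sup>2) \<le> norm (\<beta>2 * (g s * (cmod (h s))\<^sup>2))"
    proof (intro AE_I2 impI)
      fix s :: real assume "s \<in> {0..}"
      then have "\<bar>g' s\<bar> * (cmod (h s))\<^sup>2 \<le> (\<beta>2 * g s) * (cmod (h s))\<^sup>2" "0 \<le> g s"
        using mult_right_mono[OF abs_g'_le] g_nonneg \<beta>_pos by simp_all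
      then show "norm (g' s * (cmod (h s))\<^sup>2) \<le> norm (\<beta>2 * (g s * (cmod (h s))\<^sup>2))"
        unfolding real_norm_def abs_mult using \<beta>_pos by simp
    qed
    show "set_borel_measurable lborel {0..} (\<lambda>s. g' s * (cmod (h s))\<^sup>2)"
      unfolding power2_eq_square by (intro set_borel_measurable_times set_borel_measurable_cmod meas)
  qed
qed

text \<open>Integrate g (|h| - A/m)^2 \<ge> 0, where A is the integral of g |h| and m the mass; A/m
  is the mean of |h| with respect to g, the shift that gives the sharp inequality.\<close>

lemma history_Cauchy_Schwarz:
  assumes "rn_history g h"
  shows "(LINT s:{0..}|lborel. g s * cmod (h s))\<^sup>2 \<le> kernel_mass g * (LINT s:{0..}|lborel. g s * (cmod (h s))\<^sup>2)"
proof -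
  define A where "A = (LINT s:{0..}|lborel. g s * cmod (h s))"
  define m where "m = kernel_mass g"
  note int = history_integrable[OF assms] g_integrable
  have "0 \<le> (LINT s:{0..}|lborel. g s * (cmod (h s))\<^sup>2 + (A / m)\<^sup>2 * g s - 2 * (A / m) * (g s * cmod (h s)))"
    unfolding set_lebesgue_integral_def
  proof (rule integral_nonneg_AE, intro AE_I2)
    fix s :: real
    have "0 \<le> indicat_real {0..} s * (g s * (cmod (h s) - A / m)\<^sup>2)"
      by (simp add: g_nonneg indicator_def)
    then show "0 \<le> indicat_real {0..} s *\<^sub>R (g s * (cmod (h s))\<^sup>2 + (A / m)\<^sup>2 * g s - 2 * (A / m) * (g s * cmod (h s)))"
      by (simp add: power2_eq_square algebra_simps)
  qed
  also have "\<dots> = (LINT s:{0..}|lborel. g s * (cmod (h s))\<^sup>2) + (A / m)\<^sup>2 * m - 2 * (A / m) * A"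
    using int by (simp add: A_def m_def kernel_mass_def)
  finally have "(A / m)\<^sup>2 * m \<le> (LINT s:{0..}|lborel. g s * (cmod (h s))\<^sup>2)"
    using mass(1) by (simp add: m_def power2_eq_square field_simps)
  then show ?thesis
    using mass(1) by (simp add: A_def m_def power2_eq_square field_simps)
qed

text \<open>The two bounds on g' do different work: |g'| \<le> \<beta>2 g makes the mean with kernel
  g' no worse than the mean itself, while g' \<le> - \<beta>1 g turns the derivative of the memory
  energy into dissipation.\<close>

lemma memory_bounds:
  assumes "rn_history g (hat_eta S)"
  shows "0 \<le> memory_energy S"
    and "cmod (memory_mean S) \<le> sqrt (kernel_mass g) * sqrt (memory_energy S)"
    and "cmod (memory_mean' S) \<le> \<beta>2 * sqrt (kernel_mass g) * sqrt (memory_energy S)"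
    and "memory_energy' S \<le> - \<beta>1 * memory_energy S"
proof -
  define A where "A = (LINT s:{0..}|lborel. g s * cmod (hat_eta S s))"
  note int = history_integrable[OF assms]
  show "0 \<le> memory_energy S"
    unfolding memory_energy_def set_lebesgue_integral_def
    by (rule integral_nonneg_AE) (simp add: g_nonneg indicator_def)
  have A: "A \<le> sqrt (kernel_mass g) * sqrt (memory_energy S)"
    using real_le_rsqrt[OF history_Cauchy_Schwarz[OF assms, folded A_def]]
    by (simp add: memory_energy_def real_sqrt_mult)
  have "cmod (memory_mean S) \<le> (LINT s:{0..}|lborel. cmod (of_real (g s) * hat_eta S s))"
    unfolding memory_mean_def by (rule set_integral_norm_bound[OF int(3)])
  also have "\<dots> = A"
    unfolding A_def by (rule set_lebesgue_integral_cong) (auto simp: norm_mult g_nonneg)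
  finally show "cmod (memory_mean S) \<le> sqrt (kernel_mass g) * sqrt (memory_energy S)"
    using A by simp
  have "cmod (memory_mean' S) \<le> (LINT s:{0..}|lborel. cmod (of_real (g' s) * hat_eta S s))"
    unfolding memory_mean'_def by (rule set_integral_norm_bound[OF int(4)])
  also have "\<dots> \<le> (LINT s:{0..}|lborel. \<beta>2 * (g s * cmod (hat_eta S s)))"
  proof (rule set_integral_mono)
    fix s :: real assume "s \<in> {0..}"
    then have "\<bar>g' s\<bar> * cmod (hat_eta S s) \<le> (\<beta>2 * g s) * cmod (hat_eta S s)"
      using mult_right_mono[OF abs_g'_le] by simp
    then show "cmod (of_real (g' s) * hat_eta S s) \<le> \<beta>2 * (g s * cmod (hat_eta S s))"
      by (simp add: norm_mult mult.assoc)
  qed (use int(2) set_integrable_norm[OF int(4)] in auto)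
  also have "\<dots> = \<beta>2 * A"
    by (simp add: A_def)
  also have "\<dots> \<le> \<beta>2 * (sqrt (kernel_mass g) * sqrt (memory_energy S))"
    using A \<beta>_pos by simp
  finally show "cmod (memory_mean' S) \<le> \<beta>2 * sqrt (kernel_mass g) * sqrt (memory_energy S)"
    by simp
  have "memory_energy' S \<le> (LINT s:{0..}|lborel. - \<beta>1 * (g s * (cmod (hat_eta S s))\<^sup>2))"
    unfolding memory_energy'_def
  proof (rule set_integral_mono[OF int(5)])
    show "set_integrable lborel {0..} (\<lambda>s. - \<beta>1 * (g s * (cmod (hat_eta S s))\<^sup>2))"
      using int(1) by (rule set_integrable_mult_right)
    fix s :: real assume "s \<in> {0..}"
    then have "g' s * (cmod (hat_eta S s))\<^sup>2 \<le> (- \<beta>1 * g s) * (cmod (hat_eta S s))\<^sup>2"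
      using g'_bounds[of s] by (intro mult_right_mono) auto
    then show "g' s * (cmod (hat_eta S s))\<^sup>2 \<le> - \<beta>1 * (g s * (cmod (hat_eta S s))\<^sup>2)"
      by simp
  qed
  also have "\<dots> = - \<beta>1 * memory_energy S"
    unfolding memory_energy_def by (rule set_integral_mult_right)
  finally show "memory_energy' S \<le> - \<beta>1 * memory_energy S" .
qed

text \<open>Along a characteristic the history is differentiable with derivative \<theta>, so the
  mean value inequality applies there. Regularity across characteristics does not enter, so
  histories that jump across them are covered.\<close>

lemma history_lipschitz:
  assumes "solution \<xi> U" "\<tau>0 = 1" "0 \<le> t" "0 \<le> s" "0 \<le> t + r" "0 \<le> s + r" "t \<le> T" "t + r \<le> T"
    and L: "\<And>x. 0 \<le> x \<Longrightarrow> x \<le> T \<Longrightarrow> cmod (hat_theta (U x)) \<le> L"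
  shows "cmod (hat_eta (U (t + r)) (s + r) - hat_eta (U t) s) \<le> L * \<bar>r\<bar>"
proof -
  let ?S = "closed_segment 0 r"
  have S: "0 \<le> t + x \<and> 0 \<le> s + x \<and> t + x \<le> T" if "x \<in> ?S" for x
    using that assms by (auto simp: closed_segment_eq_real_ivl split: if_splits)
  have "norm ((\<lambda>x. hat_eta (U (t + x)) (s + x)) r - (\<lambda>x. hat_eta (U (t + x)) (s + x)) 0) \<le> L * \<bar>r - 0\<bar>"
  proof (rule vector_differentiable_bound[of ?S])
    fix x assume x: "x \<in> ?S"
    have "has_transport_derivative (\<lambda>t. hat_eta (U t)) (hat_theta (U (t + x))) (t + x) (s + x)"
      using S[OF x] by (intro solution_history(3)[OF assms(1,2)]) auto
    then have "((\<lambda>x. hat_eta (U (t + x)) (s + x)) has_vector_derivative hat_theta (U (t + x)))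
        (at x within {x. 0 \<le> t + x \<and> 0 \<le> s + x})"
      using has_vector_derivative_shift_at_0[of "\<lambda>x. hat_eta (U (t + x)) (s + x)" x _ "{x. 0 \<le> t + x \<and> 0 \<le> s + x}"]
      by (simp add: has_transport_derivative_def add.assoc)
    then show "((\<lambda>x. hat_eta (U (t + x)) (s + x)) has_vector_derivative hat_theta (U (t + x))) (at x within ?S)"
      by (rule has_vector_derivative_within_subset) (use S in auto)
    show "norm (hat_theta (U (t + x))) \<le> L"
      using S[OF x] L by auto
  qed auto
  then show ?thesis by simp
qed

lemma solution_theta_bounded:
  assumes "solution \<xi> U"
  obtains L where "0 \<le> L" "\<And>x. 0 \<le> x \<Longrightarrow> x \<le> T \<Longrightarrow> cmod (hat_theta (U x)) \<le> L"
proof -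
  have "continuous_on {0..} (\<lambda>t. hat_theta (U t))"
    using solution_derivs(6)[OF assms] by (intro continuous_on_vector_derivative) auto
  then have "continuous_on {0..T} (\<lambda>t. hat_theta (U t))"
    by (rule continuous_on_subset) auto
  then have "bounded ((\<lambda>t. hat_theta (U t)) ` {0..T})"
    by (intro compact_imp_bounded compact_continuous_image) auto
  then obtain L where "L > 0" "\<And>x. 0 \<le> x \<Longrightarrow> x \<le> T \<Longrightarrow> cmod (hat_theta (U x)) \<le> L"
    by (auto simp: bounded_pos)
  then show ?thesis using that[of L] by auto
qed

lemma memory_derivs:
  assumes "solution \<xi> U" "\<tau>0 = 1" "0 \<le> t"
  shows "((\<lambda>t. memory_mean (U t)) has_vector_derivative
            of_real (kernel_mass g) * hat_theta (U t) + memory_mean' (U t)) (at t within {0..})"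
    and "((\<lambda>t. memory_energy (U t)) has_real_derivative
            memory_energy' (U t) + 2 * (memory_mean (U t) \<bullet> hat_theta (U t))) (at t within {0..})"
proof -
  \<comment> \<open>The window reaches to \<open>t + 1\<close> because the increments of time go up
    to 1.\<close>
  obtain L where L: "0 \<le> L" "\<And>x. 0 \<le> x \<Longrightarrow> x \<le> t + 1 \<Longrightarrow> cmod (hat_theta (U x)) \<le> L"
    using solution_theta_bounded[OF assms(1)] by metis
  define \<eta> where "\<eta> t = hat_eta (U t)" for t
  define \<theta> where "\<theta> = hat_theta (U t)"
  note lip = history_lipschitz[OF assms(1,2), where T = "t + 1", OF _ _ _ _ _ _ L(2), folded \<eta>_def]
  have hist: "rn_history g (\<eta> t)" if "0 \<le> t" for t
    using solution_history(1)[OF assms(1,2) that] by (simp add: \<eta>_def)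
  note int = history_integrable[OF hist]
  have \<eta>0: "\<eta> t 0 = 0" if "0 \<le> t" for t
    using solution_history(2)[OF assms(1,2) that] by (simp add: \<eta>_def)
  have lip1: "cmod (\<eta> (t + r) (s + r) - \<eta> t s) \<le> \<bar>r\<bar> * L"
    if "\<bar>r\<bar> \<le> 1" "0 \<le> t + r" "0 \<le> s" "0 \<le> s + r" for r s
    using lip[of t s r] that \<open>0 \<le> t\<close> by (simp add: mult.commute)
  \<comment> \<open>The characteristic through \<open>(t', s)\<close> starts at
    \<open>(t' - s, 0)\<close>, where the history vanishes.\<close>
  have small1: "cmod (\<eta> t' s) \<le> L * s" if "0 \<le> s" "s \<le> 1" "s \<le> t'" "t' \<le> t + 1" for t' s
    using lip[of "t' - s" 0 s] \<eta>0[of "t' - s"] that by simp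
  have der: "((\<lambda>r. \<eta> (t + r) (s + r)) has_vector_derivative \<theta>) (at 0 within {r. 0 \<le> t + r \<and> 0 \<le> s + r})"
    if "0 < s" for s
    using solution_history(3)[OF assms] that unfolding has_transport_derivative_def \<eta>_def \<theta>_def by simp
  have dint1: "set_integrable lborel {0..} (\<lambda>s. of_real (g s) * \<theta>)"
  proof -
    have "set_integrable lborel {0..} (\<lambda>s. complex_of_real (g s))"
      using integrable_of_real[OF g_integrable[unfolded set_integrable_def], where 'a=complex]
      by (simp add: set_integrable_def scaleR_conv_of_real)
    then show ?thesis by (rule set_integrable_mult_left)
  qed
  have "((\<lambda>t. LINT s:{0..}|lborel. g s *\<^sub>R \<eta> t s) has_vector_derivative
            (LINT s:{0..}|lborel. g' s *\<^sub>R \<eta> t s + g s *\<^sub>R \<theta>)) (at t within {0..})"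
  proof (rule has_vector_derivative_memory_integral[OF g_deriv g_nonneg abs_g'_le _ assms(3) _ der _ lip1 _ small1])
    show "set_borel_measurable lborel {0..} (\<lambda>s. g' s *\<^sub>R \<eta> t s + g s *\<^sub>R \<theta>)"
      using set_integral_add(1)[OF int(4)[OF assms(3)] dint1]
      by (auto simp: scaleR_conv_of_real set_borel_measurable_def set_integrable_def)
    show "set_integrable lborel {0..} (\<lambda>s. g s * L)"
      using g_integrable by (rule set_integrable_mult_left)
  qed (use \<beta>_pos int(3) in \<open>auto simp: scaleR_conv_of_real\<close>)
  moreover have "(LINT s:{0..}|lborel. of_real (g s) * \<theta>) = of_real (kernel_mass g) * \<theta>"
    using integral_of_real[OF g_integrable[unfolded set_integrable_def], where 'a=complex]
    by (simp add: kernel_mass_def set_lebesgue_integral_def scaleR_conv_of_real)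
  moreover have "(LINT s:{0..}|lborel. g' s *\<^sub>R \<eta> t s + g s *\<^sub>R \<theta>) =
      memory_mean' (U t) + (LINT s:{0..}|lborel. of_real (g s) * \<theta>)"
    using set_integral_add(2)[OF int(4)[OF assms(3)] dint1]
    by (simp only: memory_mean'_def \<eta>_def scaleR_conv_of_real)
  ultimately show "((\<lambda>t. memory_mean (U t)) has_vector_derivative
            of_real (kernel_mass g) * hat_theta (U t) + memory_mean' (U t)) (at t within {0..})"
    by (simp only: memory_mean_def \<eta>_def \<theta>_def scaleR_conv_of_real add.commute)
  have dint2: "set_integrable lborel {0..} (\<lambda>s. 2 * ((of_real (g s) * \<eta> t s) \<bullet> \<theta>))"
    by (rule set_integrable_mult_right)
      (use integrable_inner_left[OF int(3)[OF assms(3), unfolded set_integrable_def], of \<theta>] in \<open>simp add: set_integrable_def\<close>)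
  have "((\<lambda>t. LINT s:{0..}|lborel. g s *\<^sub>R (cmod (\<eta> t s))\<^sup>2) has_vector_derivative
            (LINT s:{0..}|lborel. g' s *\<^sub>R (cmod (\<eta> t s))\<^sup>2 + g s *\<^sub>R (2 * (\<eta> t s \<bullet> \<theta>)))) (at t within {0..})"
  proof (rule has_vector_derivative_memory_integral[OF g_deriv g_nonneg abs_g'_le _ assms(3)])
    fix s :: real assume "0 < s"
    show "((\<lambda>r. (cmod (\<eta> (t + r) (s + r)))\<^sup>2) has_vector_derivative 2 * (\<eta> t s \<bullet> \<theta>))
        (at 0 within {r. 0 \<le> t + r \<and> 0 \<le> s + r})"
      using has_real_derivative_inner[OF der[OF \<open>0 < s\<close>] der[OF \<open>0 < s\<close>]]
      by (simp add: power2_norm_eq_inner has_real_derivative_iff_has_vector_derivative inner_commute)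
  next
    show "set_borel_measurable lborel {0..} (\<lambda>s. g' s *\<^sub>R (cmod (\<eta> t s))\<^sup>2 + g s *\<^sub>R (2 * (\<eta> t s \<bullet> \<theta>)))"
      using set_integral_add(1)[OF int(5)[OF assms(3)] dint2]
      by (auto simp: set_borel_measurable_def set_integrable_def mult.left_commute simp flip: scaleR_conv_of_real)
  next
    fix r s :: real assume r: "\<bar>r\<bar> \<le> 1" "0 \<le> t + r" "0 \<le> s" "0 \<le> s + r"
    let ?x = "\<eta> (t + r) (s + r)" and ?y = "\<eta> t s"
    have d: "cmod (?x - ?y) \<le> \<bar>r\<bar> * L" by (rule lip1[OF r])
    also have "\<dots> \<le> L" using r L(1) by (simp add: mult_left_le_one_le)
    finally have "cmod ?x \<le> cmod ?y + L" using norm_triangle_ineq2[of ?x ?y] by linarith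
    have "\<bar>(cmod ?x)\<^sup>2 - (cmod ?y)\<^sup>2\<bar> = \<bar>cmod ?x - cmod ?y\<bar> * (cmod ?x + cmod ?y)"
      by (simp add: power2_eq_square square_diff_square_factored abs_mult)
    also have "\<dots> \<le> (\<bar>r\<bar> * L) * (2 * cmod ?y + L)"
      using d norm_triangle_ineq3[of ?x ?y] \<open>cmod ?x \<le> cmod ?y + L\<close> L(1)
      by (intro mult_mono) auto
    finally show "norm ((cmod ?x)\<^sup>2 - (cmod ?y)\<^sup>2) \<le> \<bar>r\<bar> * (L * (2 * cmod ?y + L))"
      by (simp add: mult.assoc)
  next
    \<comment> \<open>The Lipschitz constant for the squared history is linear in its modulus, so
      integrability of g |\<eta>| suffices.\<close>
    have "set_integrable lborel {0..} (\<lambda>s. 2 * L * (g s * cmod (\<eta> t s)) + L\<^sup>2 * g s)"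
      using int(2)[OF assms(3)] g_integrable by (intro set_integral_add set_integrable_mult_right)
    then show "set_integrable lborel {0..} (\<lambda>s. g s * (L * (2 * cmod (\<eta> t s) + L)))"
      by (simp add: algebra_simps power2_eq_square)
  next
    fix t' s :: real assume s: "0 \<le> s" "s \<le> 1" "s \<le> t'" "t' \<le> t + 1"
    \<comment> \<open>Near the boundary the square is even of order s^2; \<open>s \<le> 1\<close>
      weakens this to the linear bound asked for.\<close>
    have "(cmod (\<eta> t' s))\<^sup>2 \<le> (L * s)\<^sup>2"
      using small1[OF s] by (intro power_mono) auto
    also have "\<dots> \<le> L\<^sup>2 * s"
      using mult_left_mono[of "s * s" s "L\<^sup>2"] s mult_left_le[of s s]
      by (simp add: power2_eq_square algebra_simps)
    finally show "norm ((cmod (\<eta> t' s))\<^sup>2) \<le> L\<^sup>2 * s" by simp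
  qed (use \<beta>_pos int(1) in auto)
  moreover have "(LINT s:{0..}|lborel. 2 * ((of_real (g s) * \<eta> t s) \<bullet> \<theta>)) = 2 * (memory_mean (U t) \<bullet> \<theta>)"
    using integral_inner_left[OF int(3)[OF assms(3), unfolded set_integrable_def], of \<theta>]
    by (simp add: set_lebesgue_integral_def memory_mean_def \<eta>_def)
  ultimately show "((\<lambda>t. memory_energy (U t)) has_real_derivative
            memory_energy' (U t) + 2 * (memory_mean (U t) \<bullet> hat_theta (U t))) (at t within {0..})"
    using set_integral_add(2)[OF int(5)[OF assms(3)] dint2]
    by (simp add: memory_energy_def memory_energy'_def \<eta>_def \<theta>_def has_real_derivative_iff_has_vector_derivative
        mult.left_commute flip: scaleR_conv_of_real)
qed


subsection \<open>Energy and dissipation\<close>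

definition energy :: "real \<Rightarrow> rn_state \<Rightarrow> real" where
  "energy \<xi> S = k1 * (cmod (hat_v S))\<^sup>2 + \<rho>1 * (cmod (hat_u S))\<^sup>2 + k2 * (cmod (hat_z S))\<^sup>2
    + \<rho>2 * (cmod (hat_y S))\<^sup>2 + \<kappa> * (cmod (hat_phi S))\<^sup>2 + \<rho>3 * (cmod (hat_theta S))\<^sup>2
    + k0 * (cmod (hat_p S))\<^sup>2 + real \<tau>0 * \<xi>^4 * memory_energy S"

definition dissipation :: "real \<Rightarrow> rn_state \<Rightarrow> real" where
  "dissipation \<xi> S = (if \<tau>0 = 0 then (cmod (hat_theta S))\<^sup>2 else \<xi>^4 * memory_energy S)"

definition rate :: real where
  "rate = (if \<tau>0 = 0 then 2 * \<gamma> else \<beta>1)"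

definition norm2 :: "real \<Rightarrow> rn_state \<Rightarrow> real" where
  "norm2 \<xi> S = (cmod (hat_v S))\<^sup>2 + (cmod (hat_u S))\<^sup>2 + (cmod (hat_z S))\<^sup>2 + (cmod (hat_y S))\<^sup>2
     + (cmod (hat_phi S))\<^sup>2 + (cmod (hat_theta S))\<^sup>2 + (cmod (hat_p S))\<^sup>2
     + real \<tau>0 * \<xi>^4 * memory_energy S"

text \<open>What a state on a solution satisfies at a nonzero frequency, without reference to time:
  bounds on multipliers are proved once for such states.\<close>

definition admissible :: "real \<Rightarrow> rn_state \<Rightarrow> bool" where
  "admissible \<xi> S \<longleftrightarrow> \<xi> \<noteq> 0 \<and> rn_compatible l \<xi> S \<and> (\<tau>0 = 1 \<longrightarrow> rn_history g (hat_eta S))"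

lemma rn_norm_eq: "rn_norm \<tau>0 g \<xi> S = sqrt (norm2 \<xi> S)"
  by (simp add: rn_norm_def norm2_def memory_energy_def)

lemma memory_term_nonneg: "\<tau>0 = 1 \<longrightarrow> rn_history g (hat_eta S) \<Longrightarrow> 0 \<le> real \<tau>0 * \<xi>^4 * memory_energy S"
  using \<tau>0 memory_bounds(1)[of S] by auto

lemma rate_pos: "0 < rate"
  using pos \<beta>_pos by (simp add: rate_def)

lemma solution_admissible: "solution \<xi> U \<Longrightarrow> \<xi> \<noteq> 0 \<Longrightarrow> 0 \<le> t \<Longrightarrow> admissible \<xi> (U t)"
  using solution_compatible solution_history by (auto simp: admissible_def)

definition moment :: "real \<Rightarrow> rn_state \<Rightarrow> complex" where
  "moment \<xi> S = (\<kappa> * \<xi>) *\<^sub>R hat_phi S + (l * k0) *\<^sub>R (\<i> * hat_p S)"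

lemma basic_derivs:
  assumes "solution \<xi> U" "0 \<le> t"
  shows "((\<lambda>t. hat_v (U t)) has_vector_derivative \<xi> *\<^sub>R (\<i> * hat_u (U t))) (at t within {0..})"
    and "((\<lambda>t. hat_u (U t)) has_vector_derivative
          (k1 * \<xi> / \<rho>1) *\<^sub>R (\<i> * hat_v (U t)) - (k0 / \<rho>1) *\<^sub>R hat_p (U t)) (at t within {0..})"
    and "((\<lambda>t. hat_z (U t)) has_vector_derivative \<xi> *\<^sub>R (\<i> * hat_y (U t))) (at t within {0..})"
    and "((\<lambda>t. hat_y (U t)) has_vector_derivative
          (k2 * \<xi> / \<rho>2) *\<^sub>R (\<i> * hat_z (U t)) - (k0 / \<rho>2) *\<^sub>R hat_p (U t)) (at t within {0..})"
    and "((\<lambda>t. hat_phi (U t)) has_vector_derivative - (\<xi>\<^sup>2 *\<^sub>R hat_theta (U t))) (at t within {0..})"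
    and "((\<lambda>t. hat_theta (U t)) has_vector_derivative
          (1 / \<rho>3) *\<^sub>R (\<xi> *\<^sub>R moment \<xi> (U t) - damping \<xi> (U t))) (at t within {0..})"
    and "((\<lambda>t. hat_p (U t)) has_vector_derivative
          hat_u (U t) + hat_y (U t) + (l * \<xi>) *\<^sub>R (\<i> * hat_theta (U t))) (at t within {0..})"
  by ((rule has_vector_derivative_eq_rhs, rule solution_derivs[OF assms], insert pos,
      simp add: moment_def scaleR_conv_of_real field_simps power2_eq_square)+)

text \<open>With memory, the damping is \<xi>^4 times the mean of the history, so its work cancels
  the cross term in the derivative of the memory energy; the integral with g' remains and is at most
  - \<beta>1 times the memory energy. With friction the work itself, - 2 \<gamma> |\<theta>|^2,
  remains.\<close>

lemma energy_deriv:
  assumes "solution \<xi> U" "0 \<le> t"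
  shows "\<exists>d. ((\<lambda>t. energy \<xi> (U t)) has_real_derivative d) (at t within {0..}) \<and>
             d \<le> - rate * dissipation \<xi> (U t)"
proof -
  note D = basic_derivs[OF assms]
  let ?S = "U t"
  \<comment> \<open>The mechanical part is differentiated separately. For \<tau>0 = 0 nothing is
    known about the history, and the memory energy has the coefficient 0.\<close>
  define e where "e S = energy \<xi> S - real \<tau>0 * \<xi>^4 * memory_energy S" for S
  have "((\<lambda>t. e (U t)) has_real_derivative - 2 * (damping \<xi> ?S \<bullet> hat_theta ?S)) (at t within {0..})"
    unfolding e_def energy_def power2_norm_eq_inner add_diff_cancel_right'
    by (rule DERIV_cong, (rule DERIV_add DERIV_cmult has_real_derivative_inner D)+)
      (use pos in \<open>simp add: moment_def inner_i_left inner_i_swap[of "hat_v ?S" "hat_u ?S"]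
        inner_i_swap[of "hat_z ?S" "hat_y ?S"] inner_i_swap[of "hat_p ?S" "hat_theta ?S"]
        inner_commute[of "hat_theta ?S" "damping \<xi> ?S"] inner_commute[of "hat_theta ?S" "hat_phi ?S"]
        inner_commute[of "hat_p ?S" "hat_u ?S"] inner_commute[of "hat_p ?S" "hat_y ?S"] power2_eq_square algebra_simps\<close>)
  moreover have "((\<lambda>t. real \<tau>0 * \<xi>^4 * memory_energy (U t)) has_real_derivative
      real \<tau>0 * \<xi>^4 * (memory_energy' ?S + 2 * (memory_mean ?S \<bullet> hat_theta ?S))) (at t within {0..})"
  proof (cases "\<tau>0 = 1")
    case True
    then show ?thesis by (intro DERIV_cmult memory_derivs(2)[OF assms(1) True assms(2)])
  qed (use \<tau>0 in auto)
  ultimately have "((\<lambda>t. e (U t) + real \<tau>0 * \<xi>^4 * memory_energy (U t)) has_real_derivative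
      - 2 * (damping \<xi> ?S \<bullet> hat_theta ?S)
      + real \<tau>0 * \<xi>^4 * (memory_energy' ?S + 2 * (memory_mean ?S \<bullet> hat_theta ?S))) (at t within {0..})"
    (is "(_ has_real_derivative ?d) _") by (rule DERIV_add)
  moreover have "?d \<le> - rate * dissipation \<xi> ?S"
  proof (cases "\<tau>0 = 0")
    case True
    then show ?thesis
      unfolding rn_damping_def rate_def dissipation_def
      by (simp add: power2_norm_eq_inner inner_complex_def algebra_simps)
  next
    case False
    then have 1: "\<tau>0 = 1" using \<tau>0 by auto
    have "\<xi>^4 * memory_energy' ?S \<le> \<xi>^4 * (- \<beta>1 * memory_energy ?S)"
      using memory_bounds(4)[OF solution_history(1)[OF assms(1) 1 assms(2)]] by (intro mult_left_mono) auto
    moreover have "damping \<xi> ?S = \<xi>^4 *\<^sub>R memory_mean ?S"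
      using 1 by (simp add: rn_damping_def memory_mean_def scaleR_conv_of_real)
    ultimately show ?thesis
      unfolding rate_def dissipation_def using 1 by (simp add: algebra_simps)
  qed
  ultimately show ?thesis
    unfolding e_def by auto
qed

lemma energy_norm2:
  obtains e1 e2 where "0 < e1" "0 < e2"
    "\<And>\<xi> S. (\<tau>0 = 1 \<longrightarrow> rn_history g (hat_eta S)) \<Longrightarrow> e1 * norm2 \<xi> S \<le> energy \<xi> S \<and> energy \<xi> S \<le> e2 * norm2 \<xi> S"
proof -
  \<comment> \<open>The entry 1 is the coefficient of the memory term.\<close>
  define C where "C = {k1, \<rho>1, k2, \<rho>2, \<kappa>, \<rho>3, k0, 1}"
  have C: "finite C" "C \<noteq> {}" "\<And>c. c \<in> C \<Longrightarrow> 0 < c"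
    using pos \<kappa>_pos by (auto simp: C_def)
  obtain e1 e2 where e: "\<And>c. c \<in> C \<Longrightarrow> e1 \<le> c" "\<And>c. c \<in> C \<Longrightarrow> c \<le> e2" "0 < e1" "0 < e2"
    using C Min_in[OF C(1,2)] Max_in[OF C(1,2)] by (meson Max_ge Min_le)
  have mem: "k1 \<in> C" "\<rho>1 \<in> C" "k2 \<in> C" "\<rho>2 \<in> C" "\<kappa> \<in> C" "\<rho>3 \<in> C" "k0 \<in> C" "1 \<in> C"
    by (auto simp: C_def)
  have le: "e1 * x \<le> c * x \<and> c * x \<le> e2 * x" if "c \<in> C" "0 \<le> x" for c x
    using e that by (auto intro!: mult_right_mono)
  have "e1 * norm2 \<xi> S \<le> energy \<xi> S \<and> energy \<xi> S \<le> e2 * norm2 \<xi> S"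
    if "\<tau>0 = 1 \<longrightarrow> rn_history g (hat_eta S)" for \<xi> S
    using le[OF mem(1), of "(cmod (hat_v S))\<^sup>2"] le[OF mem(2), of "(cmod (hat_u S))\<^sup>2"]
      le[OF mem(3), of "(cmod (hat_z S))\<^sup>2"] le[OF mem(4), of "(cmod (hat_y S))\<^sup>2"]
      le[OF mem(5), of "(cmod (hat_phi S))\<^sup>2"] le[OF mem(6), of "(cmod (hat_theta S))\<^sup>2"]
      le[OF mem(7), of "(cmod (hat_p S))\<^sup>2"] le[OF mem(8) memory_term_nonneg[OF that, of \<xi>]]
    by (simp add: energy_def norm2_def distrib_left)
  then show ?thesis using that e(3,4) by blast
qed

section \<open>Frequency weights and the weighted norm\<close>

definition freq :: "real \<Rightarrow> real" where
  "freq \<xi> = 1 + \<bar>\<xi>\<bar>"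

text \<open>Comparable to the inverse of the decay rate \<open>f(\<xi>)\<close> of the theorem; see \<open>cost_le\<close>.\<close>

definition cost :: "real \<Rightarrow> real" where
  "cost \<xi> = freq \<xi> ^ 10 / \<bar>\<xi>\<bar> ^ (4 + 2 * \<tau>0)"

lemma freq_bounds: "1 \<le> freq \<xi>" "\<bar>\<xi>\<bar> \<le> freq \<xi>" "0 < freq \<xi>"
  by (simp_all add: freq_def)

text \<open>The conditions on the exponents are those that both dampings allow:
  \<open>j \<le> 4\<close> is the order of \<open>cost\<close> at 0 with friction, and
  \<open>i - j \<le> 4\<close> its order at infinity with memory.\<close>

lemma freq_power_quotient_le_cost:
  assumes "\<xi> \<noteq> 0" "j \<le> 4" "i \<le> j + 4"
  shows "freq \<xi> ^ i / \<bar>\<xi>\<bar> ^ j \<le> cost \<xi>"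
proof -
  let ?m = "4 + 2 * \<tau>0"
  have m: "j \<le> ?m" "i + (?m - j) \<le> 10" using assms \<tau>0 by auto
  have "freq \<xi> ^ i * \<bar>\<xi>\<bar> ^ ?m = freq \<xi> ^ i * \<bar>\<xi>\<bar> ^ (?m - j) * \<bar>\<xi>\<bar> ^ j"
    using m by (simp flip: power_add)
  also have "\<dots> \<le> freq \<xi> ^ i * freq \<xi> ^ (?m - j) * \<bar>\<xi>\<bar> ^ j"
    using freq_bounds[of \<xi>] by (intro mult_right_mono mult_left_mono power_mono) auto
  also have "\<dots> \<le> freq \<xi> ^ 10 * \<bar>\<xi>\<bar> ^ j"
    using freq_bounds[of \<xi>] m by (intro mult_right_mono) (auto simp flip: power_add intro: power_increasing)
  finally show ?thesis
    using assms by (simp add: cost_def field_simps)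
qed

lemma one_le_cost: "\<xi> \<noteq> 0 \<Longrightarrow> 1 \<le> cost \<xi>"
  using freq_power_quotient_le_cost[of \<xi> 0 0] by simp

text \<open>The weight on p pays for the factor \<xi> in the compatibility relation, which yields v
  + z. The weight on \<phi> has one power more, to recover p from the moment. The weight on \<theta>
  has order 1/\<xi> at 0 because \<theta>/\<xi> is paired with unweighted velocities. The last term
  dominates the memory part of \<open>norm2\<close>.\<close>

definition wnorm2 :: "real \<Rightarrow> rn_state \<Rightarrow> real" where
  "wnorm2 \<xi> S = (cmod (hat_v S))\<^sup>2 + (cmod (hat_u S))\<^sup>2 + (cmod (hat_z S))\<^sup>2 + (cmod (hat_y S))\<^sup>2
     + (freq \<xi> ^ 2 * cmod (hat_phi S))\<^sup>2 + (freq \<xi> * cmod (hat_p S))\<^sup>2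
     + (freq \<xi> ^ 3 / \<bar>\<xi>\<bar> * cmod (hat_theta S))\<^sup>2 + cost \<xi> * dissipation \<xi> S"

lemma dissipation_nonneg: "admissible \<xi> S \<Longrightarrow> 0 \<le> dissipation \<xi> S"
  using \<tau>0 memory_bounds(1)[of S] by (auto simp: admissible_def dissipation_def)

lemma cost_dissipation_nonneg: "admissible \<xi> S \<Longrightarrow> 0 \<le> cost \<xi> * dissipation \<xi> S"
  using dissipation_nonneg[of \<xi> S] one_le_cost[of \<xi>] by (auto simp: admissible_def)

lemma wnorm2_bounds:
  assumes "admissible \<xi> S"
  shows "0 \<le> wnorm2 \<xi> S" "norm2 \<xi> S \<le> wnorm2 \<xi> S"
    and "cmod (hat_v S) \<le> sqrt (wnorm2 \<xi> S)" "cmod (hat_u S) \<le> sqrt (wnorm2 \<xi> S)"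
    and "cmod (hat_z S) \<le> sqrt (wnorm2 \<xi> S)" "cmod (hat_y S) \<le> sqrt (wnorm2 \<xi> S)"
    and "freq \<xi> ^ 2 * cmod (hat_phi S) \<le> sqrt (wnorm2 \<xi> S)"
    and "freq \<xi> * cmod (hat_p S) \<le> sqrt (wnorm2 \<xi> S)"
    and "freq \<xi> ^ 3 / \<bar>\<xi>\<bar> * cmod (hat_theta S) \<le> sqrt (wnorm2 \<xi> S)"
proof -
  note d = cost_dissipation_nonneg[OF assms]
  show "0 \<le> wnorm2 \<xi> S" using d by (simp add: wnorm2_def)
  have \<xi>: "0 < \<bar>\<xi>\<bar>" using assms by (simp add: admissible_def)
  note b = freq_bounds[of \<xi>]
  have "1 \<le> freq \<xi> ^ 2" using b by simp
  then have 1: "(cmod (hat_phi S))\<^sup>2 \<le> (freq \<xi> ^ 2 * cmod (hat_phi S))\<^sup>2"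
    by (intro power_mono) (auto simp: mult_le_cancel_right1)
  have 2: "(cmod (hat_p S))\<^sup>2 \<le> (freq \<xi> * cmod (hat_p S))\<^sup>2"
    using b by (intro power_mono) (auto simp: mult_le_cancel_right1)
  have "\<bar>\<xi>\<bar> \<le> freq \<xi> ^ 3"
    using b power_increasing[of 1 3 "freq \<xi>"] by simp
  then have 3: "(cmod (hat_theta S))\<^sup>2 \<le> (freq \<xi> ^ 3 / \<bar>\<xi>\<bar> * cmod (hat_theta S))\<^sup>2"
    using \<xi> mult_right_mono[of 1 "freq \<xi> ^ 3 / \<bar>\<xi>\<bar>" "cmod (hat_theta S)"]
    by (intro power_mono) (auto simp: pos_le_divide_eq)
  have 4: "real \<tau>0 * \<xi>^4 * memory_energy S \<le> cost \<xi> * dissipation \<xi> S"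
  proof (cases "\<tau>0 = 0")
    case False
    then have "\<tau>0 = 1" using \<tau>0 by auto
    then show ?thesis
      using mult_right_mono[OF one_le_cost dissipation_nonneg[OF assms]] \<xi> unfolding dissipation_def by simp
  qed (use d in simp)
  show "norm2 \<xi> S \<le> wnorm2 \<xi> S"
    unfolding norm2_def wnorm2_def using 1 2 3 4 by linarith
  show "cmod (hat_v S) \<le> sqrt (wnorm2 \<xi> S)" "cmod (hat_u S) \<le> sqrt (wnorm2 \<xi> S)"
    "cmod (hat_z S) \<le> sqrt (wnorm2 \<xi> S)" "cmod (hat_y S) \<le> sqrt (wnorm2 \<xi> S)"
    "freq \<xi> ^ 2 * cmod (hat_phi S) \<le> sqrt (wnorm2 \<xi> S)"
    "freq \<xi> * cmod (hat_p S) \<le> sqrt (wnorm2 \<xi> S)"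
    "freq \<xi> ^ 3 / \<bar>\<xi>\<bar> * cmod (hat_theta S) \<le> sqrt (wnorm2 \<xi> S)"
    by (rule real_le_rsqrt, use d in \<open>simp add: wnorm2_def\<close>)+
qed

lemma norm2_bounds:
  assumes "admissible \<xi> S"
  shows "0 \<le> norm2 \<xi> S"
    and "cmod (hat_v S) \<le> sqrt (norm2 \<xi> S)" "cmod (hat_u S) \<le> sqrt (norm2 \<xi> S)"
    and "cmod (hat_z S) \<le> sqrt (norm2 \<xi> S)" "cmod (hat_y S) \<le> sqrt (norm2 \<xi> S)"
    and "cmod (hat_phi S) \<le> sqrt (norm2 \<xi> S)" "cmod (hat_theta S) \<le> sqrt (norm2 \<xi> S)"
    and "cmod (hat_p S) \<le> sqrt (norm2 \<xi> S)"
    and "\<tau>0 = 1 \<Longrightarrow> \<xi>\<^sup>2 * sqrt (memory_energy S) \<le> sqrt (norm2 \<xi> S)"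
proof -
  note m = memory_term_nonneg[of S \<xi>]
  have m: "0 \<le> real \<tau>0 * \<xi>^4 * memory_energy S"
    using assms by (intro memory_term_nonneg) (simp add: admissible_def)
  then show "0 \<le> norm2 \<xi> S" by (simp add: norm2_def)
  show "cmod (hat_v S) \<le> sqrt (norm2 \<xi> S)" "cmod (hat_u S) \<le> sqrt (norm2 \<xi> S)"
    "cmod (hat_z S) \<le> sqrt (norm2 \<xi> S)" "cmod (hat_y S) \<le> sqrt (norm2 \<xi> S)"
    "cmod (hat_phi S) \<le> sqrt (norm2 \<xi> S)" "cmod (hat_theta S) \<le> sqrt (norm2 \<xi> S)"
    "cmod (hat_p S) \<le> sqrt (norm2 \<xi> S)"
    by (rule real_le_rsqrt, use m in \<open>simp add: norm2_def\<close>)+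
  assume 1: "\<tau>0 = 1"
  then have "0 \<le> memory_energy S"
    using assms memory_bounds(1) unfolding admissible_def by blast
  then show "\<xi>\<^sup>2 * sqrt (memory_energy S) \<le> sqrt (norm2 \<xi> S)"
    unfolding norm2_def using 1 by (intro real_le_rsqrt) (simp add: power_mult_distrib flip: power_mult)
qed

section \<open>Calculus of Lyapunov correctors\<close>

definition corrector_deriv_le ::
  "(real \<Rightarrow> rn_state \<Rightarrow> real) \<Rightarrow> (real \<Rightarrow> rn_state \<Rightarrow> real) \<Rightarrow> bool" where
  "corrector_deriv_le F B \<longleftrightarrow> (\<forall>\<xi> U t. solution \<xi> U \<longrightarrow> \<xi> \<noteq> 0 \<longrightarrow> 0 \<le> t \<longrightarrow>
     (\<exists>d. ((\<lambda>t. F \<xi> (U t)) has_real_derivative d) (at t within {0..}) \<and> d \<le> B \<xi> (U t)))"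

definition cost_bounded :: "real \<Rightarrow> (real \<Rightarrow> rn_state \<Rightarrow> real) \<Rightarrow> bool" where
  "cost_bounded C F \<longleftrightarrow> (\<forall>\<xi> S. admissible \<xi> S \<longrightarrow> \<bar>F \<xi> S\<bar> \<le> C * (cost \<xi> * norm2 \<xi> S))"

text \<open>
  \<open>X\<close> is controlled if, up to an arbitrarily small part of \<open>wnorm2\<close>, its time integral along a solution
  is at most \<open>cost \<xi>\<close> times the dissipated energy: \<open>F\<close> is the corresponding Lyapunov corrector. All
  constants are uniform in \<open>\<xi> \<noteq> 0\<close> and in the solution.
\<close>

definition controlled :: "(real \<Rightarrow> rn_state \<Rightarrow> real) \<Rightarrow> bool" where
  "controlled X \<longleftrightarrow> (\<forall>\<epsilon>>0. \<exists>C\<ge>0. \<exists>F. cost_bounded C F \<and> corrector_deriv_le F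
     (\<lambda>\<xi> S. - X \<xi> S + \<epsilon> * wnorm2 \<xi> S + C * (cost \<xi> * dissipation \<xi> S)))"

lemma corrector_deriv_le_mono:
  assumes "corrector_deriv_le F A" "\<And>\<xi> S. admissible \<xi> S \<Longrightarrow> A \<xi> S \<le> B \<xi> S"
  shows "corrector_deriv_le F B"
  unfolding corrector_deriv_le_def
proof (intro allI impI)
  fix \<xi> U and t :: real assume h: "solution \<xi> U" "\<xi> \<noteq> 0" "0 \<le> t"
  then obtain d where "((\<lambda>t. F \<xi> (U t)) has_real_derivative d) (at t within {0..})" "d \<le> A \<xi> (U t)"
    using assms(1) unfolding corrector_deriv_le_def by blast
  moreover have "A \<xi> (U t) \<le> B \<xi> (U t)"
    by (rule assms(2)[OF solution_admissible[OF h]])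
  ultimately show "\<exists>d. ((\<lambda>t. F \<xi> (U t)) has_real_derivative d) (at t within {0..}) \<and> d \<le> B \<xi> (U t)"
    by (intro exI[of _ d]) simp
qed

lemma corrector_deriv_le_lincomb:
  assumes "corrector_deriv_le F A" "corrector_deriv_le G B" "0 \<le> a" "0 \<le> b"
  shows "corrector_deriv_le (\<lambda>\<xi> S. a * F \<xi> S + b * G \<xi> S) (\<lambda>\<xi> S. a * A \<xi> S + b * B \<xi> S)"
  unfolding corrector_deriv_le_def
proof (intro allI impI)
  fix \<xi> U and t :: real assume h: "solution \<xi> U" "\<xi> \<noteq> 0" "0 \<le> t"
  obtain d e where d: "((\<lambda>t. F \<xi> (U t)) has_real_derivative d) (at t within {0..})" "d \<le> A \<xi> (U t)"
    and e: "((\<lambda>t. G \<xi> (U t)) has_real_derivative e) (at t within {0..})" "e \<le> B \<xi> (U t)"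
    using assms(1,2) h unfolding corrector_deriv_le_def by blast
  have "((\<lambda>t. a * F \<xi> (U t) + b * G \<xi> (U t)) has_real_derivative a * d + b * e) (at t within {0..})"
    by (intro DERIV_add DERIV_cmult d e)
  moreover have "a * d + b * e \<le> a * A \<xi> (U t) + b * B \<xi> (U t)"
    using d e assms(3,4) by (intro add_mono mult_left_mono)
  ultimately show "\<exists>d. ((\<lambda>t. a * F \<xi> (U t) + b * G \<xi> (U t)) has_real_derivative d) (at t within {0..}) \<and>
      d \<le> a * A \<xi> (U t) + b * B \<xi> (U t)" by blast
qed

lemma cost_norm2_nonneg: "admissible \<xi> S \<Longrightarrow> 0 \<le> cost \<xi> * norm2 \<xi> S"
  using norm2_bounds(1) one_le_cost[of \<xi>] by (simp add: admissible_def)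

lemma cost_bounded_lincomb:
  assumes "cost_bounded C F" "cost_bounded C' G" "0 \<le> a" "0 \<le> b"
  shows "cost_bounded (a * C + b * C') (\<lambda>\<xi> S. a * F \<xi> S + b * G \<xi> S)"
  unfolding cost_bounded_def
proof (intro allI impI)
  fix \<xi> S assume h: "admissible \<xi> S"
  have "\<bar>a * F \<xi> S + b * G \<xi> S\<bar> \<le> a * \<bar>F \<xi> S\<bar> + b * \<bar>G \<xi> S\<bar>"
    using assms(3,4) by (metis abs_mult abs_of_nonneg abs_triangle_ineq)
  also have "\<dots> \<le> a * (C * (cost \<xi> * norm2 \<xi> S)) + b * (C' * (cost \<xi> * norm2 \<xi> S))"
    using assms h unfolding cost_bounded_def by (intro add_mono mult_left_mono) auto
  finally show "\<bar>a * F \<xi> S + b * G \<xi> S\<bar> \<le> (a * C + b * C') * (cost \<xi> * norm2 \<xi> S)"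
    by (simp add: algebra_simps)
qed

lemma controlled_mono:
  assumes "controlled Y" "0 \<le> c" "\<And>\<xi> S. admissible \<xi> S \<Longrightarrow> X \<xi> S \<le> c * Y \<xi> S"
  shows "controlled X"
  unfolding controlled_def
proof (intro allI impI)
  fix \<epsilon> :: real assume "0 < \<epsilon>"
  define \<delta> where "\<delta> = \<epsilon> / (c + 1)"
  have "0 < \<delta>" "c * \<delta> \<le> \<epsilon>" using assms(2) \<open>0 < \<epsilon>\<close> by (simp_all add: \<delta>_def field_simps)
  then obtain C F where C: "C \<ge> 0" "cost_bounded C F" "corrector_deriv_le F
     (\<lambda>\<xi> S. - Y \<xi> S + \<delta> * wnorm2 \<xi> S + C * (cost \<xi> * dissipation \<xi> S))"
    using assms(1) unfolding controlled_def by blast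
  have "cost_bounded (c * C) (\<lambda>\<xi> S. c * F \<xi> S)"
    using cost_bounded_lincomb[OF C(2) C(2) assms(2) order_refl] by simp
  moreover have "corrector_deriv_le (\<lambda>\<xi> S. c * F \<xi> S)
      (\<lambda>\<xi> S. - X \<xi> S + \<epsilon> * wnorm2 \<xi> S + (c * C) * (cost \<xi> * dissipation \<xi> S))"
  proof (rule corrector_deriv_le_mono)
    show "corrector_deriv_le (\<lambda>\<xi> S. c * F \<xi> S)
      (\<lambda>\<xi> S. c * (- Y \<xi> S + \<delta> * wnorm2 \<xi> S + C * (cost \<xi> * dissipation \<xi> S)))"
      using corrector_deriv_le_lincomb[OF C(3) C(3) assms(2) order_refl] by simp
    fix \<xi> S assume h: "admissible \<xi> S"
    have "c * \<delta> * wnorm2 \<xi> S \<le> \<epsilon> * wnorm2 \<xi> S"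
      using \<open>c * \<delta> \<le> \<epsilon>\<close> wnorm2_bounds(1)[OF h] by (rule mult_right_mono)
    then show "c * (- Y \<xi> S + \<delta> * wnorm2 \<xi> S + C * (cost \<xi> * dissipation \<xi> S))
        \<le> - X \<xi> S + \<epsilon> * wnorm2 \<xi> S + (c * C) * (cost \<xi> * dissipation \<xi> S)"
      using assms(3)[OF h] by (simp add: algebra_simps)
  qed
  moreover have "0 \<le> c * C" using assms(2) C(1) by simp
  ultimately show "\<exists>C\<ge>0. \<exists>F. cost_bounded C F \<and> corrector_deriv_le F
     (\<lambda>\<xi> S. - X \<xi> S + \<epsilon> * wnorm2 \<xi> S + C * (cost \<xi> * dissipation \<xi> S))" by blast
qed

text \<open>
  The mixed term is split by Young's inequality: its \<open>wnorm2\<close> part is absorbed in \<open>\<epsilon>\<close>, the \<open>h\<close> part is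
  controlled already.
\<close>

lemma controlled_step:
  assumes h: "controlled (\<lambda>\<xi> S. (h \<xi> S)\<^sup>2)" and "0 \<le> C1" "0 \<le> C2"
    and F: "cost_bounded C1 F"
    and deriv: "corrector_deriv_le F (\<lambda>\<xi> S. - X \<xi> S + C2 * (h \<xi> S * (h \<xi> S + sqrt (wnorm2 \<xi> S))))"
  shows "controlled X"
  unfolding controlled_def
proof (intro allI impI)
  fix \<epsilon> :: real assume "0 < \<epsilon>"
  \<comment> \<open>Coefficient of \<open>h^2\<close> after splitting: \<open>C2\<close> from the
    pure square, the rest from Young's inequality with \<open>\<epsilon> / 2\<close> left on
    \<open>wnorm2\<close>. The choice of \<delta> spends the other half of \<epsilon> on controlling
    \<open>c * h^2\<close>.\<close>
  define c where "c = C2 + C2\<^sup>2 / (2 * \<epsilon>)"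
  have "0 \<le> c" using \<open>0 \<le> C2\<close> \<open>0 < \<epsilon>\<close> by (simp add: c_def)
  define \<delta> where "\<delta> = \<epsilon> / (2 * (c + 1))"
  have "0 < \<delta>" "c * \<delta> \<le> \<epsilon> / 2"
    using \<open>0 \<le> c\<close> \<open>0 < \<epsilon>\<close> by (simp_all add: \<delta>_def field_simps)
  then obtain C G where C: "C \<ge> 0" "cost_bounded C G" "corrector_deriv_le G
     (\<lambda>\<xi> S. - (h \<xi> S)\<^sup>2 + \<delta> * wnorm2 \<xi> S + C * (cost \<xi> * dissipation \<xi> S))"
    using h unfolding controlled_def by blast
  have "cost_bounded (1 * C1 + c * C) (\<lambda>\<xi> S. 1 * F \<xi> S + c * G \<xi> S)"
    by (rule cost_bounded_lincomb) (use F C \<open>0 \<le> c\<close> in auto)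
  moreover have "corrector_deriv_le (\<lambda>\<xi> S. 1 * F \<xi> S + c * G \<xi> S)
      (\<lambda>\<xi> S. - X \<xi> S + \<epsilon> * wnorm2 \<xi> S + (1 * C1 + c * C) * (cost \<xi> * dissipation \<xi> S))"
  proof (rule corrector_deriv_le_mono[OF corrector_deriv_le_lincomb[OF deriv C(3), of 1 c]])
    fix \<xi> S assume adm: "admissible \<xi> S"
    define T where "T = sqrt (wnorm2 \<xi> S)"
    have T: "T\<^sup>2 = wnorm2 \<xi> S" using wnorm2_bounds(1)[OF adm] by (simp add: T_def)
    have "0 \<le> (C2 * h \<xi> S - \<epsilon> * T)\<^sup>2" by simp
    then have "C2 * (h \<xi> S * T) \<le> \<epsilon> / 2 * T\<^sup>2 + C2\<^sup>2 / (2 * \<epsilon>) * (h \<xi> S)\<^sup>2"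
      using \<open>0 < \<epsilon>\<close> by (simp add: power2_eq_square field_simps)
    moreover have "c * \<delta> * T\<^sup>2 \<le> \<epsilon> / 2 * T\<^sup>2"
      using \<open>c * \<delta> \<le> \<epsilon> / 2\<close> by (rule mult_right_mono) simp
    moreover have "C2 * (h \<xi> S * (h \<xi> S + T)) + C2\<^sup>2 / (2 * \<epsilon>) * (h \<xi> S)\<^sup>2 = c * (h \<xi> S)\<^sup>2 + C2 * (h \<xi> S * T)"
      by (simp add: c_def power2_eq_square algebra_simps)
    moreover have "0 \<le> C1 * (cost \<xi> * dissipation \<xi> S)"
      using cost_dissipation_nonneg[OF adm] \<open>0 \<le> C1\<close> by simp
    ultimately show "1 * (- X \<xi> S + C2 * (h \<xi> S * (h \<xi> S + sqrt (wnorm2 \<xi> S))))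
        + c * (- (h \<xi> S)\<^sup>2 + \<delta> * wnorm2 \<xi> S + C * (cost \<xi> * dissipation \<xi> S))
        \<le> - X \<xi> S + \<epsilon> * wnorm2 \<xi> S + (1 * C1 + c * C) * (cost \<xi> * dissipation \<xi> S)"
      unfolding T_def[symmetric] T[symmetric] using wnorm2_bounds(1)[OF adm]
      by (simp add: algebra_simps T_def)
  qed (use \<open>0 \<le> c\<close> in auto)
  moreover have "0 \<le> 1 * C1 + c * C" using \<open>0 \<le> C1\<close> C(1) \<open>0 \<le> c\<close> by simp
  ultimately show "\<exists>C\<ge>0. \<exists>F. cost_bounded C F \<and> corrector_deriv_le F
     (\<lambda>\<xi> S. - X \<xi> S + \<epsilon> * wnorm2 \<xi> S + C * (cost \<xi> * dissipation \<xi> S))" by blast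
qed

lemma controlled_add:
  assumes "controlled X" "controlled Y"
  shows "controlled (\<lambda>\<xi> S. X \<xi> S + Y \<xi> S)"
  unfolding controlled_def
proof (intro allI impI)
  fix \<epsilon> :: real assume "0 < \<epsilon>"
  then have "0 < \<epsilon> / 2" by simp
  then obtain C F C' G where C: "C \<ge> 0" "cost_bounded C F" "corrector_deriv_le F
       (\<lambda>\<xi> S. - X \<xi> S + \<epsilon> / 2 * wnorm2 \<xi> S + C * (cost \<xi> * dissipation \<xi> S))"
    and C': "C' \<ge> 0" "cost_bounded C' G" "corrector_deriv_le G
       (\<lambda>\<xi> S. - Y \<xi> S + \<epsilon> / 2 * wnorm2 \<xi> S + C' * (cost \<xi> * dissipation \<xi> S))"
    using assms unfolding controlled_def by meson
  have "cost_bounded (1 * C + 1 * C') (\<lambda>\<xi> S. 1 * F \<xi> S + 1 * G \<xi> S)"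
    by (rule cost_bounded_lincomb) (use C C' in auto)
  moreover have "corrector_deriv_le (\<lambda>\<xi> S. 1 * F \<xi> S + 1 * G \<xi> S)
      (\<lambda>\<xi> S. - (X \<xi> S + Y \<xi> S) + \<epsilon> * wnorm2 \<xi> S + (1 * C + 1 * C') * (cost \<xi> * dissipation \<xi> S))"
    by (rule corrector_deriv_le_mono[OF corrector_deriv_le_lincomb[OF C(3) C'(3), of 1 1]])
      (auto simp: algebra_simps)
  ultimately show "\<exists>C\<ge>0. \<exists>F. cost_bounded C F \<and> corrector_deriv_le F
     (\<lambda>\<xi> S. - (X \<xi> S + Y \<xi> S) + \<epsilon> * wnorm2 \<xi> S + C * (cost \<xi> * dissipation \<xi> S))"
    using C(1) C'(1) by (intro exI[of _ "1 * C + 1 * C'"]) auto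
qed

text \<open>The start of every chain of transfers: corrector 0 and constant 1.\<close>

lemma controlled_dissipation: "controlled (\<lambda>\<xi> S. cost \<xi> * dissipation \<xi> S)"
  unfolding controlled_def
proof (intro allI impI)
  fix \<epsilon> :: real assume "0 < \<epsilon>"
  have "cost_bounded 1 (\<lambda>\<xi> S. 0)"
    using cost_norm2_nonneg by (simp add: cost_bounded_def)
  moreover have "corrector_deriv_le (\<lambda>\<xi> S. 0)
      (\<lambda>\<xi> S. - (cost \<xi> * dissipation \<xi> S) + \<epsilon> * wnorm2 \<xi> S + 1 * (cost \<xi> * dissipation \<xi> S))"
    using solution_admissible wnorm2_bounds(1) \<open>0 < \<epsilon>\<close>
    by (auto simp: corrector_deriv_le_def intro!: exI[of _ 0])
  ultimately show "\<exists>C\<ge>0. \<exists>F. cost_bounded C F \<and> corrector_deriv_le F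
     (\<lambda>\<xi> S. - (cost \<xi> * dissipation \<xi> S) + \<epsilon> * wnorm2 \<xi> S + C * (cost \<xi> * dissipation \<xi> S))"
    by (intro exI[of _ 1]) auto
qed

text \<open>An amplitude instead of its square, so that products of a small amplitude with the
  square root of \<open>wnorm2\<close> can be expressed.\<close>

definition small :: "(real \<Rightarrow> rn_state \<Rightarrow> real) \<Rightarrow> bool" where
  "small h \<longleftrightarrow> (\<forall>\<xi> S. admissible \<xi> S \<longrightarrow> 0 \<le> h \<xi> S) \<and> controlled (\<lambda>\<xi> S. (h \<xi> S)\<^sup>2)"

lemma small_mono:
  assumes "small h" "0 \<le> c" "\<And>\<xi> S. admissible \<xi> S \<Longrightarrow> 0 \<le> f \<xi> S \<and> f \<xi> S \<le> c * h \<xi> S"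
  shows "small f"
proof -
  have "controlled (\<lambda>\<xi> S. (f \<xi> S)\<^sup>2)"
  proof (rule controlled_mono[of "\<lambda>\<xi> S. (h \<xi> S)\<^sup>2" "c\<^sup>2"])
    fix \<xi> S assume "admissible \<xi> S"
    then show "(f \<xi> S)\<^sup>2 \<le> c\<^sup>2 * (h \<xi> S)\<^sup>2"
      using assms(3) by (auto simp flip: power_mult_distrib intro: power_mono)
  qed (use assms(1) in \<open>auto simp: small_def\<close>)
  then show ?thesis using assms(3) by (simp add: small_def)
qed

lemma small_add:
  assumes "small f" "small h"
  shows "small (\<lambda>\<xi> S. f \<xi> S + h \<xi> S)"
proof -
  have "controlled (\<lambda>\<xi> S. (f \<xi> S + h \<xi> S)\<^sup>2)"
  proof (rule controlled_mono[of "\<lambda>\<xi> S. (f \<xi> S)\<^sup>2 + (h \<xi> S)\<^sup>2" 2])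
    show "(f \<xi> S + h \<xi> S)\<^sup>2 \<le> 2 * ((f \<xi> S)\<^sup>2 + (h \<xi> S)\<^sup>2)" for \<xi> S
      using sum_squares_bound[of "f \<xi> S" "h \<xi> S"] by (simp add: power2_eq_square algebra_simps)
  qed (use assms in \<open>auto simp: small_def intro: controlled_add\<close>)
  then show ?thesis using assms by (simp add: small_def)
qed

lemma small_step:
  assumes "small h" "0 \<le> C1" "0 \<le> C2" "0 < c" "cost_bounded C1 F"
    and "corrector_deriv_le F (\<lambda>\<xi> S. - (c * (f \<xi> S)\<^sup>2) + C2 * (h \<xi> S * (h \<xi> S + sqrt (wnorm2 \<xi> S))))"
    and "\<And>\<xi> S. admissible \<xi> S \<Longrightarrow> 0 \<le> f \<xi> S"
  shows "small f"
proof -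
  have "controlled (\<lambda>\<xi> S. c * (f \<xi> S)\<^sup>2)"
    using assms by (intro controlled_step[OF _ assms(2,3,5,6)]) (simp add: small_def)
  then have "controlled (\<lambda>\<xi> S. (f \<xi> S)\<^sup>2)"
    by (rule controlled_mono[of _ "1 / c"]) (use assms(4) in auto)
  then show ?thesis using assms(7) by (simp add: small_def)
qed


section \<open>Combinations of the state variables adapted to the equations\<close>

definition stiffness :: "real \<Rightarrow> real" where
  "stiffness \<xi> = k0 * (1 / k1 + 1 / k2) + \<xi>\<^sup>2"

text \<open>With these weights the elastic forces of the two waves add up to i \<xi> (v + z), which
  compatibility expresses by p and \<phi>. Hence the derivative contains neither v nor z, whatever
  the speeds are; \<open>stiffness\<close> is the resulting coefficient of p.\<close>

definition velocity_sum :: "rn_state \<Rightarrow> complex" where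
  "velocity_sum S = (\<rho>1 / k1) *\<^sub>R hat_u S + (\<rho>2 / k2) *\<^sub>R hat_y S"

text \<open>The combination of strains that drives u + y. It is a multiple of v + z exactly when the
  two speeds agree.\<close>

definition strain_sum :: "rn_state \<Rightarrow> complex" where
  "strain_sum S = (k1 / \<rho>1) *\<^sub>R hat_v S + (k2 / \<rho>2) *\<^sub>R hat_z S"

text \<open>
  Adding a multiple of \<open>\<theta>\<close> to the velocities eliminates \<open>p\<close> from their equations. A direct bound on the
  \<open>p\<close> terms loses a power of \<open>\<xi>\<close> at low frequency, where \<open>p\<close> oscillates fast.
\<close>

definition corrected_u :: "real \<Rightarrow> rn_state \<Rightarrow> complex" where
  "corrected_u \<xi> S = \<rho>1 *\<^sub>R hat_u S - (\<rho>3 / (l * \<xi>)) *\<^sub>R (\<i> * hat_theta S)"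

definition corrected_y :: "real \<Rightarrow> rn_state \<Rightarrow> complex" where
  "corrected_y \<xi> S = \<rho>2 *\<^sub>R hat_y S - (\<rho>3 / (l * \<xi>)) *\<^sub>R (\<i> * hat_theta S)"

definition corrected_sum :: "real \<Rightarrow> rn_state \<Rightarrow> complex" where
  "corrected_sum \<xi> S = (1 / \<rho>1) *\<^sub>R corrected_u \<xi> S + (1 / \<rho>2) *\<^sub>R corrected_y \<xi> S"

lemma derived_derivs:
  assumes "solution \<xi> U" "\<xi> \<noteq> 0" "0 \<le> t"
  shows "((\<lambda>t. moment \<xi> (U t)) has_vector_derivative
          (l * k0) *\<^sub>R (\<i> * (hat_u (U t) + hat_y (U t))) - (\<kappa> * \<xi>^3 + l\<^sup>2 * k0 * \<xi>) *\<^sub>R hat_theta (U t))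
          (at t within {0..})"
    and "((\<lambda>t. velocity_sum (U t)) has_vector_derivative
          - (stiffness \<xi> *\<^sub>R hat_p (U t)) - (l * \<xi>) *\<^sub>R (\<i> * hat_phi (U t))) (at t within {0..})"
    and "((\<lambda>t. strain_sum (U t)) has_vector_derivative
          \<xi> *\<^sub>R (\<i> * ((k1 / \<rho>1) *\<^sub>R hat_u (U t) + (k2 / \<rho>2) *\<^sub>R hat_y (U t)))) (at t within {0..})"
    and "((\<lambda>t. hat_v (U t) + hat_z (U t)) has_vector_derivative
          \<xi> *\<^sub>R (\<i> * (hat_u (U t) + hat_y (U t)))) (at t within {0..})"
    and "((\<lambda>t. corrected_u \<xi> (U t)) has_vector_derivative
          \<xi> *\<^sub>R (\<i> * (k1 *\<^sub>R hat_v (U t) - (\<kappa> / l) *\<^sub>R hat_phi (U t) + (1 / (l * \<xi>\<^sup>2)) *\<^sub>R damping \<xi> (U t))))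
          (at t within {0..})"
    and "((\<lambda>t. corrected_y \<xi> (U t)) has_vector_derivative
          \<xi> *\<^sub>R (\<i> * (k2 *\<^sub>R hat_z (U t) - (\<kappa> / l) *\<^sub>R hat_phi (U t) + (1 / (l * \<xi>\<^sup>2)) *\<^sub>R damping \<xi> (U t))))
          (at t within {0..})"
    and "((\<lambda>t. corrected_sum \<xi> (U t)) has_vector_derivative
          \<xi> *\<^sub>R (\<i> * (strain_sum (U t) + (1 / \<rho>1 + 1 / \<rho>2) *\<^sub>R
            ((1 / (l * \<xi>\<^sup>2)) *\<^sub>R damping \<xi> (U t) - (\<kappa> / l) *\<^sub>R hat_phi (U t))))) (at t within {0..})"
proof -
  note D = basic_derivs[OF assms(1,3)]
  note rules = has_vector_derivative_add has_vector_derivative_diff has_vector_derivative_mult_right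
    bounded_linear.has_vector_derivative[OF bounded_linear_scaleR_right]
  have C: "hat_z (U t) = \<i> * of_real \<xi> * hat_p (U t) - hat_v (U t) - of_real l * hat_phi (U t)"
    using solution_compatible[OF assms(1,3)] by (simp add: rn_compatible_def algebra_simps)
  show "((\<lambda>t. moment \<xi> (U t)) has_vector_derivative
          (l * k0) *\<^sub>R (\<i> * (hat_u (U t) + hat_y (U t))) - (\<kappa> * \<xi>^3 + l\<^sup>2 * k0 * \<xi>) *\<^sub>R hat_theta (U t))
          (at t within {0..})"
    unfolding moment_def
    by (rule has_vector_derivative_eq_rhs, (rule rules D)+)
      (simp add: scaleR_conv_of_real algebra_simps power2_eq_square power3_eq_cube)
  show "((\<lambda>t. velocity_sum (U t)) has_vector_derivative
          - (stiffness \<xi> *\<^sub>R hat_p (U t)) - (l * \<xi>) *\<^sub>R (\<i> * hat_phi (U t))) (at t within {0..})"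
    unfolding velocity_sum_def
    by (rule has_vector_derivative_eq_rhs, (rule rules D)+)
      (use pos in \<open>simp add: C scaleR_conv_of_real stiffness_def field_simps power2_eq_square\<close>)
  show "((\<lambda>t. strain_sum (U t)) has_vector_derivative
          \<xi> *\<^sub>R (\<i> * ((k1 / \<rho>1) *\<^sub>R hat_u (U t) + (k2 / \<rho>2) *\<^sub>R hat_y (U t)))) (at t within {0..})"
    unfolding strain_sum_def
    by (rule has_vector_derivative_eq_rhs, (rule rules D)+)
      (simp add: scaleR_conv_of_real algebra_simps)
  show "((\<lambda>t. hat_v (U t) + hat_z (U t)) has_vector_derivative
          \<xi> *\<^sub>R (\<i> * (hat_u (U t) + hat_y (U t)))) (at t within {0..})"
    by (rule has_vector_derivative_eq_rhs, (rule rules D)+)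
      (simp add: scaleR_conv_of_real algebra_simps)
  show u: "((\<lambda>t. corrected_u \<xi> (U t)) has_vector_derivative
          \<xi> *\<^sub>R (\<i> * (k1 *\<^sub>R hat_v (U t) - (\<kappa> / l) *\<^sub>R hat_phi (U t) + (1 / (l * \<xi>\<^sup>2)) *\<^sub>R damping \<xi> (U t))))
          (at t within {0..})"
    unfolding corrected_u_def
    by (rule has_vector_derivative_eq_rhs, (rule rules D)+)
      (use pos assms(2) in \<open>simp add: moment_def scaleR_conv_of_real field_simps power2_eq_square\<close>)
  show y: "((\<lambda>t. corrected_y \<xi> (U t)) has_vector_derivative
          \<xi> *\<^sub>R (\<i> * (k2 *\<^sub>R hat_z (U t) - (\<kappa> / l) *\<^sub>R hat_phi (U t) + (1 / (l * \<xi>\<^sup>2)) *\<^sub>R damping \<xi> (U t))))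
          (at t within {0..})"
    unfolding corrected_y_def
    by (rule has_vector_derivative_eq_rhs, (rule rules D)+)
      (use pos assms(2) in \<open>simp add: moment_def scaleR_conv_of_real field_simps power2_eq_square\<close>)
  show "((\<lambda>t. corrected_sum \<xi> (U t)) has_vector_derivative
          \<xi> *\<^sub>R (\<i> * (strain_sum (U t) + (1 / \<rho>1 + 1 / \<rho>2) *\<^sub>R
            ((1 / (l * \<xi>\<^sup>2)) *\<^sub>R damping \<xi> (U t) - (\<kappa> / l) *\<^sub>R hat_phi (U t))))) (at t within {0..})"
    unfolding corrected_sum_def
    by (rule has_vector_derivative_eq_rhs, (rule rules u y)+)
      (use pos assms(2) in \<open>simp add: strain_sum_def scaleR_conv_of_real field_simps\<close>)
qed


section \<open>Comparison of orders at low and high frequency\<close>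

definition weight :: "real \<Rightarrow> nat \<Rightarrow> nat \<Rightarrow> real" where
  "weight \<xi> i j = freq \<xi> ^ i / \<bar>\<xi>\<bar> ^ j"

lemma weight_pos: "\<xi> \<noteq> 0 \<Longrightarrow> 0 < weight \<xi> i j"
  using freq_bounds(3) by (simp add: weight_def)

lemma weight_mult: "weight \<xi> i j * weight \<xi> i' j' = weight \<xi> (i + i') (j + j')"
  by (simp add: weight_def power_add)

text \<open>\<open>weight \<xi> i j\<close> has order |\<xi>|^-j at 0 and |\<xi>|^(i - j) at
  infinity. The two hypotheses on the exponents compare these orders at the two ends.\<close>

lemma weight_mono:
  assumes "\<xi> \<noteq> 0" "j \<le> n" "i + n \<le> m + j"
  shows "weight \<xi> i j \<le> weight \<xi> m n"
proof -
  note b = freq_bounds[of \<xi>]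
  have "freq \<xi> ^ i * \<bar>\<xi>\<bar> ^ n = freq \<xi> ^ i * \<bar>\<xi>\<bar> ^ (n - j) * \<bar>\<xi>\<bar> ^ j"
    using assms by (simp flip: power_add)
  also have "\<dots> \<le> freq \<xi> ^ i * freq \<xi> ^ (n - j) * \<bar>\<xi>\<bar> ^ j"
    using b by (intro mult_right_mono mult_left_mono power_mono) auto
  also have "\<dots> \<le> freq \<xi> ^ m * \<bar>\<xi>\<bar> ^ j"
    using b assms by (intro mult_right_mono) (auto simp flip: power_add intro: power_increasing)
  finally show ?thesis
    using assms by (simp add: weight_def field_simps)
qed

text \<open>Estimates a term of a derivative: the weights available on the two factors must together
  outweigh the coefficient at 0 and at infinity. In the applications X is the small amplitude and Y
  its sum with the square root of \<open>wnorm2\<close>.\<close>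

lemma weighted_inner_le:
  fixes x y :: complex
  assumes "\<xi> \<noteq> 0" "\<bar>c\<bar> \<le> k * weight \<xi> m n"
    and "weight \<xi> i j * norm x \<le> A * X" "weight \<xi> i' j' * norm y \<le> B * Y"
    and "0 \<le> k" "n \<le> j + j'" "m + (j + j') \<le> i + i' + n"
  shows "c * (x \<bullet> y) \<le> (k * (A * B)) * (X * Y)"
proof -
  have "\<bar>c\<bar> \<le> k * (weight \<xi> i j * weight \<xi> i' j')"
    using assms(2) mult_left_mono[OF weight_mono[OF assms(1,6,7)] assms(5)] by (simp add: weight_mult)
  then have "\<bar>c * (x \<bullet> y)\<bar> \<le> k * ((A * X) * (B * Y))"
    using assms(3-5) weight_pos[OF assms(1)]
    by (intro scaled_inner_le[of c k "weight \<xi> i j" "weight \<xi> i' j'"]) (auto intro: less_imp_le)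
  then show ?thesis by (simp add: mult_ac)
qed

text \<open>The counterpart for the size of a corrector: the orders of the coefficient and of both
  factors add up, and their sum must stay below \<open>cost\<close> at both ends.\<close>

lemma cost_bounded_inner:
  assumes c: "\<And>\<xi>. \<xi> \<noteq> 0 \<Longrightarrow> \<bar>c \<xi>\<bar> \<le> k * weight \<xi> m n"
    and x: "\<And>\<xi> S. admissible \<xi> S \<Longrightarrow> norm (x \<xi> S :: complex) \<le> A * weight \<xi> i j * sqrt (norm2 \<xi> S)"
    and y: "\<And>\<xi> S. admissible \<xi> S \<Longrightarrow> norm (y \<xi> S) \<le> B * weight \<xi> i' j' * sqrt (norm2 \<xi> S)"
    and "0 \<le> k" "0 \<le> A" "0 \<le> B" "n + j + j' \<le> 4" "m + i + i' \<le> n + j + j' + 4"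
  shows "cost_bounded (k * (A * B)) (\<lambda>\<xi> S. c \<xi> * (x \<xi> S \<bullet> y \<xi> S))"
  unfolding cost_bounded_def
proof (intro allI impI)
  fix \<xi> S assume adm: "admissible \<xi> S"
  then have \<xi>: "\<xi> \<noteq> 0" by (simp add: admissible_def)
  let ?n = "sqrt (norm2 \<xi> S)"
  have "\<bar>c \<xi> * (x \<xi> S \<bullet> y \<xi> S)\<bar> \<le> \<bar>c \<xi>\<bar> * (norm (x \<xi> S) * norm (y \<xi> S))"
    unfolding abs_mult by (intro mult_left_mono Cauchy_Schwarz_ineq2) simp
  also have "\<dots> \<le> (k * weight \<xi> m n) * ((A * weight \<xi> i j * ?n) * (B * weight \<xi> i' j' * ?n))"
  proof -
    have W: "0 \<le> weight \<xi> i j" for i j using weight_pos[OF \<xi>] by (simp add: less_imp_le)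
    show ?thesis
      using c[OF \<xi>] x[OF adm] y[OF adm] assms(4-6) norm2_bounds(1)[OF adm]
      by (intro mult_mono) (auto intro!: mult_nonneg_nonneg W)
  qed
  also have "\<dots> = (k * (A * B)) * ((weight \<xi> m n * weight \<xi> i j * weight \<xi> i' j') * (?n * ?n))"
    by (simp only: ac_simps)
  also have "weight \<xi> m n * weight \<xi> i j * weight \<xi> i' j' = weight \<xi> (m + i + i') (n + j + j')"
    by (simp add: weight_mult)
  also have "?n * ?n = norm2 \<xi> S"
    using norm2_bounds(1)[OF adm] by simp
  also have "(k * (A * B)) * (weight \<xi> (m + i + i') (n + j + j') * norm2 \<xi> S) \<le> (k * (A * B)) * (cost \<xi> * norm2 \<xi> S)"
    using freq_power_quotient_le_cost[OF \<xi> assms(7,8)] norm2_bounds(1)[OF adm] assms(4-6)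
    by (intro mult_left_mono mult_right_mono) (auto simp: weight_def)
  finally show "\<bar>c \<xi> * (x \<xi> S \<bullet> y \<xi> S)\<bar> \<le> k * (A * B) * (cost \<xi> * norm2 \<xi> S)" .
qed

lemma cost_bounded_add: "cost_bounded C F \<Longrightarrow> cost_bounded C' G \<Longrightarrow> cost_bounded (C + C') (\<lambda>\<xi> S. F \<xi> S + G \<xi> S)"
  using cost_bounded_lincomb[of C F C' G 1 1] by simp

lemma corrector_deriv_leI:
  assumes "\<And>\<xi> U t. solution \<xi> U \<Longrightarrow> \<xi> \<noteq> 0 \<Longrightarrow> 0 \<le> t \<Longrightarrow> admissible \<xi> (U t) \<Longrightarrow>
      \<exists>d. ((\<lambda>t. F \<xi> (U t)) has_real_derivative d) (at t within {0..}) \<and> d \<le> B \<xi> (U t)"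
  shows "corrector_deriv_le F B"
  using assms solution_admissible unfolding corrector_deriv_le_def by blast

definition theta_size :: "real \<Rightarrow> rn_state \<Rightarrow> real" where
  "theta_size \<xi> S = weight \<xi> 3 1 * cmod (hat_theta S)"

text \<open>The weight is what the term (\<open>freq\<close>^4/\<xi>^2) damping \<bullet> \<phi> in
  the estimate of \<phi> leaves to the damping once \<phi> has taken \<open>freq\<close>^2.\<close>

definition damping_size :: "real \<Rightarrow> rn_state \<Rightarrow> real" where
  "damping_size \<xi> S = weight \<xi> 2 2 * cmod (damping \<xi> S)"

text \<open>The residue of cancelling p in the estimate of \<phi>. For large \<xi> its coefficient
  has order |\<xi>|^3, one more than \<open>theta_size\<close> can pay for, so smallness of
  \<open>theta_size\<close> does not suffice and its control is a separate premise.\<close>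

definition coupling :: "real \<Rightarrow> rn_state \<Rightarrow> real" where
  "coupling \<xi> S = (freq \<xi> ^ 4 * l * k0 * \<xi> / stiffness \<xi>) * ((\<i> * velocity_sum S) \<bullet> hat_theta S)"

lemma sizes_nonneg: "\<xi> \<noteq> 0 \<Longrightarrow> 0 \<le> theta_size \<xi> S" "\<xi> \<noteq> 0 \<Longrightarrow> 0 \<le> damping_size \<xi> S"
  using weight_pos[of \<xi>] by (simp_all add: theta_size_def damping_size_def less_imp_le)

lemma weight_bounds:
  assumes "admissible \<xi> S"
  defines "T \<equiv> sqrt (wnorm2 \<xi> S)"
  shows "0 \<le> T" "weight \<xi> 0 0 * cmod (hat_v S) \<le> T" "weight \<xi> 0 0 * cmod (hat_u S) \<le> T"
    and "weight \<xi> 0 0 * cmod (hat_z S) \<le> T" "weight \<xi> 0 0 * cmod (hat_y S) \<le> T"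
    and "weight \<xi> 2 0 * cmod (hat_phi S) \<le> T" "weight \<xi> 1 0 * cmod (hat_p S) \<le> T"
    and "weight \<xi> 1 0 * cmod (moment \<xi> S) \<le> (\<kappa> + l * k0) * T"
proof -
  show t: "0 \<le> T" "weight \<xi> 0 0 * cmod (hat_v S) \<le> T" "weight \<xi> 0 0 * cmod (hat_u S) \<le> T"
    "weight \<xi> 0 0 * cmod (hat_z S) \<le> T" "weight \<xi> 0 0 * cmod (hat_y S) \<le> T"
    "weight \<xi> 2 0 * cmod (hat_phi S) \<le> T" "weight \<xi> 1 0 * cmod (hat_p S) \<le> T"
    using wnorm2_bounds[OF assms(1)] by (simp_all add: weight_def T_def)
  note b = freq_bounds[of \<xi>]
  have "cmod (moment \<xi> S) \<le> \<kappa> * \<bar>\<xi>\<bar> * cmod (hat_phi S) + l * k0 * cmod (hat_p S)"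
    unfolding moment_def using pos \<kappa>_pos
    by (intro order_trans[OF norm_triangle_ineq]) (simp add: norm_mult abs_mult)
  then have "freq \<xi> * cmod (moment \<xi> S) \<le> freq \<xi> * (\<kappa> * \<bar>\<xi>\<bar> * cmod (hat_phi S) + l * k0 * cmod (hat_p S))"
    using b by (intro mult_left_mono) auto
  also have "\<dots> = \<kappa> * (freq \<xi> * \<bar>\<xi>\<bar> * cmod (hat_phi S)) + l * k0 * (freq \<xi> * cmod (hat_p S))"
    by (simp add: algebra_simps)
  also have "\<dots> \<le> \<kappa> * T + l * k0 * T"
  proof (intro add_mono mult_left_mono)
    have "freq \<xi> * \<bar>\<xi>\<bar> * cmod (hat_phi S) \<le> freq \<xi> * freq \<xi> * cmod (hat_phi S)"
      using b by (intro mult_right_mono mult_left_mono) auto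
    then show "freq \<xi> * \<bar>\<xi>\<bar> * cmod (hat_phi S) \<le> T"
      using t(6) by (simp add: weight_def power2_eq_square)
  qed (use t(7) pos \<kappa>_pos in \<open>auto simp: weight_def\<close>)
  finally show "weight \<xi> 1 0 * cmod (moment \<xi> S) \<le> (\<kappa> + l * k0) * T"
    by (simp add: weight_def algebra_simps)
qed

lemma norm2_moment:
  assumes "admissible \<xi> S"
  shows "cmod (moment \<xi> S) \<le> (\<kappa> + l * k0) * weight \<xi> 1 0 * sqrt (norm2 \<xi> S)"
proof -
  note b = freq_bounds[of \<xi>] and n = norm2_bounds[OF assms]
  have "cmod (moment \<xi> S) \<le> \<kappa> * (\<bar>\<xi>\<bar> * cmod (hat_phi S)) + l * k0 * (1 * cmod (hat_p S))"
    unfolding moment_def using pos \<kappa>_pos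
    by (intro order_trans[OF norm_triangle_ineq]) (simp add: norm_mult abs_mult)
  also have "\<dots> \<le> \<kappa> * (freq \<xi> * sqrt (norm2 \<xi> S)) + l * k0 * (freq \<xi> * sqrt (norm2 \<xi> S))"
    using b n pos \<kappa>_pos by (intro add_mono mult_left_mono mult_mono) auto
  finally show ?thesis by (simp add: weight_def algebra_simps)
qed

lemma norm2_velocity_sum:
  assumes "admissible \<xi> S"
  shows "cmod (\<i> * velocity_sum S) \<le> (\<rho>1 / k1 + \<rho>2 / k2) * weight \<xi> 0 0 * sqrt (norm2 \<xi> S)"
proof -
  have "cmod (velocity_sum S) \<le> \<rho>1 / k1 * cmod (hat_u S) + \<rho>2 / k2 * cmod (hat_y S)"
    unfolding velocity_sum_def using pos by (intro order_trans[OF norm_triangle_ineq]) simp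
  also have "\<dots> \<le> \<rho>1 / k1 * sqrt (norm2 \<xi> S) + \<rho>2 / k2 * sqrt (norm2 \<xi> S)"
    using norm2_bounds[OF assms] pos by (intro add_mono mult_left_mono) auto
  finally show ?thesis by (simp add: weight_def norm_mult algebra_simps)
qed

lemma inverse_stiffness_le:
  obtains c where "0 < c" "\<And>\<xi>. 0 < stiffness \<xi>" "\<And>\<xi>. 1 / stiffness \<xi> \<le> c / freq \<xi> ^ 2"
proof -
  define e where "e = k0 * (1 / k1 + 1 / k2)"
  have e: "0 < e" using pos by (simp add: e_def add_pos_pos)
  have st: "0 < stiffness \<xi>" for \<xi>
    using e by (simp add: stiffness_def e_def[symmetric] add_pos_nonneg)
  \<comment> \<open>With \<open>e\<close> the value of \<open>stiffness\<close> at 0: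
    \<open>freq\<close>^2 \<le> 2 + 2 \<xi>^2, and both summands are at most
    \<open>2 * (1 / e + 1)\<close> times the corresponding summand of e + \<xi>^2.\<close>
  define c where "c = 2 * (1 / e + 1)"
  have "freq \<xi> ^ 2 \<le> c * stiffness \<xi>" for \<xi>
  proof -
    have "freq \<xi> ^ 2 \<le> 2 + 2 * \<xi>\<^sup>2"
      using sum_squares_bound[of 1 "\<bar>\<xi>\<bar>"] by (simp add: freq_def power2_eq_square algebra_simps)
    also have "\<dots> \<le> c * stiffness \<xi>"
      using e by (simp add: c_def stiffness_def e_def[symmetric] field_simps)
    finally show ?thesis .
  qed
  then have "1 / stiffness \<xi> \<le> c / freq \<xi> ^ 2" for \<xi>
    using st[of \<xi>] freq_bounds(3)[of \<xi>] by (simp add: field_simps)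
  moreover have "0 < c" using e by (simp add: c_def add_pos_pos)
  ultimately show ?thesis
    using st that by blast
qed

subsection \<open>The plate variables\<close>

text \<open>The moment is the force in the equation of \<theta>, so pairing \<theta> with it and
  dividing by \<xi> gives a square of fixed sign. Its own derivative contains only \<theta> and u +
  y, hence every remaining product has a factor \<theta> or the damping.\<close>

lemma small_moment:
  assumes "small theta_size" "small damping_size"
  shows "small (\<lambda>\<xi> S. weight \<xi> 1 0 * cmod (moment \<xi> S))"
proof -
  define k where "k = \<rho>3 * (\<kappa> + l\<^sup>2 * k0)"
  define C where "C = 1 * (1 * (\<kappa> + l * k0)) + k * (1 * 1) + \<rho>3 * l * k0 * (1 * 2)"
  have k0: "0 \<le> k" using pos \<kappa>_pos by (simp add: k_def)
  let ?h = "\<lambda>\<xi> S. theta_size \<xi> S + damping_size \<xi> S"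
  let ?F = "\<lambda>\<xi> S. (- (freq \<xi> ^ 2 * \<rho>3 / \<xi>)) * (hat_theta S \<bullet> moment \<xi> S)"
  show ?thesis
  proof (rule small_step[of ?h "\<rho>3 * (1 * (\<kappa> + l * k0))" C 1 ?F])
    show "cost_bounded (\<rho>3 * (1 * (\<kappa> + l * k0))) ?F"
      by (rule cost_bounded_inner[where m=2 and n=1 and i=0 and j=0 and i'=1 and j'=0])
        (use pos \<kappa>_pos freq_bounds(3) norm2_moment norm2_bounds(7) in \<open>auto simp: weight_def abs_mult less_imp_le mult.commute\<close>)
    show "corrector_deriv_le ?F
       (\<lambda>\<xi> S. - (1 * (weight \<xi> 1 0 * cmod (moment \<xi> S))\<^sup>2) + C * (?h \<xi> S * (?h \<xi> S + sqrt (wnorm2 \<xi> S))))"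
    proof (rule corrector_deriv_leI)
      fix \<xi> U and t :: real assume h: "solution \<xi> U" "\<xi> \<noteq> 0" "0 \<le> t" and adm: "admissible \<xi> (U t)"
      note \<xi> = h(2)
      define S where "S = U t"
      have "((\<lambda>t. ?F \<xi> (U t)) has_real_derivative
          - (freq \<xi> ^ 2) * (moment \<xi> S \<bullet> moment \<xi> S)
          + (freq \<xi> ^ 2 / \<xi>) * (damping \<xi> S \<bullet> moment \<xi> S)
          + (freq \<xi> ^ 2 * \<rho>3 * (\<kappa> * \<xi>\<^sup>2 + l\<^sup>2 * k0)) * (hat_theta S \<bullet> hat_theta S)
          + (- (\<rho>3 * l * k0 * freq \<xi> ^ 2 / \<xi>)) * (hat_theta S \<bullet> (\<i> * (hat_u S + hat_y S))))
          (at t within {0..})" (is "(_ has_real_derivative ?d) _")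
        unfolding S_def
        by (rule DERIV_cong, (rule DERIV_cmult has_real_derivative_inner basic_derivs[OF h(1,3)] derived_derivs[OF h])+)
          (use pos \<xi> in \<open>simp add: inner_add_left inner_add_right inner_diff_left inner_diff_right
            field_simps power2_eq_square power3_eq_cube\<close>)
      moreover
      define T where "T = sqrt (wnorm2 \<xi> S)"
      define H where "H = ?h \<xi> S"
      note b = weight_bounds[OF adm, folded S_def, folded T_def]
      have H: "0 \<le> H" "weight \<xi> 3 1 * cmod (hat_theta S) \<le> 1 * H" "weight \<xi> 2 2 * cmod (damping \<xi> S) \<le> 1 * H"
        "weight \<xi> 3 1 * cmod (hat_theta S) \<le> 1 * (H + T)"
        using sizes_nonneg[OF \<xi>, of S] b(1) by (simp_all add: H_def theta_size_def damping_size_def)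
      have 1: "(freq \<xi> ^ 2 / \<xi>) * (damping \<xi> S \<bullet> moment \<xi> S) \<le> 1 * (1 * (\<kappa> + l * k0)) * (H * (H + T))"
      proof (rule weighted_inner_le[OF \<xi>, where m=2 and n=1, OF _ H(3)])
        show "weight \<xi> 1 0 * cmod (moment \<xi> S) \<le> (\<kappa> + l * k0) * (H + T)"
          by (rule order_trans[OF b(8) mult_left_mono]) (use H(1) pos \<kappa>_pos in auto)
      qed (auto simp: weight_def)
      have 2: "(freq \<xi> ^ 2 * \<rho>3 * (\<kappa> * \<xi>\<^sup>2 + l\<^sup>2 * k0)) * (hat_theta S \<bullet> hat_theta S)
          \<le> k * (1 * 1) * (H * (H + T))"
      proof (rule weighted_inner_le[OF \<xi>, where m=4 and n=0, OF _ H(2,4)])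
        have "\<xi>\<^sup>2 \<le> freq \<xi> ^ 2" "1 \<le> freq \<xi> ^ 2"
          using freq_bounds[of \<xi>] by (auto simp: abs_le_square_iff[symmetric])
        then have "\<kappa> * \<xi>\<^sup>2 + l\<^sup>2 * k0 * 1 \<le> \<kappa> * freq \<xi> ^ 2 + l\<^sup>2 * k0 * freq \<xi> ^ 2"
          using pos \<kappa>_pos by (intro add_mono mult_left_mono) auto
        then have "freq \<xi> ^ 2 * \<rho>3 * (\<kappa> * \<xi>\<^sup>2 + l\<^sup>2 * k0) \<le> freq \<xi> ^ 2 * \<rho>3 * (\<kappa> * freq \<xi> ^ 2 + l\<^sup>2 * k0 * freq \<xi> ^ 2)"
          using pos by (intro mult_left_mono) auto
        also have "\<dots> = k * weight \<xi> 4 0"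
          by (simp add: k_def weight_def algebra_simps flip: power_add)
        finally show "\<bar>freq \<xi> ^ 2 * \<rho>3 * (\<kappa> * \<xi>\<^sup>2 + l\<^sup>2 * k0)\<bar> \<le> k * weight \<xi> 4 0"
          using pos \<kappa>_pos by simp
      qed (use k0 in auto)
      have 3: "(- (\<rho>3 * l * k0 * freq \<xi> ^ 2 / \<xi>)) * (hat_theta S \<bullet> (\<i> * (hat_u S + hat_y S)))
          \<le> \<rho>3 * l * k0 * (1 * 2) * (H * (H + T))"
      proof (rule weighted_inner_le[OF \<xi>, where m=2 and n=1 and i'=0 and j'=0, OF _ H(2)])
        show "weight \<xi> 0 0 * cmod (\<i> * (hat_u S + hat_y S)) \<le> 2 * (H + T)"
          using b(3,5) H(1) norm_triangle_ineq[of "hat_u S" "hat_y S"] by (simp add: weight_def norm_mult)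
      qed (use pos in \<open>auto simp: weight_def abs_mult\<close>)
      have "freq \<xi> ^ 2 * (moment \<xi> S \<bullet> moment \<xi> S) = (weight \<xi> 1 0 * cmod (moment \<xi> S))\<^sup>2"
        by (simp add: weight_def power_mult_distrib power2_norm_eq_inner)
      then have "?d \<le> - (1 * (weight \<xi> 1 0 * cmod (moment \<xi> S))\<^sup>2) + C * (H * (H + T))"
        using 1 2 3 unfolding C_def distrib_right[of _ _ "H * (H + T)"] by linarith
      ultimately show "\<exists>d. ((\<lambda>t. ?F \<xi> (U t)) has_real_derivative d) (at t within {0..}) \<and>
          d \<le> - (1 * (weight \<xi> 1 0 * cmod (moment \<xi> (U t)))\<^sup>2)
            + C * (?h \<xi> (U t) * (?h \<xi> (U t) + sqrt (wnorm2 \<xi> (U t))))"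
        unfolding S_def H_def T_def by blast
    qed
  qed (use assms pos \<kappa>_pos k0 freq_bounds(3) in
      \<open>auto simp: C_def weight_def less_imp_le intro: small_add intro!: add_nonneg_nonneg mult_nonneg_nonneg\<close>)
qed

text \<open>Pairing \<theta> with \<phi> yields - \<kappa> |\<phi>|^2 but also a product of p and
  \<phi> with coefficient \<open>freq\<close>^4/\<xi>, while p is not yet controlled. The second
  multiplier is scaled by \<open>stiffness\<close> so that the p part of the derivative of
  \<open>velocity_sum\<close> cancels this product; the derivative of \<phi> in it produces
  \<open>coupling\<close>.\<close>

lemma small_phi:
  assumes "small theta_size" "small damping_size" "controlled coupling"
  shows "small (\<lambda>\<xi> S. weight \<xi> 2 0 * cmod (hat_phi S))"
proof -
  obtain c where c: "0 < c" "\<And>\<xi>. 0 < stiffness \<xi>" "\<And>\<xi>. 1 / stiffness \<xi> \<le> c / freq \<xi> ^ 2"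
    using inverse_stiffness_le by blast
  define C where "C = 1 * (1 * 1) + \<rho>3 * (1 * 1)"
  define C1 where "C1 = \<rho>3 * (1 * 1) + (l * k0 * c) * ((\<rho>1 / k1 + \<rho>2 / k2) * 1)"
  let ?h = "\<lambda>\<xi> S. theta_size \<xi> S + damping_size \<xi> S"
  let ?F = "\<lambda>\<xi> S. (- (\<rho>3 * freq \<xi> ^ 4 / \<xi>\<^sup>2)) * (hat_theta S \<bullet> hat_phi S)
      + (- (freq \<xi> ^ 4 * l * k0 / (\<xi> * stiffness \<xi>))) * ((\<i> * velocity_sum S) \<bullet> hat_phi S)"
  have "controlled (\<lambda>\<xi> S. \<kappa> * (weight \<xi> 2 0 * cmod (hat_phi S))\<^sup>2 - coupling \<xi> S)"
  proof (rule controlled_step[of ?h C1 C ?F])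
    show "cost_bounded C1 ?F"
      unfolding C1_def
    proof (rule cost_bounded_add)
      show "cost_bounded (\<rho>3 * (1 * 1)) (\<lambda>\<xi> S. (- (\<rho>3 * freq \<xi> ^ 4 / \<xi>\<^sup>2)) * (hat_theta S \<bullet> hat_phi S))"
        by (rule cost_bounded_inner[where m=4 and n=2 and i=0 and j=0 and i'=0 and j'=0])
          (use pos norm2_bounds(6,7) in \<open>auto simp: weight_def abs_mult\<close>)
      show "cost_bounded ((l * k0 * c) * ((\<rho>1 / k1 + \<rho>2 / k2) * 1))
        (\<lambda>\<xi> S. (- (freq \<xi> ^ 4 * l * k0 / (\<xi> * stiffness \<xi>))) * ((\<i> * velocity_sum S) \<bullet> hat_phi S))"
      proof (rule cost_bounded_inner[where m=2 and n=1 and i=0 and j=0 and i'=0 and j'=0])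
        fix \<xi> :: real assume "\<xi> \<noteq> 0"
        have "\<bar>- (freq \<xi> ^ 4 * l * k0 / (\<xi> * stiffness \<xi>))\<bar> = freq \<xi> ^ 4 * l * k0 / \<bar>\<xi>\<bar> * (1 / stiffness \<xi>)"
          using pos c(2)[of \<xi>] by (simp add: abs_mult)
        also have "\<dots> \<le> freq \<xi> ^ 4 * l * k0 / \<bar>\<xi>\<bar> * (c / freq \<xi> ^ 2)"
          using pos by (intro mult_left_mono c(3)) auto
        also have "\<dots> = l * k0 * c * weight \<xi> 2 1"
          using freq_bounds(3)[of \<xi>] by (simp add: weight_def field_simps eval_nat_numeral)
        finally show "\<bar>- (freq \<xi> ^ 4 * l * k0 / (\<xi> * stiffness \<xi>))\<bar> \<le> l * k0 * c * weight \<xi> 2 1" .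
      qed (use pos c(1) norm2_velocity_sum norm2_bounds(6) in \<open>auto simp: weight_def\<close>)
    qed
    show "corrector_deriv_le ?F (\<lambda>\<xi> S. - (\<kappa> * (weight \<xi> 2 0 * cmod (hat_phi S))\<^sup>2 - coupling \<xi> S)
        + C * (?h \<xi> S * (?h \<xi> S + sqrt (wnorm2 \<xi> S))))"
    proof (rule corrector_deriv_leI)
      fix \<xi> U and t :: real assume h: "solution \<xi> U" "\<xi> \<noteq> 0" "0 \<le> t" and adm: "admissible \<xi> (U t)"
      note \<xi> = h(2)
      define S where "S = U t"
      have i\<phi>: "\<i> * (- (stiffness \<xi> *\<^sub>R hat_p S) - (l * \<xi>) *\<^sub>R (\<i> * hat_phi S))
          = (l * \<xi>) *\<^sub>R hat_phi S - stiffness \<xi> *\<^sub>R (\<i> * hat_p S)"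
        by (simp add: complex_eq_iff)
      have iW: "((\<lambda>t. \<i> * velocity_sum (U t)) has_vector_derivative
          (l * \<xi>) *\<^sub>R hat_phi S - stiffness \<xi> *\<^sub>R (\<i> * hat_p S)) (at t within {0..})"
        using has_vector_derivative_mult_right[OF derived_derivs(2)[OF h], of \<i>] unfolding i\<phi>[unfolded S_def] S_def .
      have "((\<lambda>t. ?F \<xi> (U t)) has_real_derivative
          - (freq \<xi> ^ 4 * (\<kappa> + l\<^sup>2 * k0 / stiffness \<xi>)) * (hat_phi S \<bullet> hat_phi S)
          + (freq \<xi> ^ 4 / \<xi>\<^sup>2) * (damping \<xi> S \<bullet> hat_phi S)
          + (\<rho>3 * freq \<xi> ^ 4) * (hat_theta S \<bullet> hat_theta S) + coupling \<xi> S)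
          (at t within {0..})" (is "(_ has_real_derivative ?d) _")
        unfolding S_def
        by (rule DERIV_cong, (rule DERIV_add DERIV_cmult has_real_derivative_inner basic_derivs[OF h(1,3)] iW[unfolded S_def])+)
          (use pos \<xi> c(2)[of \<xi>] in \<open>simp add: coupling_def moment_def inner_add_left inner_add_right inner_diff_left inner_diff_right
            field_simps power2_eq_square\<close>)
      moreover
      define T where "T = sqrt (wnorm2 \<xi> S)"
      define H where "H = ?h \<xi> S"
      note b = weight_bounds[OF adm, folded S_def, folded T_def]
      have H: "0 \<le> H" "weight \<xi> 3 1 * cmod (hat_theta S) \<le> 1 * H" "weight \<xi> 2 2 * cmod (damping \<xi> S) \<le> 1 * H"
        "weight \<xi> 3 1 * cmod (hat_theta S) \<le> 1 * (H + T)" "weight \<xi> 2 0 * cmod (hat_phi S) \<le> 1 * (H + T)"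
        using sizes_nonneg[OF \<xi>, of S] b(1,6) by (simp_all add: H_def theta_size_def damping_size_def)
      have 1: "(freq \<xi> ^ 4 / \<xi>\<^sup>2) * (damping \<xi> S \<bullet> hat_phi S) \<le> 1 * (1 * 1) * (H * (H + T))"
        by (rule weighted_inner_le[OF \<xi>, where m=4 and n=2, OF _ H(3,5)]) (auto simp: weight_def)
      have 2: "(\<rho>3 * freq \<xi> ^ 4) * (hat_theta S \<bullet> hat_theta S) \<le> \<rho>3 * (1 * 1) * (H * (H + T))"
        by (rule weighted_inner_le[OF \<xi>, where m=4 and n=0, OF _ H(2,4)]) (use pos in \<open>auto simp: weight_def abs_mult\<close>)
      \<comment> \<open>The \<phi> part of the derivative of \<open>velocity_sum\<close> contributes
        a second square with the favourable sign, which is dropped.\<close>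
      have "\<kappa> * freq \<xi> ^ 4 \<le> freq \<xi> ^ 4 * (\<kappa> + l\<^sup>2 * k0 / stiffness \<xi>)"
        using pos c(2)[of \<xi>] by (simp add: distrib_left)
      then have 3: "\<kappa> * freq \<xi> ^ 4 * (hat_phi S \<bullet> hat_phi S)
          \<le> freq \<xi> ^ 4 * (\<kappa> + l\<^sup>2 * k0 / stiffness \<xi>) * (hat_phi S \<bullet> hat_phi S)"
        by (rule mult_right_mono) simp
      have 4: "\<kappa> * freq \<xi> ^ 4 * (hat_phi S \<bullet> hat_phi S) = \<kappa> * (weight \<xi> 2 0 * cmod (hat_phi S))\<^sup>2"
        by (simp add: weight_def power_mult_distrib power2_norm_eq_inner flip: power_mult)
      have "?d \<le> - (\<kappa> * (weight \<xi> 2 0 * cmod (hat_phi S))\<^sup>2 - coupling \<xi> S) + C * (H * (H + T))"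
        using add_mono[OF add_mono[OF le_imp_neg_le[OF 3[unfolded 4]] 1] 2]
        unfolding C_def distrib_right[of _ _ "H * (H + T)"] mult_minus_left by linarith
      ultimately show "\<exists>d. ((\<lambda>t. ?F \<xi> (U t)) has_real_derivative d) (at t within {0..}) \<and>
          d \<le> - (\<kappa> * (weight \<xi> 2 0 * cmod (hat_phi (U t)))\<^sup>2 - coupling \<xi> (U t))
            + C * (?h \<xi> (U t) * (?h \<xi> (U t) + sqrt (wnorm2 \<xi> (U t))))"
        unfolding S_def H_def T_def by blast
    qed
    show "controlled (\<lambda>\<xi> S. (?h \<xi> S)\<^sup>2)"
      using small_add[OF assms(1,2)] by (simp add: small_def)
  qed (use pos c(1) in \<open>auto simp: C_def C1_def\<close>)
  then have "controlled (\<lambda>\<xi> S. \<kappa> * (weight \<xi> 2 0 * cmod (hat_phi S))\<^sup>2)"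
    using controlled_add[OF _ assms(3)] by fastforce
  then have "controlled (\<lambda>\<xi> S. (weight \<xi> 2 0 * cmod (hat_phi S))\<^sup>2)"
    by (rule controlled_mono[of _ "1 / \<kappa>"]) (use \<kappa>_pos in auto)
  then show ?thesis
    using freq_bounds(3) by (auto simp: small_def weight_def less_imp_le)
qed


lemma weight_0_0: "weight \<xi> 0 0 = 1"
  by (simp add: weight_def)

text \<open>The moment combines \<xi> \<phi> and p; the second power of \<open>freq\<close> on
  \<phi> pays for the factor \<xi>.\<close>

lemma small_p:
  assumes "small (\<lambda>\<xi> S. weight \<xi> 1 0 * cmod (moment \<xi> S))" "small (\<lambda>\<xi> S. weight \<xi> 2 0 * cmod (hat_phi S))"
  shows "small (\<lambda>\<xi> S. weight \<xi> 1 0 * cmod (hat_p S))"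
proof (rule small_mono[OF small_add[OF assms], of "(1 + \<kappa>) / (l * k0)"])
  fix \<xi> S assume "admissible \<xi> S"
  note b = freq_bounds[of \<xi>]
  have "(l * k0) *\<^sub>R (\<i> * hat_p S) = moment \<xi> S - (\<kappa> * \<xi>) *\<^sub>R hat_phi S"
    by (simp add: moment_def)
  then have "l * k0 * cmod (hat_p S) = cmod (moment \<xi> S - (\<kappa> * \<xi>) *\<^sub>R hat_phi S)"
    using pos by (metis abs_of_pos mult_pos_pos norm_scaleR norm_mult norm_ii mult_1)
  also have "\<dots> \<le> cmod (moment \<xi> S) + \<kappa> * (\<bar>\<xi>\<bar> * cmod (hat_phi S))"
    using norm_triangle_ineq4[of "moment \<xi> S" "(\<kappa> * \<xi>) *\<^sub>R hat_phi S"] \<kappa>_pos by (simp add: abs_mult)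
  also have "\<dots> \<le> cmod (moment \<xi> S) + \<kappa> * (freq \<xi> * cmod (hat_phi S))"
    using b \<kappa>_pos by (intro add_left_mono mult_left_mono mult_right_mono) auto
  finally have "freq \<xi> * (l * k0 * cmod (hat_p S)) \<le> freq \<xi> * (cmod (moment \<xi> S) + \<kappa> * (freq \<xi> * cmod (hat_phi S)))"
    using b by (intro mult_left_mono) auto
  then have 1: "l * k0 * (weight \<xi> 1 0 * cmod (hat_p S))
      \<le> 1 * (weight \<xi> 1 0 * cmod (moment \<xi> S)) + \<kappa> * (weight \<xi> 2 0 * cmod (hat_phi S))"
    by (simp add: weight_def power2_eq_square algebra_simps)
  also have "\<dots> \<le> (1 + \<kappa>) * (weight \<xi> 1 0 * cmod (moment \<xi> S)) + (1 + \<kappa>) * (weight \<xi> 2 0 * cmod (hat_phi S))"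
    using b \<kappa>_pos by (intro add_mono mult_right_mono) (auto simp: weight_def)
  finally show "0 \<le> weight \<xi> 1 0 * cmod (hat_p S) \<and> weight \<xi> 1 0 * cmod (hat_p S)
      \<le> (1 + \<kappa>) / (l * k0) * (weight \<xi> 1 0 * cmod (moment \<xi> S) + weight \<xi> 2 0 * cmod (hat_phi S))"
    using pos b by (simp add: weight_def field_simps)
qed (use pos \<kappa>_pos in auto)

text \<open>By compatibility v + z = i \<xi> p - l \<phi>, and the weight on p absorbs
  \<xi>.\<close>

lemma small_v_plus_z:
  assumes "small (\<lambda>\<xi> S. weight \<xi> 1 0 * cmod (hat_p S))" "small (\<lambda>\<xi> S. weight \<xi> 2 0 * cmod (hat_phi S))"
  shows "small (\<lambda>\<xi> S. cmod (hat_v S + hat_z S))"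
proof (rule small_mono[OF small_add[OF assms], of "1 + l"])
  fix \<xi> S assume adm: "admissible \<xi> S"
  note b = freq_bounds[of \<xi>]
  have "hat_v S + hat_z S = \<i> * of_real \<xi> * hat_p S - of_real l * hat_phi S"
    using adm by (simp add: admissible_def rn_compatible_def)
  then have "cmod (hat_v S + hat_z S) \<le> \<bar>\<xi>\<bar> * cmod (hat_p S) + l * cmod (hat_phi S)"
    using norm_triangle_ineq4[of "\<i> * of_real \<xi> * hat_p S" "of_real l * hat_phi S"] pos by (simp add: norm_mult)
  also have "\<dots> \<le> (1 + l) * (weight \<xi> 1 0 * cmod (hat_p S)) + (1 + l) * (weight \<xi> 2 0 * cmod (hat_phi S))"
  proof (intro add_mono)
    have "1 * cmod (hat_phi S) \<le> weight \<xi> 2 0 * cmod (hat_phi S)"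
      using b by (intro mult_right_mono) (auto simp: weight_def)
    then show "l * cmod (hat_phi S) \<le> (1 + l) * (weight \<xi> 2 0 * cmod (hat_phi S))"
      using pos by (intro mult_mono) auto
    have "\<bar>\<xi>\<bar> * cmod (hat_p S) \<le> weight \<xi> 1 0 * cmod (hat_p S)"
      using b by (intro mult_right_mono) (auto simp: weight_def)
    also have "\<dots> \<le> (1 + l) * (weight \<xi> 1 0 * cmod (hat_p S))"
      using pos b by (simp add: weight_def distrib_right)
    finally show "\<bar>\<xi>\<bar> * cmod (hat_p S) \<le> (1 + l) * (weight \<xi> 1 0 * cmod (hat_p S))" .
  qed
  finally show "0 \<le> cmod (hat_v S + hat_z S) \<and> cmod (hat_v S + hat_z S)
      \<le> (1 + l) * (weight \<xi> 1 0 * cmod (hat_p S) + weight \<xi> 2 0 * cmod (hat_phi S))"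
    by (simp add: distrib_left)
qed (use pos in auto)

subsection \<open>The wave variables\<close>

text \<open>The correction \<theta>/\<xi> costs one order at low frequency. Together with the factor
  1/\<xi> of the multiplier this is \<xi>^-2, which \<open>cost\<close> still bounds.\<close>

lemma norm2_corrected:
  assumes "admissible \<xi> S" "0 < \<rho>" "cmod w \<le> sqrt (norm2 \<xi> S)"
  shows "cmod (\<i> * (\<rho> *\<^sub>R w - (\<rho>3 / (l * \<xi>)) *\<^sub>R (\<i> * hat_theta S)))
     \<le> (\<rho> + \<rho>3 / l) * weight \<xi> 1 1 * sqrt (norm2 \<xi> S)"
proof -
  have \<xi>: "\<xi> \<noteq> 0" using assms by (simp add: admissible_def)
  let ?n = "sqrt (norm2 \<xi> S)"
  have W: "1 \<le> weight \<xi> 1 1" "1 / \<bar>\<xi>\<bar> \<le> weight \<xi> 1 1"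
    using weight_mono[OF \<xi>, of 0 1 0 1] weight_mono[OF \<xi>, of 1 1 0 1] by (simp_all add: weight_def)
  have "cmod (\<i> * (\<rho> *\<^sub>R w - (\<rho>3 / (l * \<xi>)) *\<^sub>R (\<i> * hat_theta S)))
      \<le> \<rho> * (1 * cmod w) + \<rho>3 / l * (1 / \<bar>\<xi>\<bar> * cmod (hat_theta S))"
    using norm_triangle_ineq4[of "\<rho> *\<^sub>R w" "(\<rho>3 / (l * \<xi>)) *\<^sub>R (\<i> * hat_theta S)"] assms(2) pos
    by (simp add: norm_mult abs_mult)
  also have "\<dots> \<le> \<rho> * (weight \<xi> 1 1 * ?n) + \<rho>3 / l * (weight \<xi> 1 1 * ?n)"
    using W assms(2,3) pos norm2_bounds(7)[OF assms(1)] by (intro add_mono mult_left_mono mult_mono) auto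
  finally show ?thesis by (simp add: algebra_simps)
qed

text \<open>Stated for a pair (e, w) because it is applied to (v, u) and to (z, y). The strain
  \<open>e\<close> is small, the multiplier identity gains \<open>\<rho> |w|^2\<close>, and the
  corrected velocity brings in only \<theta>, \<phi> and the damping, all of them small.\<close>

lemma small_velocity:
  assumes "small theta_size" "small damping_size" "small (\<lambda>\<xi> S. weight \<xi> 2 0 * cmod (hat_phi S))"
    and "small (\<lambda>\<xi> S. cmod (e S))" "0 < \<rho>" "0 < k"
    and e': "\<And>\<xi> U t. solution \<xi> U \<Longrightarrow> 0 \<le> t \<Longrightarrow>
      ((\<lambda>t. e (U t)) has_vector_derivative \<xi> *\<^sub>R (\<i> * w (U t))) (at t within {0..})"
    and w': "\<And>\<xi> U t. solution \<xi> U \<Longrightarrow> \<xi> \<noteq> 0 \<Longrightarrow> 0 \<le> t \<Longrightarrow>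
      ((\<lambda>t. \<rho> *\<^sub>R w (U t) - (\<rho>3 / (l * \<xi>)) *\<^sub>R (\<i> * hat_theta (U t))) has_vector_derivative
          \<xi> *\<^sub>R (\<i> * (k *\<^sub>R e (U t) - (\<kappa> / l) *\<^sub>R hat_phi (U t) + (1 / (l * \<xi>\<^sup>2)) *\<^sub>R damping \<xi> (U t))))
          (at t within {0..})"
    and n: "\<And>\<xi> S. admissible \<xi> S \<Longrightarrow> cmod (e S) \<le> sqrt (norm2 \<xi> S)"
      "\<And>\<xi> S. admissible \<xi> S \<Longrightarrow> cmod (w S) \<le> sqrt (norm2 \<xi> S)"
      "\<And>\<xi> S. admissible \<xi> S \<Longrightarrow> cmod (e S) \<le> sqrt (wnorm2 \<xi> S)"
      "\<And>\<xi> S. admissible \<xi> S \<Longrightarrow> cmod (w S) \<le> sqrt (wnorm2 \<xi> S)"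
  shows "small (\<lambda>\<xi> S. cmod (w S))"
proof -
  define C where "C = k * (1 * 1) + \<kappa> / l * (1 * 1) + 1 / l * (1 * 1) + \<rho>3 / l * (1 * 1)"
  let ?h = "\<lambda>\<xi> S. theta_size \<xi> S + damping_size \<xi> S + weight \<xi> 2 0 * cmod (hat_phi S) + cmod (e S)"
  let ?c = "\<lambda>\<xi> S. \<rho> *\<^sub>R w S - (\<rho>3 / (l * \<xi>)) *\<^sub>R (\<i> * hat_theta S)"
  let ?F = "\<lambda>\<xi> S. (- (1 / \<xi>)) * (e S \<bullet> (\<i> * ?c \<xi> S))"
  show ?thesis
  proof (rule small_step[of ?h "1 * (1 * (\<rho> + \<rho>3 / l))" C \<rho> ?F])
    show "small ?h" by (intro small_add assms)
    show "cost_bounded (1 * (1 * (\<rho> + \<rho>3 / l))) ?F"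
      by (rule cost_bounded_inner[where m=0 and n=1 and i=0 and j=0 and i'=1 and j'=1])
        (use pos assms(5) norm2_corrected[OF _ assms(5) n(2)] n(1) in \<open>auto simp: weight_def[of _ 0]\<close>)
    show "corrector_deriv_le ?F
       (\<lambda>\<xi> S. - (\<rho> * (cmod (w S))\<^sup>2) + C * (?h \<xi> S * (?h \<xi> S + sqrt (wnorm2 \<xi> S))))"
    proof (rule corrector_deriv_leI)
      fix \<xi> U and t :: real assume h: "solution \<xi> U" "\<xi> \<noteq> 0" "0 \<le> t" and adm: "admissible \<xi> (U t)"
      note \<xi> = h(2)
      define S where "S = U t"
      have ic: "((\<lambda>t. \<i> * ?c \<xi> (U t)) has_vector_derivative
          - (\<xi> *\<^sub>R (k *\<^sub>R e S - (\<kappa> / l) *\<^sub>R hat_phi S + (1 / (l * \<xi>\<^sup>2)) *\<^sub>R damping \<xi> S))) (at t within {0..})"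
        using has_vector_derivative_mult_right[OF w'[OF h], of \<i>] unfolding i_scaleR_i S_def .
      have deriv: "((\<lambda>t. ?F \<xi> (U t)) has_real_derivative
          - \<rho> * (w S \<bullet> w S) + k * (e S \<bullet> e S) + (- (\<kappa> / l)) * (e S \<bullet> hat_phi S)
          + (1 / (l * \<xi>\<^sup>2)) * (damping \<xi> S \<bullet> e S) + (\<rho>3 / (l * \<xi>)) * ((\<i> * hat_theta S) \<bullet> w S))
          (at t within {0..})" (is "(_ has_real_derivative ?d) _")
        by (rule DERIV_cong[OF DERIV_cmult[OF has_real_derivative_inner[OF e'[OF h(1,3)] ic], of "- (1 / \<xi>)",
              unfolded multiplier_identity[OF \<xi>]]])
          (simp add: S_def inner_add_right inner_diff_right inner_commute[of "e (U t)" "damping \<xi> (U t)"]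
            inner_commute[of "w (U t)" "\<i> * hat_theta (U t)"])
      define T where "T = sqrt (wnorm2 \<xi> S)"
      define H where "H = ?h \<xi> S"
      have "0 \<le> T" "cmod (e S) \<le> T" "cmod (w S) \<le> T"
        using weight_bounds(1)[OF adm] n(3,4)[OF adm] by (simp_all add: T_def S_def)
      moreover have "0 \<le> weight \<xi> 2 0 * cmod (hat_phi S)" using weight_pos[OF \<xi>] by (simp add: less_imp_le)
      ultimately have H: "0 \<le> H" "weight \<xi> 3 1 * cmod (\<i> * hat_theta S) \<le> 1 * H" "weight \<xi> 2 2 * cmod (damping \<xi> S) \<le> 1 * H"
        "weight \<xi> 0 0 * cmod (e S) \<le> 1 * H" "weight \<xi> 2 0 * cmod (hat_phi S) \<le> 1 * (H + T)"
        "weight \<xi> 0 0 * cmod (e S) \<le> 1 * (H + T)" "weight \<xi> 0 0 * cmod (w S) \<le> 1 * (H + T)"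
        using sizes_nonneg[OF \<xi>, of S] norm_ge_zero[of "e S"]
        unfolding H_def theta_size_def damping_size_def norm_mult norm_ii mult_1 weight_0_0 by linarith+
      have 1: "k * (e S \<bullet> e S) \<le> k * (1 * 1) * (H * (H + T))"
        by (rule weighted_inner_le[OF \<xi>, where m=0 and n=0, OF _ H(4,6)]) (use assms(6) in \<open>auto simp: weight_def\<close>)
      have 2: "(- (\<kappa> / l)) * (e S \<bullet> hat_phi S) \<le> \<kappa> / l * (1 * 1) * (H * (H + T))"
        by (rule weighted_inner_le[OF \<xi>, where m=0 and n=0, OF _ H(4,5)]) (use pos \<kappa>_pos in \<open>auto simp: weight_def\<close>)
      have 3: "(1 / (l * \<xi>\<^sup>2)) * (damping \<xi> S \<bullet> e S) \<le> 1 / l * (1 * 1) * (H * (H + T))"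
        by (rule weighted_inner_le[OF \<xi>, where m=0 and n=2, OF _ H(3,6)]) (use pos in \<open>auto simp: weight_def\<close>)
      have 4: "(\<rho>3 / (l * \<xi>)) * ((\<i> * hat_theta S) \<bullet> w S) \<le> \<rho>3 / l * (1 * 1) * (H * (H + T))"
        by (rule weighted_inner_le[OF \<xi>, where m=0 and n=1, OF _ H(2,7)]) (use pos in \<open>auto simp: weight_def abs_mult\<close>)
      have "- \<rho> * (w S \<bullet> w S) \<le> - (\<rho> * (cmod (w S))\<^sup>2)" by (simp add: power2_norm_eq_inner)
      from add_mono[OF add_mono[OF add_mono[OF add_mono[OF this 1] 2] 3] 4]
      have "?d \<le> - (\<rho> * (cmod (w S))\<^sup>2) + C * (H * (H + T))"
        unfolding C_def distrib_right[of _ _ "H * (H + T)"] by linarith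
      with deriv show "\<exists>d. ((\<lambda>t. ?F \<xi> (U t)) has_real_derivative d) (at t within {0..}) \<and>
          d \<le> - (\<rho> * (cmod (w (U t)))\<^sup>2) + C * (?h \<xi> (U t) * (?h \<xi> (U t) + sqrt (wnorm2 \<xi> (U t))))"
        unfolding S_def H_def T_def by blast
    qed
  qed (use assms(5,6) pos \<kappa>_pos in \<open>auto simp: C_def intro!: add_nonneg_nonneg\<close>)
qed

lemma corrected_sum_eq:
  "corrected_sum \<xi> S = hat_u S + hat_y S - (\<rho>3 * (1 / \<rho>1 + 1 / \<rho>2) / (l * \<xi>)) *\<^sub>R (\<i> * hat_theta S)"
proof -
  have "(1 / \<rho>1) *\<^sub>R corrected_u \<xi> S + (1 / \<rho>2) *\<^sub>R corrected_y \<xi> S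
      = hat_u S + hat_y S - (1 / \<rho>1 * (\<rho>3 / (l * \<xi>)) + 1 / \<rho>2 * (\<rho>3 / (l * \<xi>))) *\<^sub>R (\<i> * hat_theta S)"
    using pos by (simp add: corrected_u_def corrected_y_def scaleR_diff_right scaleR_add_left)
  also have "1 / \<rho>1 * (\<rho>3 / (l * \<xi>)) + 1 / \<rho>2 * (\<rho>3 / (l * \<xi>)) = \<rho>3 * (1 / \<rho>1 + 1 / \<rho>2) / (l * \<xi>)"
    by (simp add: algebra_simps add_divide_distrib)
  finally show ?thesis by (simp add: corrected_sum_def)
qed

lemma norm2_corrected_sum:
  assumes "admissible \<xi> S"
  shows "cmod (corrected_sum \<xi> S) \<le> (2 + \<rho>3 * (1 / \<rho>1 + 1 / \<rho>2) / l) * weight \<xi> 1 1 * sqrt (norm2 \<xi> S)"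
proof -
  have \<xi>: "\<xi> \<noteq> 0" using assms by (simp add: admissible_def)
  let ?n = "sqrt (norm2 \<xi> S)" and ?\<sigma> = "\<rho>3 * (1 / \<rho>1 + 1 / \<rho>2) / l"
  have \<sigma>: "0 \<le> ?\<sigma>" using pos by simp
  have W: "1 \<le> weight \<xi> 1 1" "1 / \<bar>\<xi>\<bar> \<le> weight \<xi> 1 1"
    using weight_mono[OF \<xi>, of 0 1 0 1] weight_mono[OF \<xi>, of 1 1 0 1] by (simp_all add: weight_def)
  have "corrected_sum \<xi> S = (hat_u S + hat_y S) - ?\<sigma> *\<^sub>R ((1 / \<xi>) *\<^sub>R (\<i> * hat_theta S))"
    by (simp add: corrected_sum_eq)
  then have "cmod (corrected_sum \<xi> S) \<le> cmod (hat_u S + hat_y S) + cmod (?\<sigma> *\<^sub>R ((1 / \<xi>) *\<^sub>R (\<i> * hat_theta S)))"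
    by (simp only: norm_triangle_ineq4)
  also have "cmod (?\<sigma> *\<^sub>R ((1 / \<xi>) *\<^sub>R (\<i> * hat_theta S))) = ?\<sigma> * (1 / \<bar>\<xi>\<bar> * cmod (hat_theta S))"
    unfolding norm_scaleR abs_of_nonneg[OF \<sigma>] by (simp add: norm_mult)
  also have "cmod (hat_u S + hat_y S) + ?\<sigma> * (1 / \<bar>\<xi>\<bar> * cmod (hat_theta S))
      \<le> 1 * (?n + ?n) + ?\<sigma> * (weight \<xi> 1 1 * ?n)"
  proof (intro add_mono mult_left_mono mult_mono)
    show "cmod (hat_u S + hat_y S) \<le> 1 * (?n + ?n)"
      using norm_triangle_ineq[of "hat_u S" "hat_y S"] norm2_bounds(3,5)[OF assms] by simp
  qed (use W \<sigma> norm2_bounds(1,7)[OF assms] in auto)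
  also have "\<dots> \<le> weight \<xi> 1 1 * (?n + ?n) + ?\<sigma> * (weight \<xi> 1 1 * ?n)"
    using W norm2_bounds(1)[OF assms] by (intro add_mono mult_right_mono) auto
  finally show ?thesis by (simp add: algebra_simps)
qed

text \<open>The quotient of the derivative of \<open>corrected_sum\<close> by \<open>\<i> * \<xi>\<close>.\<close>

definition corrected_strain :: "real \<Rightarrow> rn_state \<Rightarrow> complex" where
  "corrected_strain \<xi> S = strain_sum S + (1 / \<rho>1 + 1 / \<rho>2) *\<^sub>R
            ((1 / (l * \<xi>\<^sup>2)) *\<^sub>R damping \<xi> S - (\<kappa> / l) *\<^sub>R hat_phi S)"

text \<open>The excess over \<open>strain_sum\<close> consists of the damping and \<phi>, which are
  small. For \<open>strain_sum\<close> itself a bound by \<open>wnorm2\<close> is enough when the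
  other factor is small.\<close>

lemma corrected_strain_le:
  assumes "admissible \<xi> S"
  shows "cmod (corrected_strain \<xi> S - strain_sum S) \<le> (1 / \<rho>1 + 1 / \<rho>2) * ((1 + \<kappa>) / l) * (damping_size \<xi> S + weight \<xi> 2 0 * cmod (hat_phi S))"
    and "cmod (strain_sum S) \<le> (k1 / \<rho>1 + k2 / \<rho>2) * sqrt (wnorm2 \<xi> S)"
proof -
  have \<xi>: "\<xi> \<noteq> 0" using assms by (simp add: admissible_def)
  let ?b = "1 / \<rho>1 + 1 / \<rho>2"
  have W: "1 / \<xi>\<^sup>2 \<le> weight \<xi> 2 2" "1 \<le> weight \<xi> 2 0"
    using weight_mono[OF \<xi>, of 2 2 0 2] weight_mono[OF \<xi>, of 0 0 0 2] by (simp_all add: weight_def)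
  have "cmod (corrected_strain \<xi> S - strain_sum S) = ?b * cmod ((1 / (l * \<xi>\<^sup>2)) *\<^sub>R damping \<xi> S - (\<kappa> / l) *\<^sub>R hat_phi S)"
    using pos by (simp add: corrected_strain_def abs_of_pos add_pos_pos)
  also have "\<dots> \<le> ?b * (1 / l * (1 / \<xi>\<^sup>2 * cmod (damping \<xi> S)) + \<kappa> / l * (1 * cmod (hat_phi S)))"
    using norm_triangle_ineq4[of "(1 / (l * \<xi>\<^sup>2)) *\<^sub>R damping \<xi> S" "(\<kappa> / l) *\<^sub>R hat_phi S"] pos \<kappa>_pos
    by (intro mult_left_mono) auto
  also have "\<dots> \<le> ?b * ((1 + \<kappa>) / l * (weight \<xi> 2 2 * cmod (damping \<xi> S)) + (1 + \<kappa>) / l * (weight \<xi> 2 0 * cmod (hat_phi S)))"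
    using W weight_pos[OF \<xi>] pos \<kappa>_pos
    by (intro mult_left_mono[of _ _ ?b] add_mono mult_mono) (auto simp: divide_right_mono less_imp_le)
  finally show "cmod (corrected_strain \<xi> S - strain_sum S) \<le> ?b * ((1 + \<kappa>) / l) * (damping_size \<xi> S + weight \<xi> 2 0 * cmod (hat_phi S))"
    by (simp only: damping_size_def distrib_left mult.assoc)
  have "cmod (strain_sum S) \<le> k1 / \<rho>1 * cmod (hat_v S) + k2 / \<rho>2 * cmod (hat_z S)"
    unfolding strain_sum_def using pos by (intro order_trans[OF norm_triangle_ineq]) simp
  also have "\<dots> \<le> k1 / \<rho>1 * sqrt (wnorm2 \<xi> S) + k2 / \<rho>2 * sqrt (wnorm2 \<xi> S)"
    using wnorm2_bounds(3,5)[OF assms] pos by (intro add_mono mult_left_mono) auto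
  finally show "cmod (strain_sum S) \<le> (k1 / \<rho>1 + k2 / \<rho>2) * sqrt (wnorm2 \<xi> S)"
    by (simp add: distrib_right)
qed

text \<open>The multiplier identity with e = v + z and c = \<open>corrected_sum\<close>, whose
  leading part is w = u + y. The strain opposite to v + z needs only to be bounded, because v + z is
  small.\<close>

lemma small_u_plus_y:
  assumes "small theta_size" "small damping_size" "small (\<lambda>\<xi> S. weight \<xi> 2 0 * cmod (hat_phi S))"
    and "small (\<lambda>\<xi> S. cmod (hat_v S + hat_z S))"
  shows "small (\<lambda>\<xi> S. cmod (hat_u S + hat_y S))"
proof -
  define b' where "b' = 1 / \<rho>1 + 1 / \<rho>2"
  define cE where "cE = b' * ((1 + \<kappa>) / l) + (k1 / \<rho>1 + k2 / \<rho>2)"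
  define \<sigma> where "\<sigma> = \<rho>3 * b' / l"
  define C where "C = 1 * (1 * cE) + \<sigma> * (1 * 2)"
  have pos': "0 < b'" "0 \<le> \<sigma>" "0 \<le> cE"
    using pos \<kappa>_pos by (simp_all add: b'_def \<sigma>_def cE_def add_pos_pos)
  let ?h = "\<lambda>\<xi> S. theta_size \<xi> S + damping_size \<xi> S + weight \<xi> 2 0 * cmod (hat_phi S) + cmod (hat_v S + hat_z S)"
  let ?F = "\<lambda>\<xi> S. (- (1 / \<xi>)) * ((hat_v S + hat_z S) \<bullet> (\<i> * corrected_sum \<xi> S))"
  show ?thesis
  proof (rule small_step[of ?h "1 * (2 * (2 + \<rho>3 * (1 / \<rho>1 + 1 / \<rho>2) / l))" C 1 ?F])
    show "small ?h" by (intro small_add assms)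
    have "cmod (hat_v S + hat_z S) \<le> 2 * sqrt (norm2 \<xi> S)" if "admissible \<xi> S" for \<xi> S
      using norm_triangle_ineq[of "hat_v S" "hat_z S"] norm2_bounds(2,4)[OF that] by simp
    then show "cost_bounded (1 * (2 * (2 + \<rho>3 * (1 / \<rho>1 + 1 / \<rho>2) / l))) ?F"
      by (intro cost_bounded_inner[where m=0 and n=1 and i=0 and j=0 and i'=1 and j'=1])
        (use pos norm2_corrected_sum in \<open>auto simp: weight_def[of _ 0] norm_mult\<close>)
    show "corrector_deriv_le ?F
       (\<lambda>\<xi> S. - (1 * (cmod (hat_u S + hat_y S))\<^sup>2) + C * (?h \<xi> S * (?h \<xi> S + sqrt (wnorm2 \<xi> S))))"
    proof (rule corrector_deriv_leI)
      fix \<xi> U and t :: real assume h: "solution \<xi> U" "\<xi> \<noteq> 0" "0 \<le> t" and adm: "admissible \<xi> (U t)"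
      note \<xi> = h(2)
      define S where "S = U t"
      have ic: "((\<lambda>t. \<i> * corrected_sum \<xi> (U t)) has_vector_derivative - (\<xi> *\<^sub>R corrected_strain \<xi> S)) (at t within {0..})"
        using has_vector_derivative_mult_right[OF derived_derivs(7)[OF h, folded corrected_strain_def], of \<i>]
        unfolding i_scaleR_i S_def .
      have deriv: "((\<lambda>t. ?F \<xi> (U t)) has_real_derivative
          - ((hat_u S + hat_y S) \<bullet> (hat_u S + hat_y S)) + 1 * ((hat_v S + hat_z S) \<bullet> corrected_strain \<xi> S)
          + (\<sigma> / \<xi>) * ((\<i> * hat_theta S) \<bullet> (hat_u S + hat_y S)))
          (at t within {0..})" (is "(_ has_real_derivative ?d) _")
        by (rule DERIV_cong[OF DERIV_cmult[OF has_real_derivative_inner[OF derived_derivs(4)[OF h] ic], of "- (1 / \<xi>)",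
              unfolded multiplier_identity[OF \<xi>]]])
          (simp add: S_def corrected_sum_eq inner_diff_right inner_commute[of "hat_u (U t) + hat_y (U t)" "\<i> * hat_theta (U t)"] \<sigma>_def b'_def)
      define T where "T = sqrt (wnorm2 \<xi> S)"
      define H where "H = ?h \<xi> S"
      note b = weight_bounds[OF adm, folded S_def, folded T_def]
      have \<phi>0: "0 \<le> weight \<xi> 2 0 * cmod (hat_phi S)" using weight_pos[OF \<xi>] by (simp add: less_imp_le)
      have H: "0 \<le> H" "weight \<xi> 3 1 * cmod (\<i> * hat_theta S) \<le> 1 * H" "weight \<xi> 0 0 * cmod (hat_v S + hat_z S) \<le> 1 * H"
        using sizes_nonneg[OF \<xi>, of S] \<phi>0 by (simp_all add: H_def theta_size_def damping_size_def norm_mult weight_def[of _ 0])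
      have "cmod (corrected_strain \<xi> S) \<le> cmod (corrected_strain \<xi> S - strain_sum S) + cmod (strain_sum S)"
        using norm_triangle_ineq[of "corrected_strain \<xi> S - strain_sum S" "strain_sum S"] by simp
      also have "\<dots> \<le> b' * ((1 + \<kappa>) / l) * (H + T) + (k1 / \<rho>1 + k2 / \<rho>2) * (H + T)"
      proof (intro add_mono)
        show "cmod (corrected_strain \<xi> S - strain_sum S) \<le> b' * ((1 + \<kappa>) / l) * (H + T)"
          by (rule order_trans[OF corrected_strain_le(1)[OF adm, folded S_def b'_def] mult_left_mono])
            (use sizes_nonneg[OF \<xi>, of S] b(1) pos pos' \<kappa>_pos in \<open>auto simp: H_def intro!: add_nonneg_nonneg\<close>)
        show "cmod (strain_sum S) \<le> (k1 / \<rho>1 + k2 / \<rho>2) * (H + T)"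
          by (rule order_trans[OF corrected_strain_le(2)[OF adm, folded S_def, folded T_def] mult_left_mono])
            (use H(1) pos in auto)
      qed
      finally have E: "weight \<xi> 0 0 * cmod (corrected_strain \<xi> S) \<le> cE * (H + T)"
        by (simp add: weight_def cE_def distrib_right)
      have 1: "1 * ((hat_v S + hat_z S) \<bullet> corrected_strain \<xi> S) \<le> 1 * (1 * cE) * (H * (H + T))"
        by (rule weighted_inner_le[OF \<xi>, where m=0 and n=0, OF _ H(3) E]) (auto simp: weight_def)
      have 2: "(\<sigma> / \<xi>) * ((\<i> * hat_theta S) \<bullet> (hat_u S + hat_y S)) \<le> \<sigma> * (1 * 2) * (H * (H + T))"
      proof (rule weighted_inner_le[OF \<xi>, where m=0 and n=1 and i'=0 and j'=0, OF _ H(2)])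
        show "weight \<xi> 0 0 * cmod (hat_u S + hat_y S) \<le> 2 * (H + T)"
          using b(3,5) H(1) norm_triangle_ineq[of "hat_u S" "hat_y S"] by (simp add: weight_def)
      qed (use pos' in \<open>auto simp: weight_def\<close>)
      have "- ((hat_u S + hat_y S) \<bullet> (hat_u S + hat_y S)) \<le> - (1 * (cmod (hat_u S + hat_y S))\<^sup>2)"
        by (simp add: power2_norm_eq_inner)
      from add_mono[OF add_mono[OF this 1] 2]
      have "?d \<le> - (1 * (cmod (hat_u S + hat_y S))\<^sup>2) + C * (H * (H + T))"
        unfolding C_def distrib_right[of _ _ "H * (H + T)"] by linarith
      with deriv show "\<exists>d. ((\<lambda>t. ?F \<xi> (U t)) has_real_derivative d) (at t within {0..}) \<and>
          d \<le> - (1 * (cmod (hat_u (U t) + hat_y (U t)))\<^sup>2) + C * (?h \<xi> (U t) * (?h \<xi> (U t) + sqrt (wnorm2 \<xi> (U t))))"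
        unfolding S_def H_def T_def by blast
    qed
  qed (use pos pos' in \<open>auto simp: C_def\<close>)
qed


text \<open>The multiplier identity read in the other direction: now e =
  \<open>corrected_sum\<close> is small, being u + y up to a \<theta> term, and the gained square is
  that of the strain that drives it.\<close>

lemma small_strain_sum:
  assumes "small theta_size" "small damping_size" "small (\<lambda>\<xi> S. weight \<xi> 2 0 * cmod (hat_phi S))"
    and "small (\<lambda>\<xi> S. cmod (hat_u S + hat_y S))"
  shows "small (\<lambda>\<xi> S. cmod (strain_sum S))"
proof -
  define b' where "b' = 1 / \<rho>1 + 1 / \<rho>2"
  define c where "c = k1 / \<rho>1 + k2 / \<rho>2"
  define cE where "cE = b' * ((1 + \<kappa>) / l)"
  define \<sigma> where "\<sigma> = \<rho>3 * b' / l"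
  define C where "C = 1 * (cE * c) + 1 * (1 * c) + \<sigma> * (1 * c)"
  have pos': "0 < b'" "0 \<le> \<sigma>" "0 \<le> cE" "0 \<le> c"
    using pos \<kappa>_pos by (simp_all add: b'_def \<sigma>_def cE_def c_def add_pos_pos)
  let ?h = "\<lambda>\<xi> S. theta_size \<xi> S + damping_size \<xi> S + weight \<xi> 2 0 * cmod (hat_phi S) + cmod (hat_u S + hat_y S)"
  let ?F = "\<lambda>\<xi> S. (- (1 / \<xi>)) * (corrected_sum \<xi> S \<bullet> (\<i> * strain_sum S))"
  let ?P = "\<lambda>S. (k1 / \<rho>1) *\<^sub>R hat_u S + (k2 / \<rho>2) *\<^sub>R hat_y S"
  show ?thesis
  proof (rule small_step[of ?h "1 * ((2 + \<rho>3 * (1 / \<rho>1 + 1 / \<rho>2) / l) * c)" C 1 ?F])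
    show "small ?h" by (intro small_add assms)
    have "cmod (\<i> * strain_sum S) \<le> c * weight \<xi> 0 0 * sqrt (norm2 \<xi> S)" if "admissible \<xi> S" for \<xi> S
    proof -
      have "cmod (strain_sum S) \<le> k1 / \<rho>1 * cmod (hat_v S) + k2 / \<rho>2 * cmod (hat_z S)"
        unfolding strain_sum_def using pos by (intro order_trans[OF norm_triangle_ineq]) simp
      also have "\<dots> \<le> k1 / \<rho>1 * sqrt (norm2 \<xi> S) + k2 / \<rho>2 * sqrt (norm2 \<xi> S)"
        using norm2_bounds(2,4)[OF that] pos by (intro add_mono mult_left_mono) auto
      finally show ?thesis by (simp add: c_def norm_mult weight_0_0 distrib_right)
    qed
    then show "cost_bounded (1 * ((2 + \<rho>3 * (1 / \<rho>1 + 1 / \<rho>2) / l) * c)) ?F"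
      by (intro cost_bounded_inner[where m=0 and n=1 and i=1 and j=1 and i'=0 and j'=0])
        (use pos pos' norm2_corrected_sum in \<open>auto simp: weight_def[of _ 0]\<close>)
    show "corrector_deriv_le ?F
       (\<lambda>\<xi> S. - (1 * (cmod (strain_sum S))\<^sup>2) + C * (?h \<xi> S * (?h \<xi> S + sqrt (wnorm2 \<xi> S))))"
    proof (rule corrector_deriv_leI)
      fix \<xi> U and t :: real assume h: "solution \<xi> U" "\<xi> \<noteq> 0" "0 \<le> t" and adm: "admissible \<xi> (U t)"
      note \<xi> = h(2)
      define S where "S = U t"
      define \<Delta> where "\<Delta> = corrected_strain \<xi> S - strain_sum S"
      have im: "((\<lambda>t. \<i> * strain_sum (U t)) has_vector_derivative - (\<xi> *\<^sub>R ?P S)) (at t within {0..})"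
        using has_vector_derivative_mult_right[OF derived_derivs(3)[OF h], of \<i>]
        unfolding i_scaleR_i S_def .
      have deriv: "((\<lambda>t. ?F \<xi> (U t)) has_real_derivative
          - (strain_sum S \<bullet> strain_sum S) + (- 1) * (\<Delta> \<bullet> strain_sum S) + 1 * ((hat_u S + hat_y S) \<bullet> ?P S)
          + (- (\<sigma> / \<xi>)) * ((\<i> * hat_theta S) \<bullet> ?P S))
          (at t within {0..})" (is "(_ has_real_derivative ?d) _")
      proof (rule DERIV_cong[OF DERIV_cmult[OF has_real_derivative_inner[OF
              derived_derivs(7)[OF h, folded corrected_strain_def] im], of "- (1 / \<xi>)", unfolded multiplier_identity[OF \<xi>]]])
        have "corrected_sum \<xi> (U t) \<bullet> ?P S = (hat_u S + hat_y S) \<bullet> ?P S - (\<sigma> / \<xi>) * ((\<i> * hat_theta S) \<bullet> ?P S)"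
          by (simp add: S_def corrected_sum_eq inner_diff_left \<sigma>_def b'_def)
        then show "corrected_sum \<xi> (U t) \<bullet> ?P S - corrected_strain \<xi> (U t) \<bullet> strain_sum (U t) = ?d"
          by (simp add: S_def \<Delta>_def inner_diff_left)
      qed
      define T where "T = sqrt (wnorm2 \<xi> S)"
      define H where "H = ?h \<xi> S"
      note b = weight_bounds[OF adm, folded S_def, folded T_def]
      have \<phi>0: "0 \<le> weight \<xi> 2 0 * cmod (hat_phi S)" using weight_pos[OF \<xi>] by (simp add: less_imp_le)
      have H: "0 \<le> H" "weight \<xi> 3 1 * cmod (\<i> * hat_theta S) \<le> 1 * H" "weight \<xi> 0 0 * cmod (hat_u S + hat_y S) \<le> 1 * H"
        using sizes_nonneg[OF \<xi>, of S] \<phi>0 by (simp_all add: H_def theta_size_def damping_size_def norm_mult weight_def[of _ 0])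
      have D: "weight \<xi> 0 0 * cmod \<Delta> \<le> cE * H"
        unfolding weight_0_0 mult_1 \<Delta>_def
        by (rule order_trans[OF corrected_strain_le(1)[OF adm, folded S_def, folded b'_def, folded cE_def] mult_left_mono])
          (use sizes_nonneg[OF \<xi>, of S] pos' in \<open>auto simp: H_def intro!: add_nonneg_nonneg\<close>)
      have m: "weight \<xi> 0 0 * cmod (strain_sum S) \<le> c * (H + T)"
        unfolding weight_0_0 mult_1
        by (rule order_trans[OF corrected_strain_le(2)[OF adm, folded S_def c_def, folded T_def] mult_left_mono])
          (use H(1) pos' in auto)
      have P: "weight \<xi> 0 0 * cmod (?P S) \<le> c * (H + T)"
      proof -
        have "cmod (?P S) \<le> k1 / \<rho>1 * cmod (hat_u S) + k2 / \<rho>2 * cmod (hat_y S)"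
          using pos by (intro order_trans[OF norm_triangle_ineq]) simp
        also have "\<dots> \<le> k1 / \<rho>1 * (H + T) + k2 / \<rho>2 * (H + T)"
          using b(3,5) H(1) pos by (intro add_mono mult_left_mono) (auto simp: weight_0_0)
        finally show ?thesis by (simp add: c_def weight_0_0 distrib_right)
      qed
      have 1: "(- 1) * (\<Delta> \<bullet> strain_sum S) \<le> 1 * (cE * c) * (H * (H + T))"
        by (rule weighted_inner_le[OF \<xi>, where m=0 and n=0, OF _ D m]) (auto simp: weight_def)
      have 2: "1 * ((hat_u S + hat_y S) \<bullet> ?P S) \<le> 1 * (1 * c) * (H * (H + T))"
        by (rule weighted_inner_le[OF \<xi>, where m=0 and n=0, OF _ H(3) P]) (auto simp: weight_def)
      have 3: "(- (\<sigma> / \<xi>)) * ((\<i> * hat_theta S) \<bullet> ?P S) \<le> \<sigma> * (1 * c) * (H * (H + T))"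
        by (rule weighted_inner_le[OF \<xi>, where m=0 and n=1, OF _ H(2) P]) (use pos' in \<open>auto simp: weight_def\<close>)
      have "- (strain_sum S \<bullet> strain_sum S) \<le> - (1 * (cmod (strain_sum S))\<^sup>2)"
        by (simp add: power2_norm_eq_inner)
      from add_mono[OF add_mono[OF add_mono[OF this 1] 2] 3]
      have "?d \<le> - (1 * (cmod (strain_sum S))\<^sup>2) + C * (H * (H + T))"
        unfolding C_def distrib_right[of _ _ "H * (H + T)"] by linarith
      with deriv show "\<exists>d. ((\<lambda>t. ?F \<xi> (U t)) has_real_derivative d) (at t within {0..}) \<and>
          d \<le> - (1 * (cmod (strain_sum (U t)))\<^sup>2) + C * (?h \<xi> (U t) * (?h \<xi> (U t) + sqrt (wnorm2 \<xi> (U t))))"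
        unfolding S_def H_def T_def by blast
    qed
  qed (use pos pos' in \<open>auto simp: C_def\<close>)
qed

text \<open>Two linear equations for v and z whose determinant is, up to sign, the difference of
  k1/\<rho>1 and k2/\<rho>2. This is where unequal speeds enter.\<close>

lemma small_v_z:
  assumes "k1 / \<rho>1 \<noteq> k2 / \<rho>2"
    and "small (\<lambda>\<xi> S. cmod (strain_sum S))" "small (\<lambda>\<xi> S. cmod (hat_v S + hat_z S))"
  shows "small (\<lambda>\<xi> S. cmod (hat_v S))" "small (\<lambda>\<xi> S. cmod (hat_z S))"
proof -
  define a1 a2 where "a1 = k1 / \<rho>1" and "a2 = k2 / \<rho>2"
  \<comment> \<open>The coefficients in the solved equations are 1 and at most
    \<open>a1 + a2\<close>; the denominator is the determinant.\<close>
  define c where "c = (1 + a1 + a2) / \<bar>a1 - a2\<bar>"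
  have a: "0 < a1" "0 < a2" "a1 \<noteq> a2"
    using pos assms(1) by (simp_all add: a1_def a2_def)
  have le: "cmod x \<le> c * (cmod (strain_sum S) + cmod (hat_v S + hat_z S))"
    if "(a1 - a2) *\<^sub>R x = s *\<^sub>R (strain_sum S - e *\<^sub>R (hat_v S + hat_z S))" "\<bar>s\<bar> = 1" "0 \<le> e" "e \<le> a1 + a2" for x S s e
  proof -
    have "\<bar>a1 - a2\<bar> * cmod x = cmod (strain_sum S - e *\<^sub>R (hat_v S + hat_z S))"
      using arg_cong[OF that(1), of cmod] that(2) by simp
    also have "\<dots> \<le> 1 * cmod (strain_sum S) + e * cmod (hat_v S + hat_z S)"
      using norm_triangle_ineq4[of "strain_sum S" "e *\<^sub>R (hat_v S + hat_z S)"] that(3) by simp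
    also have "\<dots> \<le> (1 + a1 + a2) * cmod (strain_sum S) + (1 + a1 + a2) * cmod (hat_v S + hat_z S)"
      using a that(4) by (intro add_mono mult_right_mono) auto
    finally show ?thesis
      using a(3) by (simp add: c_def field_simps)
  qed
  have "0 \<le> c" using a by (simp add: c_def)
  note mono = small_mono[OF small_add[OF assms(2,3)] this]
  have "(a1 - a2) *\<^sub>R hat_v S = 1 *\<^sub>R (strain_sum S - a2 *\<^sub>R (hat_v S + hat_z S))" for S
    by (simp add: strain_sum_def a1_def a2_def algebra_simps)
  from le[OF this] show "small (\<lambda>\<xi> S. cmod (hat_v S))"
    using a by (intro mono) auto
  have "(a1 - a2) *\<^sub>R hat_z S = (- 1) *\<^sub>R (strain_sum S - a1 *\<^sub>R (hat_v S + hat_z S))" for S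
    by (simp add: strain_sum_def a1_def a2_def algebra_simps)
  from le[OF this] show "small (\<lambda>\<xi> S. cmod (hat_z S))"
    using a by (intro mono) auto
qed

lemma controlled_wnorm2:
  assumes "k1 / \<rho>1 \<noteq> k2 / \<rho>2" "small theta_size" "small damping_size" "controlled coupling"
  shows "controlled wnorm2"
proof -
  note \<phi> = small_phi[OF assms(2-4)]
  note p = small_p[OF small_moment[OF assms(2,3)] \<phi>]
  note vz = small_v_plus_z[OF p \<phi>]
  note uy = small_u_plus_y[OF assms(2,3) \<phi> vz]
  note vz' = small_v_z[OF assms(1) small_strain_sum[OF assms(2,3) \<phi> uy] vz]
  have u: "small (\<lambda>\<xi> S. cmod (hat_u S))"
    by (rule small_velocity[OF assms(2,3) \<phi> vz'(1) pos(1) pos(5) basic_derivs(1) derived_derivs(5)[unfolded corrected_u_def]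
          norm2_bounds(2,3) wnorm2_bounds(3,4)])
  have y: "small (\<lambda>\<xi> S. cmod (hat_y S))"
    by (rule small_velocity[OF assms(2,3) \<phi> vz'(2) pos(2) pos(6) basic_derivs(3) derived_derivs(6)[unfolded corrected_y_def]
          norm2_bounds(4,5) wnorm2_bounds(5,6)])
  have sq: "controlled (\<lambda>\<xi> S. (h \<xi> S)\<^sup>2)" if "small h" for h
    using that by (simp add: small_def)
  have "controlled (\<lambda>\<xi> S. (cmod (hat_v S))\<^sup>2 + (cmod (hat_u S))\<^sup>2 + (cmod (hat_z S))\<^sup>2 + (cmod (hat_y S))\<^sup>2
     + (weight \<xi> 2 0 * cmod (hat_phi S))\<^sup>2 + (weight \<xi> 1 0 * cmod (hat_p S))\<^sup>2
     + (theta_size \<xi> S)\<^sup>2 + cost \<xi> * dissipation \<xi> S)"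
    by (intro controlled_add sq u y vz' \<phi> p assms(2) controlled_dissipation)
  then show ?thesis
    by (rule controlled_mono[of _ 1]) (simp_all add: wnorm2_def theta_size_def weight_def)
qed

subsection \<open>Control of the transverse velocity by the dissipation\<close>

text \<open>Division by \<open>stiffness\<close> gains two of the five powers at high
  frequency.\<close>

lemma coupling_coefficient_le:
  assumes "0 < c" "\<And>\<xi>. 0 < stiffness \<xi>" "\<And>\<xi>. 1 / stiffness \<xi> \<le> c / freq \<xi> ^ 2"
  shows "\<bar>freq \<xi> ^ 4 * l * k0 * \<xi> / stiffness \<xi>\<bar> \<le> l * k0 * c * weight \<xi> 3 0"
proof -
  note b = freq_bounds[of \<xi>]
  have "\<bar>freq \<xi> ^ 4 * l * k0 * \<xi> / stiffness \<xi>\<bar> = freq \<xi> ^ 4 * l * k0 * \<bar>\<xi>\<bar> * (1 / stiffness \<xi>)"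
    using pos assms(2)[of \<xi>] by (simp add: abs_mult)
  also have "\<dots> \<le> freq \<xi> ^ 4 * l * k0 * freq \<xi> * (c / freq \<xi> ^ 2)"
    using pos b assms(2)[of \<xi>] by (intro mult_mono assms(3)) (auto simp: less_imp_le)
  also have "\<dots> = l * k0 * c * weight \<xi> 3 0"
    using b by (simp add: weight_def field_simps eval_nat_numeral)
  finally show ?thesis .
qed

lemma velocity_sum_le:
  assumes "admissible \<xi> S"
  shows "weight \<xi> 0 0 * cmod (\<i> * velocity_sum S) \<le> (\<rho>1 / k1 + \<rho>2 / k2) * sqrt (wnorm2 \<xi> S)"
proof -
  have "cmod (velocity_sum S) \<le> \<rho>1 / k1 * cmod (hat_u S) + \<rho>2 / k2 * cmod (hat_y S)"
    unfolding velocity_sum_def using pos by (intro order_trans[OF norm_triangle_ineq]) simp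
  also have "\<dots> \<le> \<rho>1 / k1 * sqrt (wnorm2 \<xi> S) + \<rho>2 / k2 * sqrt (wnorm2 \<xi> S)"
    using wnorm2_bounds(4,6)[OF assms] pos by (intro add_mono mult_left_mono) auto
  finally show ?thesis by (simp add: weight_0_0 norm_mult distrib_right)
qed

lemma velocity_sum_deriv:
  assumes "solution \<xi> U" "\<xi> \<noteq> 0" "0 \<le> t"
  shows "((\<lambda>t. \<i> * velocity_sum (U t)) has_vector_derivative
     (l * \<xi>) *\<^sub>R hat_phi (U t) - stiffness \<xi> *\<^sub>R (\<i> * hat_p (U t))) (at t within {0..})"
  by (rule has_vector_derivative_eq_rhs[OF has_vector_derivative_mult_right[OF derived_derivs(2)[OF assms], of \<i>]])
    (simp add: complex_eq_iff)

text \<open>The square of \<open>?h\<close> is \<open>cost\<close> times the dissipation, so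
  \<theta> is available with order \<xi>^-2 at 0, as \<open>damping_size\<close> requires, and
  |\<xi>|^3 at infinity, as \<open>coupling\<close> requires. Hence \<open>coupling\<close> is
  estimated directly, with corrector 0.\<close>

lemma frictional_sizes:
  assumes "\<tau>0 = 0"
  shows "small theta_size" "small damping_size" "controlled coupling"
proof -
  let ?h = "\<lambda>\<xi> S. weight \<xi> 5 2 * cmod (hat_theta S)"
  have nn: "0 \<le> weight \<xi> i j" if "admissible \<xi> S" for \<xi> S i j
    using that weight_pos[of \<xi> i j] by (simp add: admissible_def)
  have "controlled (\<lambda>\<xi> S. (?h \<xi> S)\<^sup>2)"
  proof (rule controlled_mono[OF controlled_dissipation, of 1])
    show "(?h \<xi> S)\<^sup>2 \<le> 1 * (cost \<xi> * dissipation \<xi> S)" for \<xi> S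
      unfolding cost_def dissipation_def using assms
      by (simp add: weight_def power_mult_distrib power_divide flip: power_mult)
  qed simp
  then have h: "small ?h" using nn by (auto simp: small_def)
  show "small theta_size"
  proof (rule small_mono[OF h, of 1])
    fix \<xi> S assume adm: "admissible \<xi> S"
    then have "\<xi> \<noteq> 0" by (simp add: admissible_def)
    then show "0 \<le> theta_size \<xi> S \<and> theta_size \<xi> S \<le> 1 * ?h \<xi> S"
      using sizes_nonneg(1) by (auto simp: theta_size_def intro!: mult_right_mono weight_mono)
  qed simp
  show "small damping_size"
  proof (rule small_mono[OF h, of \<gamma>])
    fix \<xi> S assume adm: "admissible \<xi> S"
    then have \<xi>: "\<xi> \<noteq> 0" by (simp add: admissible_def)
    have "damping_size \<xi> S = \<gamma> * (weight \<xi> 2 2 * cmod (hat_theta S))"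
      unfolding damping_size_def rn_damping_def using assms pos by (simp add: norm_mult)
    also have "\<dots> \<le> \<gamma> * ?h \<xi> S"
      using pos by (intro mult_left_mono mult_right_mono weight_mono \<xi>) auto
    finally show "0 \<le> damping_size \<xi> S \<and> damping_size \<xi> S \<le> \<gamma> * ?h \<xi> S"
      using sizes_nonneg(2)[OF \<xi>] by simp
  qed (use pos in simp)
  obtain c where c: "0 < c" "\<And>\<xi>. 0 < stiffness \<xi>" "\<And>\<xi>. 1 / stiffness \<xi> \<le> c / freq \<xi> ^ 2"
    using inverse_stiffness_le by blast
  define C where "C = (l * k0 * c) * (1 * (\<rho>1 / k1 + \<rho>2 / k2))"
  show "controlled coupling"
  proof (rule controlled_step[of ?h 0 C "\<lambda>\<xi> S. 0"])
    show "corrector_deriv_le (\<lambda>\<xi> S. 0) (\<lambda>\<xi> S. - coupling \<xi> S + C * (?h \<xi> S * (?h \<xi> S + sqrt (wnorm2 \<xi> S))))"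
    proof (rule corrector_deriv_leI)
      fix \<xi> U and t :: real assume h: "\<xi> \<noteq> 0" and adm: "admissible \<xi> (U t)"
      define S where "S = U t"
      have "coupling \<xi> S = (freq \<xi> ^ 4 * l * k0 * \<xi> / stiffness \<xi>) * (hat_theta S \<bullet> (\<i> * velocity_sum S))"
        by (simp add: coupling_def inner_commute)
      also have "\<dots> \<le> (l * k0 * c) * (1 * (\<rho>1 / k1 + \<rho>2 / k2)) * (?h \<xi> S * (?h \<xi> S + sqrt (wnorm2 \<xi> S)))"
      proof (rule weighted_inner_le[OF h, where m=3 and n=0 and i=5 and j=2 and i'=0 and j'=0])
        show "\<bar>freq \<xi> ^ 4 * l * k0 * \<xi> / stiffness \<xi>\<bar> \<le> l * k0 * c * weight \<xi> 3 0"
          by (rule coupling_coefficient_le[OF c])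
        show "weight \<xi> 0 0 * cmod (\<i> * velocity_sum S) \<le> (\<rho>1 / k1 + \<rho>2 / k2) * (?h \<xi> S + sqrt (wnorm2 \<xi> S))"
          by (rule order_trans[OF velocity_sum_le[OF adm, folded S_def] mult_left_mono])
            (use nn[OF adm] pos in auto)
      qed (use pos c(1) in auto)
      finally have "0 \<le> - coupling \<xi> S + C * (?h \<xi> S * (?h \<xi> S + sqrt (wnorm2 \<xi> S)))"
        by (simp add: C_def)
      then show "\<exists>d. ((\<lambda>t. 0) has_real_derivative d) (at t within {0..}) \<and>
          d \<le> - coupling \<xi> (U t) + C * (?h \<xi> (U t) * (?h \<xi> (U t) + sqrt (wnorm2 \<xi> (U t))))"
        unfolding S_def by (intro exI[of _ 0]) auto
    qed
  qed (use h pos c(1) in \<open>auto simp: small_def C_def cost_bounded_def\<close>)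
qed

text \<open>Only the history is dissipated. Its mean has the derivative \<open>g0\<close> \<theta>
  plus a term with kernel g', so a multiplier pairing the mean with X produces \<open>g0\<close>
  \<theta> \<bullet> X: X = \<theta> gives \<open>theta_size\<close>, and X = i times
  \<open>velocity_sum\<close> gives \<open>coupling\<close>.\<close>

lemma memory_sizes:
  assumes "\<tau>0 = 1"
  shows "small theta_size" "small damping_size" "controlled coupling"
proof -
  define r where "r = sqrt (kernel_mass g)"
  define g0 where "g0 = kernel_mass g"
  have r: "0 < r" "0 < g0" using mass(1) by (simp_all add: r_def g0_def)
  let ?h = "\<lambda>\<xi> S. weight \<xi> 5 1 * sqrt (memory_energy S)"
  have M: "0 \<le> memory_energy S" "cmod (memory_mean S) \<le> r * sqrt (memory_energy S)"
      "cmod (memory_mean' S) \<le> \<beta>2 * r * sqrt (memory_energy S)" if "admissible \<xi> S" for \<xi> S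
    using that assms memory_bounds unfolding admissible_def r_def by blast+
  have nn: "0 \<le> weight \<xi> i j" if "admissible \<xi> S" for \<xi> S i j
    using that weight_pos[of \<xi> i j] by (simp add: admissible_def)
  have hN: "weight \<xi> 5 1 * cmod (memory_mean S) \<le> r * ?h \<xi> S" "weight \<xi> 5 1 * cmod (memory_mean' S) \<le> \<beta>2 * r * ?h \<xi> S"
      "0 \<le> ?h \<xi> S" if "admissible \<xi> S" for \<xi> S
    using mult_left_mono[OF M(2)[OF that] nn[OF that, of 5 1]] mult_left_mono[OF M(3)[OF that] nn[OF that, of 5 1]]
      M(1)[OF that] nn[OF that, of 5 1] by (simp_all add: mult_ac)
  have nN: "cmod (memory_mean S) \<le> r * weight \<xi> 0 2 * sqrt (norm2 \<xi> S)" if "admissible \<xi> S" for \<xi> S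
  proof -
    have "\<xi> \<noteq> 0" using that by (simp add: admissible_def)
    then have "sqrt (memory_energy S) \<le> weight \<xi> 0 2 * sqrt (norm2 \<xi> S)"
      using norm2_bounds(9)[OF that assms] by (simp add: weight_def field_simps)
    then have "r * sqrt (memory_energy S) \<le> r * (weight \<xi> 0 2 * sqrt (norm2 \<xi> S))"
      using r by simp
    with M(2)[OF that] show ?thesis
      by (simp add: mult.assoc)
  qed
  have h: "small ?h"
  proof -
    have "controlled (\<lambda>\<xi> S. (?h \<xi> S)\<^sup>2)"
    proof (rule controlled_mono[OF controlled_dissipation, of 1])
      fix \<xi> S assume adm: "admissible \<xi> S"
      then have "\<xi> \<noteq> 0" by (simp add: admissible_def)
      have "(?h \<xi> S)\<^sup>2 = freq \<xi> ^ 10 / \<xi>\<^sup>2 * memory_energy S"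
        using M(1)[OF adm] by (simp add: weight_def power_mult_distrib power_divide flip: power_mult)
      also have "\<dots> = cost \<xi> * dissipation \<xi> S"
        unfolding cost_def dissipation_def using assms \<open>\<xi> \<noteq> 0\<close> by (simp add: field_simps eval_nat_numeral)
      finally show "(?h \<xi> S)\<^sup>2 \<le> 1 * (cost \<xi> * dissipation \<xi> S)" by simp
    qed simp
    then show ?thesis using hN(3) by (auto simp: small_def)
  qed
  note N' = memory_derivs(1)[OF _ assms, folded scaleR_conv_of_real g0_def]
  have damp: "damping \<xi> S = \<xi>^4 *\<^sub>R memory_mean S" for \<xi> S
    using assms by (simp add: rn_damping_def memory_mean_def scaleR_conv_of_real)
  show "small damping_size"
  proof (rule small_mono[OF h, of r])
    fix \<xi> S assume adm: "admissible \<xi> S"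
    then have \<xi>: "\<xi> \<noteq> 0" by (simp add: admissible_def)
    have "cmod (damping \<xi> S) = \<bar>\<xi>\<bar> ^ 4 * cmod (memory_mean S)"
      by (simp add: damp power_abs)
    then have "damping_size \<xi> S = (freq \<xi> ^ 2 * \<bar>\<xi>\<bar> ^ 2) * cmod (memory_mean S)"
      using \<xi> by (simp add: damping_size_def weight_def field_simps eval_nat_numeral del: power2_abs abs_mult_self_eq)
    also have "\<dots> \<le> weight \<xi> 5 1 * cmod (memory_mean S)"
    proof (rule mult_right_mono)
      have "freq \<xi> ^ 2 * \<bar>\<xi>\<bar> ^ 2 \<le> freq \<xi> ^ 2 * freq \<xi> ^ 2"
        using freq_bounds[of \<xi>] by (intro mult_left_mono power_mono) auto
      also have "\<dots> = weight \<xi> 4 0" by (simp add: weight_def flip: power_add)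
      also have "\<dots> \<le> weight \<xi> 5 1" using \<xi> by (intro weight_mono) auto
      finally show "freq \<xi> ^ 2 * \<bar>\<xi>\<bar> ^ 2 \<le> weight \<xi> 5 1" .
    qed simp
    finally show "0 \<le> damping_size \<xi> S \<and> damping_size \<xi> S \<le> r * ?h \<xi> S"
      using hN(1)[OF adm] sizes_nonneg(2)[OF \<xi>] by simp
  qed (use r in simp)
  show "small theta_size"
  proof -
    define C where "C = 1 * (r * (\<kappa> + l * k0)) + 1 * (r * r) + \<rho>3 * (\<beta>2 * r * 1)"
    \<comment> \<open>The coefficient is \<rho>3 times the square of the weight in
      \<open>theta_size\<close>.\<close>
    let ?F = "\<lambda>\<xi> S. (- (\<rho>3 * freq \<xi> ^ 6 / \<xi>\<^sup>2)) * (hat_theta S \<bullet> memory_mean S)"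
    show ?thesis
    proof (rule small_step[OF h, of "\<rho>3 * (1 * r)" C "\<rho>3 * g0" ?F])
      show "cost_bounded (\<rho>3 * (1 * r)) ?F"
        by (rule cost_bounded_inner[where m=6 and n=2 and i=0 and j=0 and i'=0 and j'=2])
          (use pos r nN norm2_bounds(7) in \<open>auto simp: weight_def abs_mult\<close>)
      show "corrector_deriv_le ?F
         (\<lambda>\<xi> S. - (\<rho>3 * g0 * (theta_size \<xi> S)\<^sup>2) + C * (?h \<xi> S * (?h \<xi> S + sqrt (wnorm2 \<xi> S))))"
      proof (rule corrector_deriv_leI)
        fix \<xi> U and t :: real assume h: "solution \<xi> U" "\<xi> \<noteq> 0" "0 \<le> t" and adm: "admissible \<xi> (U t)"
        note \<xi> = h(2)
        define S where "S = U t"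
        have deriv: "((\<lambda>t. ?F \<xi> (U t)) has_real_derivative
            - (\<rho>3 * g0 * freq \<xi> ^ 6 / \<xi>\<^sup>2) * (hat_theta S \<bullet> hat_theta S)
            + (- (freq \<xi> ^ 6 / \<xi>)) * (memory_mean S \<bullet> moment \<xi> S)
            + (freq \<xi> ^ 6 * \<xi>\<^sup>2) * (memory_mean S \<bullet> memory_mean S)
            + (- (\<rho>3 * freq \<xi> ^ 6 / \<xi>\<^sup>2)) * (memory_mean' S \<bullet> hat_theta S))
            (at t within {0..})" (is "(_ has_real_derivative ?d) _")
          unfolding S_def
          by (rule DERIV_cong, (rule DERIV_cmult has_real_derivative_inner basic_derivs(6)[OF h(1,3)]
                N'[OF h(1,3)])+)
            (use pos \<xi> in \<open>simp add: damp inner_add_left inner_add_right inner_diff_left inner_diff_right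
              inner_commute[of "moment \<xi> (U t)"] inner_commute[of "memory_mean' (U t)"]
              field_simps power2_eq_square eval_nat_numeral\<close>)
        define T where "T = sqrt (wnorm2 \<xi> S)"
        define H where "H = ?h \<xi> S"
        note b = weight_bounds[OF adm, folded S_def, folded T_def]
        note HN = hN[OF adm, folded S_def, folded H_def]
        have H: "weight \<xi> 5 1 * cmod (memory_mean S) \<le> r * (H + T)" "weight \<xi> 3 1 * cmod (hat_theta S) \<le> 1 * (H + T)"
          "weight \<xi> 1 0 * cmod (moment \<xi> S) \<le> (\<kappa> + l * k0) * (H + T)"
        proof -
          show "weight \<xi> 5 1 * cmod (memory_mean S) \<le> r * (H + T)"
            by (rule order_trans[OF HN(1) mult_left_mono]) (use r b(1) in auto)
          show "weight \<xi> 3 1 * cmod (hat_theta S) \<le> 1 * (H + T)"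
            using wnorm2_bounds(9)[OF adm, folded S_def, folded T_def] HN(3) by (simp add: weight_def)
          show "weight \<xi> 1 0 * cmod (moment \<xi> S) \<le> (\<kappa> + l * k0) * (H + T)"
            by (rule order_trans[OF b(8) mult_left_mono]) (use HN(3) pos \<kappa>_pos in auto)
        qed
        have 1: "(- (freq \<xi> ^ 6 / \<xi>)) * (memory_mean S \<bullet> moment \<xi> S) \<le> 1 * (r * (\<kappa> + l * k0)) * (H * (H + T))"
          by (rule weighted_inner_le[OF \<xi>, where m=6 and n=1, OF _ HN(1) H(3)]) (auto simp: weight_def)
        have 2: "(freq \<xi> ^ 6 * \<xi>\<^sup>2) * (memory_mean S \<bullet> memory_mean S) \<le> 1 * (r * r) * (H * (H + T))"
        proof (rule weighted_inner_le[OF \<xi>, where m=8 and n=0, OF _ HN(1) H(1)])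
          have "freq \<xi> ^ 6 * \<bar>\<xi>\<bar> ^ 2 \<le> freq \<xi> ^ 6 * freq \<xi> ^ 2"
            using freq_bounds[of \<xi>] by (intro mult_left_mono power_mono) auto
          then show "\<bar>freq \<xi> ^ 6 * \<xi>\<^sup>2\<bar> \<le> 1 * weight \<xi> 8 0"
            by (simp add: weight_def abs_mult flip: power_add)
        qed auto
        have 3: "(- (\<rho>3 * freq \<xi> ^ 6 / \<xi>\<^sup>2)) * (memory_mean' S \<bullet> hat_theta S) \<le> \<rho>3 * (\<beta>2 * r * 1) * (H * (H + T))"
          by (rule weighted_inner_le[OF \<xi>, where m=6 and n=2, OF _ HN(2) H(2)]) (use pos in \<open>auto simp: weight_def abs_mult\<close>)
        have "- (\<rho>3 * g0 * freq \<xi> ^ 6 / \<xi>\<^sup>2) * (hat_theta S \<bullet> hat_theta S) \<le> - (\<rho>3 * g0 * (theta_size \<xi> S)\<^sup>2)"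
          by (simp add: theta_size_def weight_def power_mult_distrib power_divide power2_norm_eq_inner flip: power_mult)
        from add_mono[OF add_mono[OF add_mono[OF this 1] 2] 3]
        have "?d \<le> - (\<rho>3 * g0 * (theta_size \<xi> S)\<^sup>2) + C * (H * (H + T))"
          unfolding C_def distrib_right[of _ _ "H * (H + T)"] by linarith
        with deriv show "\<exists>d. ((\<lambda>t. ?F \<xi> (U t)) has_real_derivative d) (at t within {0..}) \<and>
            d \<le> - (\<rho>3 * g0 * (theta_size \<xi> (U t))\<^sup>2) + C * (?h \<xi> (U t) * (?h \<xi> (U t) + sqrt (wnorm2 \<xi> (U t))))"
          unfolding S_def H_def T_def by blast
      qed
      fix \<xi> S assume "admissible \<xi> S"
      then show "0 \<le> theta_size \<xi> S" using sizes_nonneg(1) by (simp add: admissible_def)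
    qed (use r pos \<kappa>_pos \<beta>_pos in \<open>auto simp: C_def\<close>)
  qed
  obtain c where c: "0 < c" "\<And>\<xi>. 0 < stiffness \<xi>" "\<And>\<xi>. 1 / stiffness \<xi> \<le> c / freq \<xi> ^ 2"
    using inverse_stiffness_le by blast
  define k where "k = l * k0 * c / g0"
  define w where "w \<xi> = freq \<xi> ^ 4 * l * k0 * \<xi> / stiffness \<xi>" for \<xi>
  define cW where "cW = \<rho>1 / k1 + \<rho>2 / k2"
  define C where "C = k * (\<beta>2 * r * cW) + k * l * (r * 1) + l * k0 / g0 * (r * 1)"
  have kpos: "0 \<le> k" "0 \<le> cW" using r pos c(1) by (simp_all add: k_def cW_def)
  have w: "\<bar>- (w \<xi> / g0)\<bar> \<le> k * weight \<xi> 3 0" for \<xi>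
    using divide_right_mono[OF coupling_coefficient_le[OF c, of \<xi>], of g0] r by (simp add: w_def k_def abs_mult)
  \<comment> \<open>Division by \<open>g0\<close> makes the \<theta> part of the derivative of the
    mean equal to - \<open>coupling\<close>. In the term with p, the \<open>stiffness\<close> in the
    derivative of \<open>velocity_sum\<close> cancels the one in \<open>w\<close>.\<close>
  let ?F = "\<lambda>\<xi> S. (- (w \<xi> / g0)) * ((\<i> * velocity_sum S) \<bullet> memory_mean S)"
  show "controlled coupling"
  proof (rule controlled_step[of ?h "k * (cW * r)" C ?F])
    show "cost_bounded (k * (cW * r)) ?F"
      by (rule cost_bounded_inner[where m=3 and n=0 and i=0 and j=0 and i'=0 and j'=2])
        (use w kpos r nN norm2_velocity_sum in \<open>auto simp: cW_def\<close>)
    show "corrector_deriv_le ?F (\<lambda>\<xi> S. - coupling \<xi> S + C * (?h \<xi> S * (?h \<xi> S + sqrt (wnorm2 \<xi> S))))"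
    proof (rule corrector_deriv_leI)
      fix \<xi> U and t :: real assume h: "solution \<xi> U" "\<xi> \<noteq> 0" "0 \<le> t" and adm: "admissible \<xi> (U t)"
      note \<xi> = h(2)
      define S where "S = U t"
      have deriv: "((\<lambda>t. ?F \<xi> (U t)) has_real_derivative
          - coupling \<xi> S + (- (w \<xi> / g0)) * (memory_mean' S \<bullet> (\<i> * velocity_sum S))
          + (- (w \<xi> / g0 * (l * \<xi>))) * (memory_mean S \<bullet> hat_phi S)
          + (freq \<xi> ^ 4 * l * k0 * \<xi> / g0) * (memory_mean S \<bullet> (\<i> * hat_p S)))
          (at t within {0..})" (is "(_ has_real_derivative ?d) _")
        unfolding S_def
        by (rule DERIV_cong, (rule DERIV_cmult has_real_derivative_inner velocity_sum_deriv[OF h]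
              N'[OF h(1,3)])+)
          (use r \<xi> c(2)[of \<xi>] in \<open>simp add: coupling_def w_def inner_add_left inner_add_right
            inner_diff_left inner_diff_right inner_commute[of "hat_phi (U t)"] inner_commute[of "\<i> * hat_p (U t)"]
            inner_commute[of "\<i> * velocity_sum (U t)" "memory_mean' (U t)"] field_simps\<close>)
      define T where "T = sqrt (wnorm2 \<xi> S)"
      define H where "H = ?h \<xi> S"
      note b = weight_bounds[OF adm, folded S_def, folded T_def]
      note HN = hN[OF adm, folded S_def, folded H_def]
      have W: "weight \<xi> 0 0 * cmod (\<i> * velocity_sum S) \<le> cW * (H + T)"
        by (rule order_trans[OF velocity_sum_le[OF adm, folded S_def cW_def, folded T_def] mult_left_mono])
          (use HN(3) kpos in auto)
      have B: "weight \<xi> 2 0 * cmod (hat_phi S) \<le> 1 * (H + T)" "weight \<xi> 1 0 * cmod (\<i> * hat_p S) \<le> 1 * (H + T)"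
        using b(6,7) HN(3) by (simp_all add: norm_mult)
      have 1: "(- (w \<xi> / g0)) * (memory_mean' S \<bullet> (\<i> * velocity_sum S)) \<le> k * (\<beta>2 * r * cW) * (H * (H + T))"
        by (rule weighted_inner_le[OF \<xi> w HN(2) W]) (use kpos in auto)
      have 2: "(- (w \<xi> / g0 * (l * \<xi>))) * (memory_mean S \<bullet> hat_phi S) \<le> k * l * (r * 1) * (H * (H + T))"
      proof (rule weighted_inner_le[OF \<xi>, where m=4 and n=0, OF _ HN(1) B(1)])
        have "\<bar>- (w \<xi> / g0)\<bar> * (l * \<bar>\<xi>\<bar>) \<le> (k * weight \<xi> 3 0) * (l * freq \<xi>)"
          using w[of \<xi>] pos freq_bounds[of \<xi>] kpos weight_pos[OF \<xi>, of 3 0]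
          by (intro mult_mono) (auto intro: mult_nonneg_nonneg)
        then show "\<bar>- (w \<xi> / g0 * (l * \<xi>))\<bar> \<le> k * l * weight \<xi> 4 0"
          using pos by (simp add: abs_mult weight_def eval_nat_numeral mult_ac)
      qed (use kpos pos in auto)
      have 3: "(freq \<xi> ^ 4 * l * k0 * \<xi> / g0) * (memory_mean S \<bullet> (\<i> * hat_p S)) \<le> l * k0 / g0 * (r * 1) * (H * (H + T))"
      proof (rule weighted_inner_le[OF \<xi>, where m=5 and n=0, OF _ HN(1) B(2)])
        have "l * k0 / g0 * (freq \<xi> ^ 4 * \<bar>\<xi>\<bar>) \<le> l * k0 / g0 * (freq \<xi> ^ 4 * freq \<xi>)"
          using pos r freq_bounds[of \<xi>] by (intro mult_left_mono) auto
        then show "\<bar>freq \<xi> ^ 4 * l * k0 * \<xi> / g0\<bar> \<le> l * k0 / g0 * weight \<xi> 5 0"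
          using pos r by (simp add: abs_mult weight_def eval_nat_numeral mult_ac)
      qed (use r pos in auto)
      from add_mono[OF add_mono[OF add_mono[OF order_refl[of "- coupling \<xi> S"] 1] 2] 3]
      have "?d \<le> - coupling \<xi> S + C * (H * (H + T))"
        unfolding C_def distrib_right[of _ _ "H * (H + T)"] by linarith
      with deriv show "\<exists>d. ((\<lambda>t. ?F \<xi> (U t)) has_real_derivative d) (at t within {0..}) \<and>
          d \<le> - coupling \<xi> (U t) + C * (?h \<xi> (U t) * (?h \<xi> (U t) + sqrt (wnorm2 \<xi> (U t))))"
        unfolding S_def H_def T_def by blast
    qed
  qed (use h kpos r pos \<beta>_pos in \<open>auto simp: small_def C_def\<close>)
qed


subsection \<open>Exponential decay\<close>

text \<open>The factor 1024 is 2^10, from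
  \<open>freq \<xi> \<le> 2 * max 1 \<bar>\<xi>\<bar>\<close>.\<close>

lemma cost_le: "\<xi> \<noteq> 0 \<Longrightarrow> \<xi> ^ (4 + 2 * \<tau>0) / (\<xi> ^ 10 + 1) / 1024 \<le> 1 / cost \<xi>"
proof -
  assume \<xi>: "\<xi> \<noteq> 0"
  have "freq \<xi> \<le> 2 * max 1 \<bar>\<xi>\<bar>" by (simp add: freq_def)
  then have "freq \<xi> ^ 10 \<le> (2 * max 1 \<bar>\<xi>\<bar>) ^ 10"
    using freq_bounds[of \<xi>] by (intro power_mono) auto
  also have "\<dots> = 1024 * (max 1 \<bar>\<xi>\<bar>) ^ 10" by (simp only: power_mult_distrib) simp
  also have "(max 1 \<bar>\<xi>\<bar>) ^ 10 \<le> \<xi> ^ 10 + 1"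
    by (simp add: max_def power_even_abs)
  finally have le: "freq \<xi> ^ 10 \<le> 1024 * (\<xi> ^ 10 + 1)" by simp
  have even: "\<xi> ^ (4 + 2 * \<tau>0) = \<bar>\<xi>\<bar> ^ (4 + 2 * \<tau>0)" by (simp add: power_even_abs)
  have "\<xi> ^ (4 + 2 * \<tau>0) / (\<xi> ^ 10 + 1) / 1024 = \<bar>\<xi>\<bar> ^ (4 + 2 * \<tau>0) / (1024 * (\<xi> ^ 10 + 1))"
    unfolding even by simp
  also have "\<dots> \<le> \<bar>\<xi>\<bar> ^ (4 + 2 * \<tau>0) / freq \<xi> ^ 10"
    using le freq_bounds[of \<xi>] add_nonneg_pos[of "\<xi> ^ 10" 1] by (intro divide_left_mono mult_pos_pos) auto
  also have "\<dots> = 1 / cost \<xi>" by (simp add: cost_def)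
  finally show ?thesis .
qed

lemma norm2_decay:
  assumes "controlled wnorm2"
  obtains c M where "0 < c" "0 < M" "\<And>\<xi> U t. solution \<xi> U \<Longrightarrow> \<xi> \<noteq> 0 \<Longrightarrow> 0 \<le> t \<Longrightarrow>
      norm2 \<xi> (U t) \<le> M * exp (- (c / cost \<xi>) * t) * norm2 \<xi> (U 0)"
proof -
  \<comment> \<open>The choice \<epsilon> = 1/2 leaves half of \<open>wnorm2\<close> as
    gain.\<close>
  obtain C F where C: "C \<ge> 0" "cost_bounded C F" "corrector_deriv_le F
     (\<lambda>\<xi> S. - wnorm2 \<xi> S + 1 / 2 * wnorm2 \<xi> S + C * (cost \<xi> * dissipation \<xi> S))"
    using assms[unfolded controlled_def, rule_format, of "1 / 2"] by auto
  obtain e1 e2 where e: "0 < e1" "0 < e2"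
    "\<And>\<xi> S. (\<tau>0 = 1 \<longrightarrow> rn_history g (hat_eta S)) \<Longrightarrow> e1 * norm2 \<xi> S \<le> energy \<xi> S \<and> energy \<xi> S \<le> e2 * norm2 \<xi> S"
    using energy_norm2 by blast
  \<comment> \<open>\<open>x\<close> makes the energy term outweigh the corrector with
    \<open>cost \<xi> * norm2\<close> to spare; \<open>y\<close> makes the dissipation of the energy
    absorb the term with \<open>C\<close>. \<open>M\<close> below bounds the Lyapunov function from
    above in units of \<open>cost \<xi> * norm2\<close>.\<close>
  define x y where "x = (C + 1) / e1" and "y = C / rate"
  define \<mu> where "\<mu> = x + y"
  define M where "M = \<mu> * e2 + C"
  have "x * e1 = C + 1" "y * rate = C" "0 < x" "0 \<le> y"
    using C(1) e(1) rate_pos by (simp_all add: x_def y_def)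
  then have \<mu>: "C + 1 \<le> \<mu> * e1" "C \<le> \<mu> * rate" "0 < \<mu>"
    using C(1) e(1) rate_pos by (simp_all add: \<mu>_def distrib_right)
  have M: "0 < M" using \<mu>(3) e(2) C(1) by (simp add: M_def add_pos_nonneg)
  \<comment> \<open>The rate is half the gain, \<open>1/2 * norm2\<close>, over the upper bound
    \<open>M * cost \<xi> * norm2\<close> of the Lyapunov function.\<close>
  have "norm2 \<xi> (U t) \<le> M * exp (- (1 / (2 * M) / cost \<xi>) * t) * norm2 \<xi> (U 0)"
    if sol: "solution \<xi> U" and \<xi>: "\<xi> \<noteq> 0" and t: "0 \<le> t" for \<xi> U t
  proof -
    have K: "0 < cost \<xi>" using one_le_cost[OF \<xi>] by simp
    define L where "L S = \<mu> * cost \<xi> * energy \<xi> S + F \<xi> S" for S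
    have L: "cost \<xi> * norm2 \<xi> S \<le> L S" "L S \<le> M * (cost \<xi> * norm2 \<xi> S)" if adm: "admissible \<xi> S" for S
    proof -
      have F: "\<bar>F \<xi> S\<bar> \<le> C * (cost \<xi> * norm2 \<xi> S)" using C(2) adm by (simp add: cost_bounded_def)
      have E: "e1 * norm2 \<xi> S \<le> energy \<xi> S" "energy \<xi> S \<le> e2 * norm2 \<xi> S"
        using e(3)[of S \<xi>] adm unfolding admissible_def by blast+
      have "(C + 1) * (cost \<xi> * norm2 \<xi> S) \<le> (\<mu> * e1) * (cost \<xi> * norm2 \<xi> S)"
        using \<mu>(1) cost_norm2_nonneg[OF adm] by (rule mult_right_mono)
      also have "\<dots> \<le> \<mu> * cost \<xi> * energy \<xi> S"
        using mult_left_mono[OF E(1), of "\<mu> * cost \<xi>"] \<mu>(3) K by (simp add: mult_ac)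
      finally show "cost \<xi> * norm2 \<xi> S \<le> L S" using F by (simp add: L_def distrib_right)
      have "\<mu> * cost \<xi> * energy \<xi> S \<le> (\<mu> * e2) * (cost \<xi> * norm2 \<xi> S)"
        using mult_left_mono[OF E(2), of "\<mu> * cost \<xi>"] \<mu>(3) K by (simp add: mult_ac)
      then show "L S \<le> M * (cost \<xi> * norm2 \<xi> S)" using F by (simp add: L_def M_def distrib_right)
    qed
    have "L (U t) \<le> exp (- (1 / (2 * M) / cost \<xi>) * (t - 0)) * L (U 0)"
    proof (rule exp_decay_if_derivative_le[OF _ order_refl t])
      fix s :: real assume s: "0 \<le> s"
      note adm = solution_admissible[OF sol \<xi> s]
      obtain d1 where d1: "((\<lambda>t. energy \<xi> (U t)) has_real_derivative d1) (at s within {0..})"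
          "d1 \<le> - rate * dissipation \<xi> (U s)"
        using energy_deriv[OF sol s] by blast
      obtain d2 where d2: "((\<lambda>t. F \<xi> (U t)) has_real_derivative d2) (at s within {0..})"
          "d2 \<le> - wnorm2 \<xi> (U s) + 1 / 2 * wnorm2 \<xi> (U s) + C * (cost \<xi> * dissipation \<xi> (U s))"
        using C(3) sol \<xi> s unfolding corrector_deriv_le_def by blast
      have "((\<lambda>t. L (U t)) has_real_derivative \<mu> * cost \<xi> * d1 + d2) (at s within {0..})"
        unfolding L_def by (intro DERIV_add DERIV_cmult d1 d2)
      moreover have "\<mu> * cost \<xi> * d1 + d2 \<le> - (1 / (2 * M) / cost \<xi>) * L (U s)"
      proof -
        have "\<mu> * cost \<xi> * d1 \<le> \<mu> * cost \<xi> * (- rate * dissipation \<xi> (U s))"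
          using d1(2) \<mu>(3) K by (intro mult_left_mono) auto
        moreover have "C * (cost \<xi> * dissipation \<xi> (U s)) \<le> (\<mu> * rate) * (cost \<xi> * dissipation \<xi> (U s))"
          using \<mu>(2) cost_dissipation_nonneg[OF adm] by (rule mult_right_mono)
        ultimately have "\<mu> * cost \<xi> * d1 + d2 \<le> - (1 / 2 * wnorm2 \<xi> (U s))"
          using d2(2) by (simp add: mult_ac)
        also have "\<dots> \<le> - (1 / 2 * norm2 \<xi> (U s))"
          using wnorm2_bounds(2)[OF adm] by simp
        also have "\<dots> \<le> - (1 / (2 * M) / cost \<xi>) * L (U s)"
          using mult_left_mono[OF L(2)[OF adm], of "1 / (2 * M) / cost \<xi>"] M K by (simp add: field_simps)
        finally show ?thesis .
      qed
      ultimately show "\<exists>d. ((\<lambda>t. L (U t)) has_real_derivative d) (at s within {0..}) \<and>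
          d \<le> - (1 / (2 * M) / cost \<xi>) * L (U s)" by blast
    qed
    also have "\<dots> \<le> exp (- (1 / (2 * M) / cost \<xi>) * (t - 0)) * (M * (cost \<xi> * norm2 \<xi> (U 0)))"
      by (intro mult_left_mono L(2) solution_admissible[OF sol \<xi>]) auto
    finally have "cost \<xi> * norm2 \<xi> (U t) \<le> cost \<xi> * (M * exp (- (1 / (2 * M) / cost \<xi>) * t) * norm2 \<xi> (U 0))"
      using L(1)[OF solution_admissible[OF sol \<xi> t]] by (simp add: mult_ac)
    then show ?thesis using K by simp
  qed
  then show ?thesis using M that[of "1 / (2 * M)" M] by simp
qed

lemma norm2_bounded:
  obtains M where "0 < M" "\<And>\<xi> U t. solution \<xi> U \<Longrightarrow> 0 \<le> t \<Longrightarrow> norm2 \<xi> (U t) \<le> M * norm2 \<xi> (U 0)"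
proof -
  obtain e1 e2 where e: "0 < e1" "0 < e2"
    "\<And>\<xi> S. (\<tau>0 = 1 \<longrightarrow> rn_history g (hat_eta S)) \<Longrightarrow> e1 * norm2 \<xi> S \<le> energy \<xi> S \<and> energy \<xi> S \<le> e2 * norm2 \<xi> S"
    using energy_norm2 by blast
  have "norm2 \<xi> (U t) \<le> e2 / e1 * norm2 \<xi> (U 0)" if sol: "solution \<xi> U" and t: "0 \<le> t" for \<xi> U t
  proof -
    have hist: "\<tau>0 = 1 \<longrightarrow> rn_history g (hat_eta (U s))" if "0 \<le> s" for s
      using solution_history(1)[OF sol _ that] by blast
    have "energy \<xi> (U t) \<le> energy \<xi> (U 0)"
    proof (rule nonincreasing_if_derivative_nonpos[OF _ order_refl t])
      fix s :: real assume s: "0 \<le> s"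
      have "0 \<le> dissipation \<xi> (U s)"
        using hist[OF s] \<tau>0 memory_bounds(1)[of "U s"] unfolding dissipation_def by auto
      then have "- rate * dissipation \<xi> (U s) \<le> 0" using rate_pos by simp
      then show "\<exists>d. ((\<lambda>t. energy \<xi> (U t)) has_real_derivative d) (at s within {0..}) \<and> d \<le> 0"
        using energy_deriv[OF sol s] by force
    qed
    then have "e1 * norm2 \<xi> (U t) \<le> e2 * norm2 \<xi> (U 0)"
      using e(3)[OF hist[OF t], of \<xi>] e(3)[OF hist[OF order_refl], of \<xi>] by linarith
    then show ?thesis using e(1) by (simp add: field_simps)
  qed
  then show ?thesis using e that[of "e2 / e1"] by simp
qed

lemma exponential_decay:
  assumes "k1 / \<rho>1 \<noteq> k2 / \<rho>2"
  shows "\<exists>c>0. \<exists>c'>0. \<forall>\<xi> U. solution \<xi> U \<longrightarrow> (\<forall>t\<ge>0. rn_norm \<tau>0 g \<xi> (U t)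
     \<le> c' * exp (- c * (\<xi> ^ (4 + 2 * \<tau>0) / (\<xi> ^ 10 + 1)) * t) * rn_norm \<tau>0 g \<xi> (U 0))"
proof -
  have "\<tau>0 = 0 \<or> \<tau>0 = 1" using \<tau>0 by auto
  then have "small theta_size" "small damping_size" "controlled coupling"
    using frictional_sizes memory_sizes by blast+
  then obtain c M where c: "0 < c" "0 < M" "\<And>\<xi> U t. solution \<xi> U \<Longrightarrow> \<xi> \<noteq> 0 \<Longrightarrow> 0 \<le> t \<Longrightarrow>
      norm2 \<xi> (U t) \<le> M * exp (- (c / cost \<xi>) * t) * norm2 \<xi> (U 0)"
    using norm2_decay[OF controlled_wnorm2[OF assms]] by metis
  obtain M0 where M0: "0 < M0" "\<And>\<xi> U t. solution \<xi> U \<Longrightarrow> 0 \<le> t \<Longrightarrow> norm2 \<xi> (U t) \<le> M0 * norm2 \<xi> (U 0)"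
    using norm2_bounded by blast
  have "rn_norm \<tau>0 g \<xi> (U t) \<le> sqrt (M + M0) * exp (- (c / 2048) * (\<xi> ^ (4 + 2 * \<tau>0) / (\<xi> ^ 10 + 1)) * t) * rn_norm \<tau>0 g \<xi> (U 0)"
    if sol: "solution \<xi> U" and t: "0 \<le> t" for \<xi> U t
  proof -
    \<comment> \<open>Passing from the squared norm to the norm halves the exponent, hence 2048 in
      place of 1024.\<close>
    have exp: "exp (- (c / 1024) * f * t) = (exp (- (c / 2048) * f * t))\<^sup>2" for f
      by (simp flip: exp_double)
    let ?f = "\<xi> ^ (4 + 2 * \<tau>0) / (\<xi> ^ 10 + 1)"
    have "0 \<le> real \<tau>0 * \<xi>^4 * memory_energy (U 0)"
      using solution_history(1)[OF sol _ order_refl] by (intro memory_term_nonneg) blast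
    then have n0: "0 \<le> norm2 \<xi> (U 0)" by (simp add: norm2_def)
    have "norm2 \<xi> (U t) \<le> (M + M0) * exp (- (c / 1024) * ?f * t) * norm2 \<xi> (U 0)"
    proof (cases "\<xi> = 0")
      \<comment> \<open>Here f(\<xi>) = 0, and the claim is the boundedness of the norm.\<close>
      case True
      have "norm2 \<xi> (U t) \<le> (M + M0) * norm2 \<xi> (U 0)"
        using M0(2)[OF sol t] mult_nonneg_nonneg[OF less_imp_le[OF c(2)] n0] by (simp add: distrib_right)
      then show ?thesis using True by (simp add: power_0_left)
    next
      case False
      have "c * t * (?f / 1024) \<le> c * t * (1 / cost \<xi>)"
        using cost_le[OF False] c(1) t by (intro mult_left_mono) auto
      then have "exp (- (c / cost \<xi>) * t) \<le> exp (- (c / 1024) * ?f * t)"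
        by (simp add: mult_ac)
      then have "M * exp (- (c / cost \<xi>) * t) * norm2 \<xi> (U 0) \<le> (M + M0) * exp (- (c / 1024) * ?f * t) * norm2 \<xi> (U 0)"
        using c(2) M0(1) n0 by (intro mult_right_mono mult_mono) auto
      then show ?thesis using c(3)[OF sol False t] by simp
    qed
    also have "\<dots> = (M + M0) * (exp (- (c / 2048) * ?f * t))\<^sup>2 * norm2 \<xi> (U 0)"
      by (simp only: exp)
    finally have "sqrt (norm2 \<xi> (U t)) \<le> sqrt ((M + M0) * (exp (- (c / 2048) * ?f * t))\<^sup>2 * norm2 \<xi> (U 0))"
      by (rule real_sqrt_le_mono)
    then show ?thesis
      by (simp add: rn_norm_eq real_sqrt_mult)
  qed
  then show ?thesis
    using c(1,2) M0(1) by (intro exI[of _ "c / 2048"] conjI exI[of _ "sqrt (M + M0)"]) auto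
qed

section \<open>Equal wave speeds: an undamped wave\<close>

definition wave_speed :: real where
  "wave_speed = sqrt (k1 / \<rho>1)"

text \<open>The initial datum is u = 1, y = -1 and 0 otherwise. As p and \<theta> stay 0, neither
  the shear coupling nor the damping acts. At \<xi> = 0 the state is constant, so that frequency
  needs no separate treatment.\<close>

definition undamped :: "real \<Rightarrow> real \<Rightarrow> rn_state" where
  "undamped \<xi> t =
     \<lparr>hat_v = \<i> * of_real (sin (wave_speed * \<xi> * t) / wave_speed), hat_u = of_real (cos (wave_speed * \<xi> * t)),
      hat_z = - (\<i> * of_real (sin (wave_speed * \<xi> * t) / wave_speed)), hat_y = - of_real (cos (wave_speed * \<xi> * t)),
      hat_phi = 0, hat_theta = 0, hat_p = 0, hat_eta = (\<lambda>_. 0)\<rparr>"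

lemma wave_speed_pos: "0 < wave_speed"
  using pos by (simp add: wave_speed_def)

lemma undamped_solution:
  assumes "k1 / \<rho>1 = k2 / \<rho>2"
  shows "rn_compatible l \<xi> (undamped \<xi> t)"
    and "rn_solution \<tau>0 \<rho>1 \<rho>2 \<rho>3 k0 k1 k2 k3 \<gamma> l g \<xi> (undamped \<xi>)"
proof -
  let ?a = wave_speed
  have a: "\<rho>1 * ?a\<^sup>2 = k1" "\<rho>2 * ?a\<^sup>2 = k2"
    using pos assms by (auto simp: wave_speed_def field_simps)
  show "rn_compatible l \<xi> (undamped \<xi> t)"
    by (simp add: rn_compatible_def undamped_def)
  have v: "((\<lambda>t. \<i> * of_real (sin (?a * \<xi> * t) / ?a)) has_vector_derivative \<i> * of_real \<xi> * of_real (cos (?a * \<xi> * t)))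
      (at t within A)" for t A
  proof -
    have "((\<lambda>t. sin (?a * \<xi> * t) / ?a) has_real_derivative \<xi> * cos (?a * \<xi> * t)) (at t within A)"
      using wave_speed_pos by (auto intro!: derivative_eq_intros)
    from has_vector_derivative_mult_right[OF has_vector_derivative_of_real[OF this], of \<i>]
    show ?thesis by (simp add: mult.assoc)
  qed
  have u: "((\<lambda>t. complex_of_real (cos (?a * \<xi> * t))) has_vector_derivative
      \<i> * of_real (?a\<^sup>2 * \<xi>) * (\<i> * of_real (sin (?a * \<xi> * t) / ?a))) (at t within A)" for t A
  proof -
    have "((\<lambda>t. cos (?a * \<xi> * t)) has_real_derivative - (?a * \<xi> * sin (?a * \<xi> * t))) (at t within A)"
      by (auto intro!: derivative_eq_intros)
    from has_vector_derivative_of_real[OF this]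
    show ?thesis
      by (rule has_vector_derivative_eq_rhs) (use wave_speed_pos in \<open>simp add: complex_eq_iff power2_eq_square\<close>)
  qed
  have u\<rho>: "((\<lambda>t. of_real \<rho> * complex_of_real (cos (?a * \<xi> * t))) has_vector_derivative
      \<i> * of_real (k * \<xi>) * (\<i> * of_real (sin (?a * \<xi> * t) / ?a))) (at t within A)" if "\<rho> * ?a\<^sup>2 = k" for t A \<rho> k
    using has_vector_derivative_mult_right[OF u, of "of_real \<rho>" t A] unfolding that[symmetric] by (simp add: mult_ac)
  have damp: "rn_damping \<tau>0 \<gamma> g \<xi> (undamped \<xi> t) = 0" for t
    by (simp add: rn_damping_def undamped_def set_lebesgue_integral_def)
  show "rn_solution \<tau>0 \<rho>1 \<rho>2 \<rho>3 k0 k1 k2 k3 \<gamma> l g \<xi> (undamped \<xi>)"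
    unfolding rn_solution_def damp
    using v u\<rho>[OF a(1)] has_vector_derivative_minus[OF v] has_vector_derivative_minus[OF u\<rho>[OF a(2)]]
    by (auto simp: undamped_def rn_history_def has_transport_derivative_def set_borel_measurable_def set_integrable_def)
qed

lemma undamped_not_tendsto_0:
  shows "\<not> ((\<lambda>t. rn_norm \<tau>0 g \<xi> (undamped \<xi> t)) \<longlongrightarrow> 0) at_top"
proof
  assume lim: "((\<lambda>t. rn_norm \<tau>0 g \<xi> (undamped \<xi> t)) \<longlongrightarrow> 0) at_top"
  define a where "a = wave_speed"
  \<comment> \<open>The smaller of the coefficients of the squared cosine and sine in the squared
    norm, hence a lower bound independent of time and frequency.\<close>
  define m where "m = min 1 (1 / a\<^sup>2)"
  have a: "0 < a" using wave_speed_pos by (simp add: a_def)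
  then have m: "0 < m" by (simp add: m_def)
  have "sqrt m \<le> rn_norm \<tau>0 g \<xi> (undamped \<xi> t)" for t
  proof -
    let ?s = "sin (a * \<xi> * t)" and ?c = "cos (a * \<xi> * t)"
    have "m = m * (?s\<^sup>2 + ?c\<^sup>2)" by simp
    also have "\<dots> \<le> (1 / a\<^sup>2) * ?s\<^sup>2 + 1 * ?c\<^sup>2"
      unfolding distrib_left m_def by (intro add_mono mult_right_mono) auto
    also have "\<dots> = (?s / a)\<^sup>2 + ?c\<^sup>2"
      by (simp add: power_divide)
    also have "\<dots> \<le> (?s / a)\<^sup>2 + ?c\<^sup>2 + (?s / a)\<^sup>2 + ?c\<^sup>2"
      using zero_le_power2[of "?s / a"] zero_le_power2[of ?c] by linarith
    also have "\<dots> = norm2 \<xi> (undamped \<xi> t)"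
      by (simp add: norm2_def undamped_def a_def[symmetric] memory_energy_def set_lebesgue_integral_def norm_mult
          norm_divide power_divide)
    finally show ?thesis by (simp add: rn_norm_eq)
  qed
  then have "sqrt m \<le> 0"
    by (intro tendsto_lowerbound[OF lim]) auto
  then show False using m by simp
qed

end

theorem theorem3p1:
  fixes \<rho>1 \<rho>2 \<rho>3 k0 k1 k2 k3 \<gamma> l \<beta>1 \<beta>2 :: real
    and g g' :: "real \<Rightarrow> real"
    and \<tau>0 :: nat
  assumes "0 < \<rho>1" "0 < \<rho>2" "0 < \<rho>3" "0 < k0" "0 < k1" "0 < k2" "0 < k3" "0 < \<gamma>" "0 < l"
    and "\<And>s. 0 \<le> s \<Longrightarrow> 0 \<le> g s"
    and "\<And>s. 0 \<le> s \<Longrightarrow> (g has_real_derivative g' s) (at s within {0..})"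
    and "continuous_on {0..} g'"
    and "0 < kernel_mass g" "kernel_mass g < k3"
    and "0 < \<beta>1" "0 < \<beta>2"
    and "\<And>s. 0 \<le> s \<Longrightarrow> - \<beta>2 * g s \<le> g' s \<and> g' s \<le> - \<beta>1 * g s"
    and "\<tau>0 \<in> {0, 1}"
  shows "(k1 / \<rho>1 = k2 / \<rho>2 \<longrightarrow>
            (\<exists>U :: real \<Rightarrow> real \<Rightarrow> rn_state. \<forall>\<xi>.
               rn_compatible l \<xi> (U \<xi> 0) \<and>
               rn_solution \<tau>0 \<rho>1 \<rho>2 \<rho>3 k0 k1 k2 k3 \<gamma> l g \<xi> (U \<xi>) \<and>
               \<not> ((\<lambda>t. rn_norm \<tau>0 g \<xi> (U \<xi> t)) \<longlongrightarrow> 0) at_top)) \<and>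
         (k1 / \<rho>1 \<noteq> k2 / \<rho>2 \<longrightarrow>
            (\<exists>c>0. \<exists>c'>0. \<forall>\<xi>. \<forall>U :: real \<Rightarrow> rn_state.
               rn_compatible l \<xi> (U 0) \<longrightarrow>
               rn_solution \<tau>0 \<rho>1 \<rho>2 \<rho>3 k0 k1 k2 k3 \<gamma> l g \<xi> U \<longrightarrow>
               (\<forall>t\<ge>0. rn_norm \<tau>0 g \<xi> (U t)
                  \<le> c' * exp (- c * (\<xi> ^ (4 + 2 * \<tau>0) / (\<xi> ^ 10 + 1)) * t) * rn_norm \<tau>0 g \<xi> (U 0))))"
proof -
  interpret rao_nakra \<rho>1 \<rho>2 \<rho>3 k0 k1 k2 k3 \<gamma> l \<beta>1 \<beta>2 g g' \<tau>0
    by (rule rao_nakra.intro) (fact assms)+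
  show ?thesis
  proof (intro conjI impI)
    assume "k1 / \<rho>1 = k2 / \<rho>2"
    then show "\<exists>U :: real \<Rightarrow> real \<Rightarrow> rn_state. \<forall>\<xi>. rn_compatible l \<xi> (U \<xi> 0) \<and>
        rn_solution \<tau>0 \<rho>1 \<rho>2 \<rho>3 k0 k1 k2 k3 \<gamma> l g \<xi> (U \<xi>) \<and>
        \<not> ((\<lambda>t. rn_norm \<tau>0 g \<xi> (U \<xi> t)) \<longlongrightarrow> 0) at_top"
      using undamped_solution undamped_not_tendsto_0 by (intro exI[of _ undamped] allI conjI)
  next
    assume "k1 / \<rho>1 \<noteq> k2 / \<rho>2"
    from exponential_decay[OF this]
    show "\<exists>c>0. \<exists>c'>0. \<forall>\<xi>. \<forall>U :: real \<Rightarrow> rn_state. rn_compatible l \<xi> (U 0) \<longrightarrow>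
        rn_solution \<tau>0 \<rho>1 \<rho>2 \<rho>3 k0 k1 k2 k3 \<gamma> l g \<xi> U \<longrightarrow>
        (\<forall>t\<ge>0. rn_norm \<tau>0 g \<xi> (U t)
           \<le> c' * exp (- c * (\<xi> ^ (4 + 2 * \<tau>0) / (\<xi> ^ 10 + 1)) * t) * rn_norm \<tau>0 g \<xi> (U 0))"
      unfolding solution_def by blast
  qed
qed

end
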